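(* Let $k$ be a field, let $\Delta$ be a strongly connected quasi-tree on the vertex set $V=\{v_1,\dots,v_n\}$, with facets $F_1,\dots,F_m$, and let $\alpha=(\alpha_i(j))$ be a collection of positive integers indexed by the pairs $(i,j)$ with $1\le i\le n$, $1\le j\le m$ and $v_i\notin F_j$. If $\alpha$ is $\Delta$-satisfying, then the ideal $$I_{\Delta(\alpha)}=\bigcap_{j=1}^m \left(x_i^{\alpha_i(j)} : v_i\notin F_j\right)\subset R=k[x_1,\dots,x_n]$$ is Cohen-Macaulay (that is, $R/I_{\Delta(\alpha)}$ is a Cohen-Macaulay ring).
   Context: A simplicial complex $\Delta$ on $V=\{v_1,\dots,v_n\}$ is a collection of subsets of $V$ (faces) closed under taking subsets and with $\{v_i\}\in\Delta$ for every $i$; facets are maximal faces, and $<F_1,\dots,F_i>$ denotes the complex generated by $F_1,\dots,F_i$. If $\dim\Delta=d-1$ (largest facets have $d$ elements), $\Delta$ is strongly connected if any two facets $F,G$ are joined by a sequence of facets $F=G_0,G_1,\dots,G_r=G$ with $|G_t\cap G_{t+1}|=d-1$ for all $t$. A facet $F$ of a complex $\Gamma$ is a leaf of $\Gamma$ if either $F$ is the only facet of $\Gamma$, or there is a facet $G\neq F$ of $\Gamma$ such that $H\cap F\subseteq G\cap F$ for all facets $H\ne F$ of $\Gamma$; such a $G$ is called a branch of $F$. $\Delta$ is a quasi-forest if its facets admit a total order $G_1,\dots,G_m$ (a leaf order) such that $G_i$ is a leaf of $<G_1,\dots,G_i>$ for all $i$. A quasi-tree is a connected quasi-forest. Relation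 tree: given a leaf order $G_1,\dots,G_m$ of a strongly connected quasi-tree $\Delta$, and, for each $i=m,m-1,\dots,2$, a choice of branch of $G_i$ in $<G_1,\dots,G_i>$, the relation tree $T(\Delta)$ is the graph whose vertices are the facets of $\Delta$ and whose edges are the pairs consisting of $G_i$ and its chosen branch ($i=2,\dots,m$). It is always a tree, and it depends on the choices. For a relation tree $T(\Delta)$ and $i\in\{1,\dots,n\}$, $T^i(\Delta)$ is the graph whose vertices are the facets $F$ with $v_i\notin F$ together with a new vertex $V_i$, and whose edges are the pairs $\{F,G\}\in E(T(\Delta))$ with $v_i\notin F$, $v_i\notin G$, and the pairs $\{V_i,F\}$ such that there is a facet $G\ni v_i$ with $\{F,G\}\in E(T(\Delta))$. It is a tree. For a tree $G$ and a vertex $v$ of $G$, $(G,v)$ is the directed graph with the same vertices in which $(u_2,u_1)$ is a directed edge iff there is a path $v,u_k,\dots,u_2,u_1$ in $G$ starting at $v$ and ending with the edge from $u_2$ to $u_1$ (edges are directed away from $v$). The collection $\alpha$ is $\Delta$-satisfying if there exists a relation tree $T(\Delta)$ such that, for all $i=1,\dots,n$ and every directed edge $(F_h,F_l)$ of $(T^i(\Delta),V_i)$ between two facets, $\alpha_i(h)\ge\alpha_i(l)$. *)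

theory Defs
  imports
    "HOL-Library.Poly_Mapping"
    "HOL-Library.Extended_Nat"
    "HOL-Algebra.Algebraic_Closure_Type"
begin

section \<open>Simplicial complexes, quasi-trees\<close>

text \<open>
  The vertices \<open>v\<^sub>1, \<dots>, v\<^sub>n\<close> are the elements of a finite type \<open>'n\<close> with
  \<open>n = CARD('n)\<close>; the same type indexes the variables \<open>x\<^sub>1, \<dots>, x\<^sub>n\<close>.
\<close>

definition simplicial_complex :: "'n::finite set set \<Rightarrow> bool" where
  "simplicial_complex \<Delta> \<longleftrightarrow> (\<forall>A\<in>\<Delta>. \<forall>B. B \<subseteq> A \<longrightarrow> B \<in> \<Delta>) \<and> (\<forall>v. {v} \<in> \<Delta>)"

definition facets :: "'n set set \<Rightarrow> 'n set set" where
  "facets \<Delta> = {F \<in> \<Delta>. \<forall>G\<in>\<Delta>. F \<subseteq> G \<longrightarrow> G = F}"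

definition generated_complex :: "'n set set \<Rightarrow> 'n set set" where
  "generated_complex \<F> = {A. \<exists>F\<in>\<F>. A \<subseteq> F}"

definition complex_connected :: "'n set set \<Rightarrow> bool" where
  "complex_connected \<Delta> \<longleftrightarrow>
     (\<forall>F\<in>facets \<Delta>. \<forall>G\<in>facets \<Delta>.
        (\<lambda>A B. A \<in> facets \<Delta> \<and> B \<in> facets \<Delta> \<and> A \<inter> B \<noteq> {})\<^sup>*\<^sup>* F G)"

text \<open>\<open>Max (card ` \<Delta>)\<close> is \<open>d = dim \<Delta> + 1\<close>.\<close>

definition strongly_connected :: "'n::finite set set \<Rightarrow> bool" where
  "strongly_connected \<Delta> \<longleftrightarrow>
     (\<forall>F\<in>facets \<Delta>. \<forall>G\<in>facets \<Delta>.
        (\<lambda>A B. A \<in> facets \<Delta> \<and> B \<in> facets \<Delta> \<and>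
               card (A \<inter> B) = Max (card ` \<Delta>) - 1)\<^sup>*\<^sup>* F G)"

definition is_branch :: "'n set set \<Rightarrow> 'n set \<Rightarrow> 'n set \<Rightarrow> bool" where
  "is_branch \<Gamma> F G \<longleftrightarrow>
     G \<in> facets \<Gamma> \<and> G \<noteq> F \<and> (\<forall>H\<in>facets \<Gamma>. H \<noteq> F \<longrightarrow> H \<inter> F \<subseteq> G \<inter> F)"

definition is_leaf :: "'n set set \<Rightarrow> 'n set \<Rightarrow> bool" where
  "is_leaf \<Gamma> F \<longleftrightarrow> F \<in> facets \<Gamma> \<and> (facets \<Gamma> = {F} \<or> (\<exists>G. is_branch \<Gamma> F G))"

text \<open>
  Orders of the facets are lists; with 0-based indexing, \<open>Gs ! t\<close> is \<open>G\<^sub>t\<^sub>+\<^sub>1\<close> and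
  \<open>set (take (Suc t) Gs)\<close> is \<open>{G\<^sub>1, \<dots>, G\<^sub>t\<^sub>+\<^sub>1}\<close>.
\<close>

definition leaf_order :: "'n set set \<Rightarrow> 'n set list \<Rightarrow> bool" where
  "leaf_order \<Delta> Gs \<longleftrightarrow>
     distinct Gs \<and> set Gs = facets \<Delta> \<and>
     (\<forall>t<length Gs. is_leaf (generated_complex (set (take (Suc t) Gs))) (Gs ! t))"

definition quasi_forest :: "'n::finite set set \<Rightarrow> bool" where
  "quasi_forest \<Delta> \<longleftrightarrow> simplicial_complex \<Delta> \<and> (\<exists>Gs. leaf_order \<Delta> Gs)"

definition quasi_tree :: "'n::finite set set \<Rightarrow> bool" where
  "quasi_tree \<Delta> \<longleftrightarrow> quasi_forest \<Delta> \<and> complex_connected \<Delta>"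


section \<open>Relation trees\<close>

text \<open>A graph is a pair (vertices, edges), edges being two-element sets of vertices.\<close>

type_synonym 'a ugraph = "'a set \<times> 'a set set"

definition relation_tree :: "'n set set \<Rightarrow> 'n set ugraph \<Rightarrow> bool" where
  "relation_tree \<Delta> T \<longleftrightarrow>
     (\<exists>Gs b. leaf_order \<Delta> Gs \<and>
        (\<forall>t. 1 \<le> t \<and> t < length Gs \<longrightarrow>
           is_branch (generated_complex (set (take (Suc t) Gs))) (Gs ! t) (b t)) \<and>
        T = (facets \<Delta>, {{Gs ! t, b t} | t. 1 \<le> t \<and> t < length Gs}))"

text \<open>The graph \<open>T\<^sup>i(\<Delta>)\<close>: a facet \<open>F\<close> is the vertex \<open>Some F\<close>, and \<open>None\<close> is the new vertex \<open>V\<^sub>i\<close>.\<close>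

definition contracted_tree :: "'n set ugraph \<Rightarrow> 'n \<Rightarrow> 'n set option ugraph" where
  "contracted_tree T i =
     (insert None (Some ` {F \<in> fst T. i \<notin> F}),
      {{Some F, Some G} | F G. {F, G} \<in> snd T \<and> i \<notin> F \<and> i \<notin> G} \<union>
      {{None, Some F} | F. F \<in> fst T \<and> i \<notin> F \<and> (\<exists>G \<in> fst T. i \<in> G \<and> {F, G} \<in> snd T)})"

definition graph_path :: "'a ugraph \<Rightarrow> 'a list \<Rightarrow> bool" where
  "graph_path T p \<longleftrightarrow>
     p \<noteq> [] \<and> set p \<subseteq> fst T \<and> distinct p \<and>
     (\<forall>t. Suc t < length p \<longrightarrow> {p ! t, p ! Suc t} \<in> snd T)"

definition directed_away :: "'a ugraph \<Rightarrow> 'a \<Rightarrow> ('a \<times> 'a) set" where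
  "directed_away T v = {(u, w). \<exists>q. graph_path T (q @ [u, w]) \<and> hd (q @ [u, w]) = v}"

definition satisfying ::
    "'n set set \<Rightarrow> (nat \<Rightarrow> 'n set) \<Rightarrow> nat \<Rightarrow> ('n \<Rightarrow> nat \<Rightarrow> nat) \<Rightarrow> bool" where
  "satisfying \<Delta> F m \<alpha> \<longleftrightarrow>
     (\<exists>T. relation_tree \<Delta> T \<and>
        (\<forall>i. \<forall>h\<in>{1..m}. \<forall>l\<in>{1..m}.
           (Some (F h), Some (F l)) \<in> directed_away (contracted_tree T i) None \<longrightarrow>
           \<alpha> i h \<ge> \<alpha> i l))"


section \<open>Cohen-Macaulay rings\<close>

text \<open>
  The localization \<open>S\<inverse>A\<close> of a commutative ring at a multiplicatively closed set: its
  elements are the classes of pairs \<open>(a, s)\<close>, read as \<open>a/s\<close>.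
\<close>

definition frac_rel :: "('a, 'b) ring_scheme \<Rightarrow> 'a set \<Rightarrow> (('a \<times> 'a) \<times> ('a \<times> 'a)) set" where
  "frac_rel A S =
     {((a, s), (b, t)) | a s b t. a \<in> carrier A \<and> b \<in> carrier A \<and> s \<in> S \<and> t \<in> S \<and>
        (\<exists>u\<in>S. u \<otimes>\<^bsub>A\<^esub> (t \<otimes>\<^bsub>A\<^esub> a) = u \<otimes>\<^bsub>A\<^esub> (s \<otimes>\<^bsub>A\<^esub> b))}"

definition loc_frac :: "('a, 'b) ring_scheme \<Rightarrow> 'a set \<Rightarrow> 'a \<Rightarrow> 'a \<Rightarrow> ('a \<times> 'a) set" where
  "loc_frac A S a s = frac_rel A S `` {(a, s)}"

definition localization :: "('a, 'b) ring_scheme \<Rightarrow> 'a set \<Rightarrow> ('a \<times> 'a) set ring" where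
  "localization A S =
     \<lparr>carrier = (carrier A \<times> S) // frac_rel A S,
      monoid.mult = (\<lambda>C D. \<Union>(a, s)\<in>C. \<Union>(b, t)\<in>D. loc_frac A S (a \<otimes>\<^bsub>A\<^esub> b) (s \<otimes>\<^bsub>A\<^esub> t)),
      one = loc_frac A S \<one>\<^bsub>A\<^esub> \<one>\<^bsub>A\<^esub>,
      ring.zero = loc_frac A S \<zero>\<^bsub>A\<^esub> \<one>\<^bsub>A\<^esub>,
      add = (\<lambda>C D. \<Union>(a, s)\<in>C. \<Union>(b, t)\<in>D.
               loc_frac A S ((t \<otimes>\<^bsub>A\<^esub> a) \<oplus>\<^bsub>A\<^esub> (s \<otimes>\<^bsub>A\<^esub> b)) (s \<otimes>\<^bsub>A\<^esub> t))\<rparr>"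

definition krull_dim :: "('a, 'b) ring_scheme \<Rightarrow> enat" where
  "krull_dim A =
     Sup {enat r | r. \<exists>P. (\<forall>i\<le>r. primeideal (P i) A) \<and> (\<forall>i<r. P i \<subset> P (Suc i))}"

text \<open>
  \<open>x\<^sub>1, \<dots>, x\<^sub>r\<close> is a regular sequence on \<open>A\<close> if multiplication by each \<open>x\<^sub>i\<close> is injective on
  \<open>A/(x\<^sub>1, \<dots>, x\<^sub>i\<^sub>-\<^sub>1)\<close> and \<open>A/(x\<^sub>1, \<dots>, x\<^sub>r) \<noteq> 0\<close>.
\<close>

definition regular_seq :: "('a, 'b) ring_scheme \<Rightarrow> 'a list \<Rightarrow> bool" where
  "regular_seq A xs \<longleftrightarrow>
     set xs \<subseteq> carrier A \<and>
     (\<forall>i<length xs. \<forall>a\<in>carrier A.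
        (xs ! i) \<otimes>\<^bsub>A\<^esub> a \<in> Idl\<^bsub>A\<^esub> (set (take i xs)) \<longrightarrow> a \<in> Idl\<^bsub>A\<^esub> (set (take i xs))) \<and>
     Idl\<^bsub>A\<^esub> (set xs) \<noteq> carrier A"

definition depth :: "'a set \<Rightarrow> ('a, 'b) ring_scheme \<Rightarrow> enat" where
  "depth M A = Sup {enat (length xs) | xs. regular_seq A xs \<and> set xs \<subseteq> M}"

definition cohen_macaulay_local :: "('a, 'b) ring_scheme \<Rightarrow> bool" where
  "cohen_macaulay_local A \<longleftrightarrow>
     cring A \<and> noetherian_ring A \<and>
     (\<exists>M. {J. maximalideal J A} = {M} \<and> depth M A = krull_dim A)"

definition cohen_macaulay :: "('a, 'b) ring_scheme \<Rightarrow> bool" where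
  "cohen_macaulay A \<longleftrightarrow>
     cring A \<and> noetherian_ring A \<and>
     (\<forall>P. maximalideal P A \<longrightarrow> cohen_macaulay_local (localization A (carrier A - P)))"


section \<open>The polynomial ring and the ideal\<close>

text \<open>
  \<open>k[x\<^sub>1, \<dots>, x\<^sub>n]\<close>: a monomial is an exponent vector \<open>'n \<Rightarrow>\<^sub>0 nat\<close>, a polynomial a
  finitely supported map from monomials to coefficients, multiplied by convolution.
\<close>

type_synonym ('n, 'k) mpoly = "('n \<Rightarrow>\<^sub>0 nat) \<Rightarrow>\<^sub>0 'k"

definition mpoly_ring :: "('n::finite, 'k::field) mpoly ring" where
  "mpoly_ring = ring_of_type_algebra"

definition poly_var :: "'n::finite \<Rightarrow> ('n, 'k::field) mpoly" where
  "poly_var i = Poly_Mapping.single (Poly_Mapping.single i 1) 1"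

definition complex_ideal ::
    "(nat \<Rightarrow> 'n::finite set) \<Rightarrow> nat \<Rightarrow> ('n \<Rightarrow> nat \<Rightarrow> nat) \<Rightarrow> ('n, 'k::field) mpoly set" where
  "complex_ideal F m \<alpha> =
     (\<Inter>j\<in>{1..m}. Idl\<^bsub>mpoly_ring\<^esub> {poly_var i ^ \<alpha> i j | i. i \<notin> F j})"

end

theory Submission
  imports Defs
begin

text \<open>
  Write \<open>R = k[x\<^sub>1, \<dots>, x\<^sub>n]\<close> and let \<open>G\<^sub>0, \<dots>, G\<^sub>m\<^sub>-\<^sub>1\<close> be the facets in a leaf order that defines the relation tree,
  \<open>Q\<^sub>t = (x\<^sub>i ^ \<alpha>\<^sub>i(t) : i \<notin> G\<^sub>t)\<close> and \<open>I\<^sub>t = Q\<^sub>0 \<inter> \<dots> \<inter> Q\<^sub>t\<close>. The ideal in question is \<open>I = I\<^sub>m\<^sub>-\<^sub>1\<close>.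

  Combinatorics. A strongly connected complex is pure, and removing the last facet of a leaf order keeps
  it strongly connected, so \<open>G\<^sub>t\<close> arises from its branch \<open>G\<^sub>b\<close> by exchanging one vertex for a new vertex \<open>w\<close>
  that no earlier facet contains. Two consequences are drawn. The vertices can be coloured such that every
  facet has exactly one vertex of each colour (\<open>colouring_exists\<close>). And the condition on \<open>\<alpha>\<close>, read along
  paths of the relation tree, compares exponents (\<open>exponent_new_vertex\<close>, \<open>exponent_old_vertex\<close>): if \<open>Z\<close> is
  the set of those \<open>i \<notin> G\<^sub>t \<union> G\<^sub>b\<close> with \<open>\<alpha>\<^sub>i(b) < \<alpha>\<^sub>i(t)\<close>, then \<open>x\<^sub>i ^ \<alpha>\<^sub>i(b)\<close> lies in \<open>I\<^sub>t\<^sub>-\<^sub>1\<close> for \<open>i = w\<close> and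
  \<open>i \<in> Z\<close>, and together with \<open>Q\<^sub>t\<close> these powers generate an ideal that contains \<open>Q\<^sub>b\<close>. By the modular law
  \<open>I\<^sub>t\<^sub>-\<^sub>1\<close> is \<open>I\<^sub>t\<close> plus these powers. Adding them one at a time filters \<open>I\<^sub>t\<^sub>-\<^sub>1/I\<^sub>t\<close> with quotients \<open>R/Q'\<close>, where
  each \<open>Q'\<close> is again generated by powers of all the variables outside \<open>G\<^sub>t\<close> (\<open>regular_at_intersection\<close>).

  Depth. Let \<open>y\<^sub>c\<close> be the sum of the variables of colour \<open>c\<close>, let \<open>P\<close> be a prime over \<open>I\<close>, and go through
  the \<open>d\<close> colours in some order. For each colour there are two cases: either \<open>P\<close> contains a polynomial in the
  \<open>y\<close>'s seen so far whose leading coefficient in \<open>y\<^sub>c\<close> lies outside \<open>P\<close>, and this polynomial is recorded, or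
  \<open>y\<^sub>c\<close> is independent modulo \<open>P\<close> of the independent elements found before (\<open>triangular_indep_split\<close>).
  Since a facet has just one vertex of each colour, \<open>y\<^sub>c\<close> can replace that vertex as a variable of \<open>R\<close>, and a
  polynomial with a leading coefficient outside \<open>P\<close> is regular at \<open>P\<close> modulo any ideal generated by elements free of \<open>y\<^sub>c\<close>; so the
  recorded polynomials form a regular sequence at \<open>P\<close> on each \<open>R/Q'\<close> (\<open>regular_at_box\<close>). Regularity passes
  to the middle term of a short exact sequence (\<open>regular_at_colon\<close>), hence along the filtrations to \<open>R/I\<close>.

  Dimension. A chain of \<open>r + 1\<close> primes between \<open>I\<close> and \<open>P\<close>, together with the \<open>e\<close> independent \<open>y\<^sub>c\<close>, gives \<open>r + e\<close>
  elements that are algebraically independent modulo the lowest prime (\<open>alg_indep_Cons\<close>). That prime contains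
  all variables outside some facet, so counting monomials yields \<open>r + e \<le> d\<close> (\<open>alg_indep_length_le\<close>). Thus
  \<open>r\<close> is at most the number \<open>d - e\<close> of recorded polynomials. As depth never exceeds dimension
  (\<open>depth_le_krull_dim\<close>), both are equal to \<open>d - e\<close>. The remaining condition, that \<open>R\<close> is noetherian, is Hilbert's basis theorem.
\<close>


section \<open>Localization of a commutative ring\<close>

locale mult_set = cring R for R (structure) +
  fixes S
  assumes S_sub: "S \<subseteq> carrier R"
    and S_one: "\<one> \<in> S"
    and S_mult: "s \<in> S \<Longrightarrow> t \<in> S \<Longrightarrow> s \<otimes> t \<in> S"
begin

lemma S_carr [simp]: "s \<in> S \<Longrightarrow> s \<in> carrier R"
  using S_sub by blast

abbreviation fr where "fr \<equiv> loc_frac R S"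
abbreviation L where "L \<equiv> localization R S"

lemma frac_rel_iff:
  "((a, s), (b, t)) \<in> frac_rel R S \<longleftrightarrow> a \<in> carrier R \<and> b \<in> carrier R \<and> s \<in> S \<and> t \<in> S \<and>
        (\<exists>u\<in>S. u \<otimes> (t \<otimes> a) = u \<otimes> (s \<otimes> b))"
  unfolding frac_rel_def by auto

lemma equiv_frac_rel: "equiv (carrier R \<times> S) (frac_rel R S)"
proof (rule equivI)
  show "frac_rel R S \<subseteq> (carrier R \<times> S) \<times> carrier R \<times> S"
    by (auto simp: frac_rel_def)
  show "refl_on (carrier R \<times> S) (frac_rel R S)"
    using S_one by (auto simp: refl_on_def frac_rel_iff)
  show "sym (frac_rel R S)"
    proof (rule symI, clarify)
    fix a s b t assume "((a, s), (b, t)) \<in> frac_rel R S"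
    then show "((b, t), (a, s)) \<in> frac_rel R S" by (metis frac_rel_iff)
  qed
  show "trans (frac_rel R S)"
  proof (rule transI, clarify)
    fix a s b t c r
    assume 1: "((a, s), (b, t)) \<in> frac_rel R S" and 2: "((b, t), (c, r)) \<in> frac_rel R S"
    obtain u where u: "u \<in> S" "u \<otimes> (t \<otimes> a) = u \<otimes> (s \<otimes> b)"
      and c: "a \<in> carrier R" "b \<in> carrier R" "c \<in> carrier R" "s \<in> S" "t \<in> S" "r \<in> S"
      using 1 2 by (auto simp: frac_rel_iff)
    obtain v where v: "v \<in> S" "v \<otimes> (r \<otimes> b) = v \<otimes> (t \<otimes> c)"
      using 2 by (auto simp: frac_rel_iff)
    have "(u \<otimes> v \<otimes> t) \<otimes> (r \<otimes> a) = (v \<otimes> r) \<otimes> (u \<otimes> (t \<otimes> a))"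
      using c u(1) v(1) by (simp add: m_ac)
    also have "\<dots> = (u \<otimes> s) \<otimes> (v \<otimes> (r \<otimes> b))"
      unfolding u(2) using c u(1) v(1) by (simp add: m_ac)
    also have "\<dots> = (u \<otimes> v \<otimes> t) \<otimes> (s \<otimes> c)"
      unfolding v(2) using c u(1) v(1) by (simp add: m_ac)
    finally show "((a, s), (c, r)) \<in> frac_rel R S"
      using c u(1) v(1) S_mult by (auto simp: frac_rel_iff intro!: bexI[of _ "u \<otimes> v \<otimes> t"])
  qed
qed

lemma fr_eq_iff:
  assumes "a \<in> carrier R" "b \<in> carrier R" "s \<in> S" "t \<in> S"
  shows "fr a s = fr b t \<longleftrightarrow> (\<exists>u\<in>S. u \<otimes> (t \<otimes> a) = u \<otimes> (s \<otimes> b))"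
  using eq_equiv_class_iff[OF equiv_frac_rel, of "(a,s)" "(b,t)"] assms
  by (auto simp: loc_frac_def frac_rel_iff)

lemma fr_eqI:
  assumes "a \<in> carrier R" "b \<in> carrier R" "s \<in> S" "t \<in> S" "t \<otimes> a = s \<otimes> b"
  shows "fr a s = fr b t"
  using fr_eq_iff[OF assms(1-4)] assms(5) S_one by auto

lemma in_fr_iff: "(b, t) \<in> fr a s \<longleftrightarrow> a \<in> carrier R \<and> b \<in> carrier R \<and> s \<in> S \<and> t \<in> S \<and> fr a s = fr b t"
proof (cases "a \<in> carrier R \<and> b \<in> carrier R \<and> s \<in> S \<and> t \<in> S")
  case True then show ?thesis using fr_eq_iff by (auto simp: loc_frac_def frac_rel_iff)
next
  case False then show ?thesis by (auto simp: loc_frac_def frac_rel_iff)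
qed

lemma carrier_L: "carrier L = {fr a s | a s. a \<in> carrier R \<and> s \<in> S}"
  by (auto simp: localization_def quotient_def loc_frac_def)

lemma carrier_LE:
  assumes "x \<in> carrier L" obtains a s where "a \<in> carrier R" "s \<in> S" "x = fr a s"
  using assms carrier_L by auto

lemma fr_carr [simp]: "a \<in> carrier R \<Longrightarrow> s \<in> S \<Longrightarrow> fr a s \<in> carrier L"
  by (auto simp: carrier_L)

lemma one_L: "\<one>\<^bsub>L\<^esub> = fr \<one> \<one>" and zero_L: "\<zero>\<^bsub>L\<^esub> = fr \<zero> \<one>"
  by (simp_all add: localization_def)

lemma mult_L:
  assumes "a \<in> carrier R" "b \<in> carrier R" "s \<in> S" "t \<in> S"
  shows "fr a s \<otimes>\<^bsub>L\<^esub> fr b t = fr (a \<otimes> b) (s \<otimes> t)"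
proof -
  have 1: "fr (a' \<otimes> b') (s' \<otimes> t') = fr (a \<otimes> b) (s \<otimes> t)"
    if "(a', s') \<in> fr a s" "(b', t') \<in> fr b t" for a' s' b' t'
  proof -
    have c: "a' \<in> carrier R" "b' \<in> carrier R" "s' \<in> S" "t' \<in> S" and e: "fr a s = fr a' s'" "fr b t = fr b' t'"
      using that by (auto simp: in_fr_iff)
    obtain u v where u: "u \<in> S" "u \<otimes> (s' \<otimes> a) = u \<otimes> (s \<otimes> a')" and v: "v \<in> S" "v \<otimes> (t' \<otimes> b) = v \<otimes> (t \<otimes> b')"
      using e assms c by (auto simp: fr_eq_iff)
    have "(u \<otimes> v) \<otimes> ((s' \<otimes> t') \<otimes> (a \<otimes> b)) = (u \<otimes> (s' \<otimes> a)) \<otimes> (v \<otimes> (t' \<otimes> b))"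
      using assms c u(1) v(1) by (simp add: m_ac)
    also have "\<dots> = (u \<otimes> v) \<otimes> ((s \<otimes> t) \<otimes> (a' \<otimes> b'))"
      unfolding u(2) v(2) using assms c u(1) v(1) by (simp add: m_ac)
    finally show ?thesis
      using assms c u(1) v(1) S_mult
      by (subst fr_eq_iff) (auto intro!: bexI[of _ "u \<otimes> v"])
  qed
  have "fr a s \<otimes>\<^bsub>L\<^esub> fr b t = (\<Union>(a', s')\<in>fr a s. \<Union>(b', t')\<in>fr b t. fr (a' \<otimes> b') (s' \<otimes> t'))"
    by (simp add: localization_def)
  also have "\<dots> = fr (a \<otimes> b) (s \<otimes> t)"
  proof -
    have "(a, s) \<in> fr a s" "(b, t) \<in> fr b t" using assms by (auto simp: in_fr_iff)
    then show ?thesis using 1 by fast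
  qed
  finally show ?thesis .
qed

lemma add_L:
  assumes "a \<in> carrier R" "b \<in> carrier R" "s \<in> S" "t \<in> S"
  shows "fr a s \<oplus>\<^bsub>L\<^esub> fr b t = fr ((t \<otimes> a) \<oplus> (s \<otimes> b)) (s \<otimes> t)"
proof -
  have 1: "fr ((t' \<otimes> a') \<oplus> (s' \<otimes> b')) (s' \<otimes> t') = fr ((t \<otimes> a) \<oplus> (s \<otimes> b)) (s \<otimes> t)"
    if "(a', s') \<in> fr a s" "(b', t') \<in> fr b t" for a' s' b' t'
  proof -
    have c: "a' \<in> carrier R" "b' \<in> carrier R" "s' \<in> S" "t' \<in> S" and e: "fr a s = fr a' s'" "fr b t = fr b' t'"
      using that by (auto simp: in_fr_iff)
    obtain u v where u: "u \<in> S" "u \<otimes> (s' \<otimes> a) = u \<otimes> (s \<otimes> a')" and v: "v \<in> S" "v \<otimes> (t' \<otimes> b) = v \<otimes> (t \<otimes> b')"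
      using e assms c by (auto simp: fr_eq_iff)
    have "(u \<otimes> v) \<otimes> ((s' \<otimes> t') \<otimes> ((t \<otimes> a) \<oplus> (s \<otimes> b)))
       = (v \<otimes> (t \<otimes> t')) \<otimes> (u \<otimes> (s' \<otimes> a)) \<oplus> (u \<otimes> (s \<otimes> s')) \<otimes> (v \<otimes> (t' \<otimes> b))"
      using assms c u(1) v(1) by (simp add: m_ac r_distr)
    also have "\<dots> = (u \<otimes> v) \<otimes> ((s \<otimes> t) \<otimes> ((t' \<otimes> a') \<oplus> (s' \<otimes> b')))"
      unfolding u(2) v(2) using assms c u(1) v(1) by (simp add: m_ac r_distr)
    finally show ?thesis
      using assms c u(1) v(1) S_mult
      by (subst fr_eq_iff) (auto intro!: bexI[of _ "u \<otimes> v"])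
  qed
  have "fr a s \<oplus>\<^bsub>L\<^esub> fr b t = (\<Union>(a', s')\<in>fr a s. \<Union>(b', t')\<in>fr b t. fr ((t' \<otimes> a') \<oplus> (s' \<otimes> b')) (s' \<otimes> t'))"
    by (simp add: localization_def)
  also have "\<dots> = fr ((t \<otimes> a) \<oplus> (s \<otimes> b)) (s \<otimes> t)"
  proof -
    have "(a, s) \<in> fr a s" "(b, t) \<in> fr b t" using assms by (auto simp: in_fr_iff)
    then show ?thesis using 1 by fast
  qed
  finally show ?thesis .
qed

lemmas L_simps = mult_L add_L one_L zero_L S_one S_mult

lemma cring_L: "cring L"
proof (rule cringI)
  show "abelian_group L"
  proof (rule abelian_groupI)
    fix x assume "x \<in> carrier L"
    then obtain a s where x: "a \<in> carrier R" "s \<in> S" "x = fr a s" by (rule carrier_LE)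
    have "fr (\<ominus> a) s \<oplus>\<^bsub>L\<^esub> x = \<zero>\<^bsub>L\<^esub>"
      using x by (simp add: L_simps, intro fr_eqI) (auto simp: L_simps r_minus l_neg)
    then show "\<exists>y\<in>carrier L. y \<oplus>\<^bsub>L\<^esub> x = \<zero>\<^bsub>L\<^esub>" using x by (intro bexI[of _ "fr (\<ominus> a) s"]) auto
    show "\<zero>\<^bsub>L\<^esub> \<oplus>\<^bsub>L\<^esub> x = x"
      using x by (simp add: L_simps)
  next
    show "\<zero>\<^bsub>L\<^esub> \<in> carrier L" by (simp add: L_simps)
  next
    fix x y assume "x \<in> carrier L" "y \<in> carrier L"
    then obtain a s b t where x: "a \<in> carrier R" "s \<in> S" "x = fr a s" "b \<in> carrier R" "t \<in> S" "y = fr b t"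
      by (metis carrier_LE)
    then show "x \<oplus>\<^bsub>L\<^esub> y \<in> carrier L" by (simp add: L_simps)
    show "x \<oplus>\<^bsub>L\<^esub> y = y \<oplus>\<^bsub>L\<^esub> x"
      using x by (simp add: L_simps a_ac m_ac)
    fix z assume "z \<in> carrier L"
    then obtain c r where z: "c \<in> carrier R" "r \<in> S" "z = fr c r" by (rule carrier_LE)
    show "x \<oplus>\<^bsub>L\<^esub> y \<oplus>\<^bsub>L\<^esub> z = x \<oplus>\<^bsub>L\<^esub> (y \<oplus>\<^bsub>L\<^esub> z)"
      using x z by (simp add: L_simps a_ac m_ac r_distr)
  qed
  show "comm_monoid L"
  proof (rule comm_monoidI)
    fix x y assume "x \<in> carrier L" "y \<in> carrier L"
    then obtain a s b t where x: "a \<in> carrier R" "s \<in> S" "x = fr a s" "b \<in> carrier R" "t \<in> S" "y = fr b t"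
      by (metis carrier_LE)
    then show "x \<otimes>\<^bsub>L\<^esub> y \<in> carrier L" by (simp add: L_simps)
    show "x \<otimes>\<^bsub>L\<^esub> y = y \<otimes>\<^bsub>L\<^esub> x"
      using x by (simp add: L_simps m_ac)
    fix z assume "z \<in> carrier L"
    then obtain c r where z: "c \<in> carrier R" "r \<in> S" "z = fr c r" by (rule carrier_LE)
    show "x \<otimes>\<^bsub>L\<^esub> y \<otimes>\<^bsub>L\<^esub> z = x \<otimes>\<^bsub>L\<^esub> (y \<otimes>\<^bsub>L\<^esub> z)"
      using x z by (simp add: L_simps m_ac)
  next
    show "\<one>\<^bsub>L\<^esub> \<in> carrier L" by (simp add: L_simps)
  next
    fix x assume "x \<in> carrier L"
    then obtain a s where x: "a \<in> carrier R" "s \<in> S" "x = fr a s" by (rule carrier_LE)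
    then show "\<one>\<^bsub>L\<^esub> \<otimes>\<^bsub>L\<^esub> x = x" by (simp add: L_simps)
  qed
  fix x y z assume "x \<in> carrier L" "y \<in> carrier L" "z \<in> carrier L"
  then obtain a s b t c r where x: "a \<in> carrier R" "s \<in> S" "x = fr a s" "b \<in> carrier R" "t \<in> S" "y = fr b t"
     "c \<in> carrier R" "r \<in> S" "z = fr c r"
    by (metis carrier_LE)
  show "(x \<oplus>\<^bsub>L\<^esub> y) \<otimes>\<^bsub>L\<^esub> z = x \<otimes>\<^bsub>L\<^esub> z \<oplus>\<^bsub>L\<^esub> y \<otimes>\<^bsub>L\<^esub> z"
    using x by (simp add: L_simps, intro fr_eqI) (auto simp: L_simps m_ac r_distr)
qed

interpretation L: cring L by (rule cring_L)

definition contraction where "contraction J = {a \<in> carrier R. fr a \<one> \<in> J}"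

lemma fr_in_ideal_iff:
  assumes "ideal J L" "a \<in> carrier R" "s \<in> S"
  shows "fr a s \<in> J \<longleftrightarrow> a \<in> contraction J"
proof
  interpret J: ideal J L by fact
  assume "fr a s \<in> J"
  then have "fr s \<one> \<otimes>\<^bsub>L\<^esub> fr a s \<in> J" using assms by (intro J.I_l_closed) (auto simp: L_simps)
  also have "fr s \<one> \<otimes>\<^bsub>L\<^esub> fr a s = fr a \<one>"
    using assms by (simp add: L_simps, intro fr_eqI) (auto simp: L_simps m_ac)
  finally show "a \<in> contraction J" using assms by (simp add: contraction_def)
next
  interpret J: ideal J L by fact
  assume "a \<in> contraction J"
  then have "fr \<one> s \<otimes>\<^bsub>L\<^esub> fr a \<one> \<in> J" using assms by (intro J.I_l_closed) (auto simp: L_simps contraction_def)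
  then show "fr a s \<in> J" using assms by (simp add: L_simps)
qed

lemma contraction_ideal:
  assumes "ideal J L" shows "ideal (contraction J) R"
proof -
  interpret J: ideal J L by fact
  have add: "a \<oplus> b \<in> contraction J" if "a \<in> contraction J" "b \<in> contraction J" for a b
  proof -
    have "fr a \<one> \<oplus>\<^bsub>L\<^esub> fr b \<one> \<in> J" using that by (intro J.a_closed) (auto simp: contraction_def)
    then show ?thesis using that by (auto simp: contraction_def L_simps)
  qed
  have mul: "x \<otimes> a \<in> contraction J" if "a \<in> contraction J" "x \<in> carrier R" for a x
  proof -
    have "fr x \<one> \<otimes>\<^bsub>L\<^esub> fr a \<one> \<in> J" using that by (intro J.I_l_closed) (auto simp: contraction_def L_simps)
    then show ?thesis using that by (auto simp: contraction_def L_simps)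
  qed
  have car: "a \<in> contraction J \<Longrightarrow> a \<in> carrier R" for a by (auto simp: contraction_def)
  show ?thesis
  proof (rule idealI[OF ring_axioms])
    show "subgroup (contraction J) (add_monoid R)"
    proof (rule add.subgroupI)
      show "contraction J \<subseteq> carrier R" using car by auto
      show "contraction J \<noteq> {}" using J.zero_closed by (auto simp: contraction_def zero_L)
    next
      fix a assume a: "a \<in> contraction J"
      then have "\<ominus> \<one> \<otimes> a \<in> contraction J" by (intro mul) auto
      then show "\<ominus> a \<in> contraction J" using a car by (simp add: l_minus)
    qed (use add in auto)
  next
    fix a x assume "a \<in> contraction J" "x \<in> carrier R"
    then show "x \<otimes> a \<in> contraction J" "a \<otimes> x \<in> contraction J"
      using mul car by (auto simp: m_comm)
  qed
qed

lemma contraction_mono: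
  assumes "ideal J L" "ideal K L" "J \<subset> K" shows "contraction J \<subset> contraction K"
proof -
  obtain x where x: "x \<in> K" "x \<notin> J" using assms by auto
  then have "x \<in> carrier L" using assms(2) by (meson additive_subgroup.a_Hcarr ideal.axioms(1))
  then obtain a s where a: "a \<in> carrier R" "s \<in> S" "x = fr a s" by (rule carrier_LE)
  have "a \<in> contraction K" "a \<notin> contraction J" using a x assms fr_in_ideal_iff by auto
  moreover have "contraction J \<subseteq> contraction K" using assms by (auto simp: contraction_def)
  ultimately show ?thesis by auto
qed

lemma contraction_prime:
  assumes "primeideal J L" shows "primeideal (contraction J) R" "contraction J \<inter> S = {}"
proof -
  interpret J: primeideal J L by fact
  have J: "ideal J L" by (rule J.is_ideal)
  show 2: "contraction J \<inter> S = {}"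
  proof (rule ccontr)
    assume "contraction J \<inter> S \<noteq> {}"
    then obtain s where s: "s \<in> S" "s \<in> contraction J" by auto
    then have "fr s s \<in> J" using fr_in_ideal_iff[OF J] by auto
    also have "fr s s = \<one>\<^bsub>L\<^esub>" using s unfolding one_L by (intro fr_eqI) (auto simp: L_simps)
    finally show False using J.one_imp_carrier J.I_notcarr by auto
  qed
  show "primeideal (contraction J) R"
  proof (rule primeidealI[OF contraction_ideal[OF J] is_cring])
    show "carrier R \<noteq> contraction J" using 2 S_one by auto
    fix a b assume ab: "a \<in> carrier R" "b \<in> carrier R" "a \<otimes> b \<in> contraction J"
    then have "fr a \<one> \<otimes>\<^bsub>L\<^esub> fr b \<one> \<in> J" by (simp add: contraction_def L_simps)
    then have "fr a \<one> \<in> J \<or> fr b \<one> \<in> J" using ab by (intro J.I_prime) (auto simp: L_simps)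
    then show "a \<in> contraction J \<or> b \<in> contraction J" using ab by (auto simp: contraction_def)
  qed
qed

text \<open>
  The fractions whose numerator some element of \<open>S\<close> multiplies into \<open>Idl B\<close> already form an ideal, and
  this property of a fraction does not depend on the representative.
\<close>

lemma Idl_L_iff:
  assumes B: "B \<subseteq> carrier R" and a: "a \<in> carrier R" "s \<in> S"
  shows "fr a s \<in> Idl\<^bsub>L\<^esub> ((\<lambda>a. fr a \<one>) ` B) \<longleftrightarrow> (\<exists>t\<in>S. t \<otimes> a \<in> Idl B)"
proof -
  let ?i = "\<lambda>a. fr a \<one>"
  have iX: "?i ` B \<subseteq> carrier L" using B S_one by auto
  have K: "ideal (Idl\<^bsub>L\<^esub> (?i ` B)) L" by (rule L.genideal_ideal[OF iX])
  have IX: "ideal (Idl B) R" by (rule genideal_ideal[OF B])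
  interpret IX: ideal "Idl B" R by fact
  show ?thesis
  proof
    define D where "D = {fr a s | a s. a \<in> carrier R \<and> s \<in> S \<and> (\<exists>t\<in>S. t \<otimes> a \<in> Idl B)}"
    have D_iff: "fr a s \<in> D \<longleftrightarrow> (\<exists>t\<in>S. t \<otimes> a \<in> Idl B)" if ac: "a \<in> carrier R" "s \<in> S" for a s
    proof
      assume "fr a s \<in> D"
      then obtain b t u where b: "b \<in> carrier R" "t \<in> S" "u \<in> S" "u \<otimes> b \<in> Idl B" "fr a s = fr b t"
        unfolding D_def by auto
      then obtain v where v: "v \<in> S" "v \<otimes> (t \<otimes> a) = v \<otimes> (s \<otimes> b)"
        using fr_eq_iff[of a b s t] ac by auto
      have "(u \<otimes> v \<otimes> t) \<otimes> a = u \<otimes> (v \<otimes> (t \<otimes> a))" using b ac v(1) by (simp add: m_ac)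
      also have "\<dots> = (v \<otimes> s) \<otimes> (u \<otimes> b)" unfolding v(2) using b ac v(1) by (simp add: m_ac)
      also have "\<dots> \<in> Idl B" using b ac v(1) by (intro IX.I_l_closed[OF b(4)]) auto
      finally show "\<exists>t\<in>S. t \<otimes> a \<in> Idl B" using b v(1) S_mult by (intro bexI[of _ "u \<otimes> v \<otimes> t"]) auto
    qed (use ac in \<open>auto simp: D_def\<close>)
    have DE: "\<exists>a s. x = fr a s \<and> a \<in> carrier R \<and> s \<in> S \<and> (\<exists>t\<in>S. t \<otimes> a \<in> Idl B)" if "x \<in> D" for x
      using that unfolding D_def by auto
    have mul: "x \<otimes>\<^bsub>L\<^esub> y \<in> D" if yx: "y \<in> D" "x \<in> carrier L" for x y
    proof -
      obtain a s t where y: "y = fr a s" "a \<in> carrier R" "s \<in> S" "t \<in> S" "t \<otimes> a \<in> Idl B" using DE[OF yx(1)] by auto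
      obtain b r where x: "b \<in> carrier R" "r \<in> S" "x = fr b r" using yx(2) by (rule carrier_LE)
      have "b \<otimes> (t \<otimes> a) \<in> Idl B" using x y by (intro IX.I_l_closed[OF y(5)]) auto
      then have "t \<otimes> (b \<otimes> a) \<in> Idl B" using x y by (simp add: m_ac)
      then show ?thesis using x y by (auto simp: L_simps D_iff)
    qed
    have DC: "D \<subseteq> carrier L" by (auto simp: D_def)
    have D: "ideal D L"
    proof (rule idealI[OF L.ring_axioms])
      show "subgroup D (add_monoid L)"
      proof (rule L.add.subgroupI)
        have "fr \<zero> \<one> \<in> D" using S_one IX.zero_closed by (subst D_iff) auto
        then show "D \<noteq> {}" by auto
        fix x assume x: "x \<in> D"
        then have "\<ominus>\<^bsub>L\<^esub> \<one>\<^bsub>L\<^esub> \<otimes>\<^bsub>L\<^esub> x \<in> D" by (intro mul) auto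
        then show "\<ominus>\<^bsub>L\<^esub> x \<in> D" using x DC by (auto simp: L.l_minus)
        fix y assume "y \<in> D"
        with x obtain a s t b r u where y: "x = fr a s" "a \<in> carrier R" "s \<in> S" "t \<in> S" "t \<otimes> a \<in> Idl B"
          "y = fr b r" "b \<in> carrier R" "r \<in> S" "u \<in> S" "u \<otimes> b \<in> Idl B" using DE by metis
        have "(u \<otimes> r) \<otimes> (t \<otimes> a) \<oplus> (t \<otimes> s) \<otimes> (u \<otimes> b) \<in> Idl B"
          using y by (intro IX.a_closed IX.I_l_closed[OF y(5)] IX.I_l_closed[OF y(10)]) auto
        then have "(t \<otimes> u) \<otimes> (r \<otimes> a \<oplus> s \<otimes> b) \<in> Idl B" using y by (simp add: m_ac r_distr)
        then show "x \<oplus>\<^bsub>L\<^esub> y \<in> D" using y S_mult by (auto simp: L_simps D_iff intro!: bexI[of _ "t \<otimes> u"])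
      qed (use DC in auto)
      fix a x assume "a \<in> D" "x \<in> carrier L"
      then show "x \<otimes>\<^bsub>L\<^esub> a \<in> D" "a \<otimes>\<^bsub>L\<^esub> x \<in> D"
        using mul[of a x] DC L.m_comm[of a x] by auto
    qed
    have "?i ` B \<subseteq> D"
    proof
      fix y assume "y \<in> ?i ` B"
      then obtain x where x: "x \<in> B" "y = fr x \<one>" by auto
      have "\<one> \<otimes> x \<in> Idl B" using x B genideal_self[OF B] by auto
      moreover have "x \<in> carrier R" using x B by auto
      ultimately show "y \<in> D" using D_iff S_one x(2) by blast
    qed
    then have "Idl\<^bsub>L\<^esub> (?i ` B) \<subseteq> D" by (rule L.genideal_minimal[OF D])
    then show "fr a s \<in> Idl\<^bsub>L\<^esub> (?i ` B) \<Longrightarrow> \<exists>t\<in>S. t \<otimes> a \<in> Idl B"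
      using D_iff a by auto
  next
    assume "\<exists>t\<in>S. t \<otimes> a \<in> Idl B"
    then obtain t where t: "t \<in> S" "t \<otimes> a \<in> Idl B" by auto
    have "B \<subseteq> contraction (Idl\<^bsub>L\<^esub> (?i ` B))"
      using B L.genideal_self[OF iX] by (auto simp: contraction_def)
    then have "Idl B \<subseteq> contraction (Idl\<^bsub>L\<^esub> (?i ` B))"
      by (rule genideal_minimal[OF contraction_ideal[OF K]])
    with t have "t \<otimes> a \<in> contraction (Idl\<^bsub>L\<^esub> (?i ` B))" by auto
    then have "fr (t \<otimes> a) (t \<otimes> s) \<in> Idl\<^bsub>L\<^esub> (?i ` B)"
      using fr_in_ideal_iff[OF K] t a S_mult by auto
    also have "fr (t \<otimes> a) (t \<otimes> s) = fr a s"
      using t a S_mult by (intro fr_eqI) (auto simp: m_ac)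
    finally show "fr a s \<in> Idl\<^bsub>L\<^esub> (?i ` B)" .
  qed
qed

text \<open>
  An ideal of the localization is determined by its contraction, so generators of the contraction do.
\<close>

lemma noetherian_L:
  assumes "noetherian_ring R" shows "noetherian_ring L"
proof (rule L.noetherian_ringI)
  fix J assume J: "ideal J L"
  interpret N: noetherian_ring R by fact
  obtain A where A: "A \<subseteq> carrier R" "finite A" "contraction J = Idl A"
    using N.finetely_gen[OF contraction_ideal[OF J]] by auto
  let ?i = "\<lambda>a. fr a \<one>"
  have iA: "?i ` A \<subseteq> carrier L" using A S_one by auto
  have "?i ` A \<subseteq> J" using genideal_self[OF A(1)] A(3) by (auto simp: contraction_def)
  then have 1: "Idl\<^bsub>L\<^esub> (?i ` A) \<subseteq> J" by (rule L.genideal_minimal[OF J])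
  have "J \<subseteq> Idl\<^bsub>L\<^esub> (?i ` A)"
  proof
    fix x assume x: "x \<in> J"
    then have "x \<in> carrier L" using J by (meson additive_subgroup.a_Hcarr ideal.axioms(1))
    then obtain a s where a: "a \<in> carrier R" "s \<in> S" "x = fr a s" by (rule carrier_LE)
    then have "\<one> \<otimes> a \<in> Idl A" using x fr_in_ideal_iff[OF J] A by auto
    then show "x \<in> Idl\<^bsub>L\<^esub> (?i ` A)" using Idl_L_iff[OF A(1) a(1,2)] a(3) S_one by blast
  qed
  with 1 show "\<exists>A\<subseteq>carrier L. finite A \<and> J = Idl\<^bsub>L\<^esub> A"
    using iA A by (intro exI[of _ "?i ` A"]) auto
qed

end

section \<open>Prime ideals, depth and dimension\<close>

text \<open>
  An ideal that is maximal among those containing \<open>I\<close> and avoiding \<open>T\<close> is prime: adjoining an element outside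
  it produces an element of \<open>T\<close>, and the product of two elements of \<open>T\<close> produced by \<open>a\<close> and by \<open>b\<close> would lie in
  the ideal if \<open>a \<otimes> b\<close> did.
\<close>

lemma (in cring) prime_disjoint_exists:
  assumes I: "ideal I R" and T: "T \<subseteq> carrier R" "\<one> \<in> T"
    and Tm: "\<And>s t. s \<in> T \<Longrightarrow> t \<in> T \<Longrightarrow> s \<otimes> t \<in> T" and dis: "I \<inter> T = {}"
  shows "\<exists>Q. primeideal Q R \<and> I \<subseteq> Q \<and> Q \<inter> T = {}"
proof -
  let ?A = "{J. ideal J R \<and> I \<subseteq> J \<and> J \<inter> T = {}}"
  have "\<exists>M\<in>?A. \<forall>J\<in>?A. M \<subseteq> J \<longrightarrow> J = M"
  proof (rule subset_Zorn_nonempty)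
    have "I \<in> ?A" using I dis by simp
    then show "?A \<noteq> {}" by blast
    fix C assume C: "C \<noteq> {}" "subset.chain ?A C"
    then have "subset.chain {I. ideal I R} C" by (auto simp: pred_on.chain_def)
    from chain_Union_is_ideal[OF this] have "ideal (\<Union>C) R" using C by simp
    moreover have "C \<subseteq> ?A" using C by (auto simp: pred_on.chain_def)
    ultimately show "\<Union>C \<in> ?A" using C(1) by auto
  qed
  then obtain M where MA: "M \<in> ?A" and MM: "\<forall>J\<in>?A. M \<subseteq> J \<longrightarrow> J = M" ..
  have M: "ideal M R" "I \<subseteq> M" "M \<inter> T = {}" using MA by simp_all
  have max: "J = M" if "ideal J R" "I \<subseteq> J" "J \<inter> T = {}" "M \<subseteq> J" for J
    using MM that by simp
  interpret M: ideal M R by fact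
  have ext: "\<exists>x r. x \<in> M \<and> r \<in> carrier R \<and> x \<oplus> r \<otimes> a \<in> T" if a: "a \<in> carrier R" "a \<notin> M" for a
  proof -
    have id: "ideal (M <+> PIdl a) R" by (intro add_ideals M cgenideal_ideal a)
    have aP: "a \<in> PIdl a" by (rule cgenideal_self[OF a(1)])
    have 1: "M \<subseteq> M <+> PIdl a"
    proof
      fix x assume x: "x \<in> M"
      have "\<zero> \<in> PIdl a" using cgenideal_ideal[OF a(1)] by (simp add: additive_subgroup.zero_closed ideal.axioms(1))
      then have "x \<oplus> \<zero> \<in> M <+> PIdl a" using x by (force simp: set_add_defs simp del: r_zero)
      then show "x \<in> M <+> PIdl a" using x by simp
    qed
    have "\<zero> \<oplus> a \<in> M <+> PIdl a" using aP M.zero_closed by (force simp: set_add_defs simp del: l_zero)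
    then have "a \<in> M <+> PIdl a" using a by simp
    then have "M <+> PIdl a \<noteq> M" using a by auto
    then have "(M <+> PIdl a) \<inter> T \<noteq> {}" using max[OF id subset_trans[OF M(2) 1] _ 1] by metis
    then obtain x y where "x \<in> M" "y \<in> PIdl a" "x \<oplus> y \<in> T" by (auto simp: set_add_defs)
    then show ?thesis unfolding cgenideal_def by auto
  qed
  have "primeideal M R"
  proof (rule primeidealI[OF M(1) is_cring])
    show "carrier R \<noteq> M" using M(3) T by auto
    fix a b assume ab: "a \<in> carrier R" "b \<in> carrier R" "a \<otimes> b \<in> M"
    show "a \<in> M \<or> b \<in> M"
    proof (rule ccontr)
      assume n: "\<not> (a \<in> M \<or> b \<in> M)"
      obtain x r where x: "x \<in> M" "r \<in> carrier R" "x \<oplus> r \<otimes> a \<in> T" using ext[of a] n ab by auto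
      obtain y q where y: "y \<in> M" "q \<in> carrier R" "y \<oplus> q \<otimes> b \<in> T" using ext[of b] n ab by auto
      have c: "x \<in> carrier R" "y \<in> carrier R" using x y by auto
      have "(x \<oplus> r \<otimes> a) \<otimes> (y \<oplus> q \<otimes> b) = (y \<oplus> q \<otimes> b) \<otimes> x \<oplus> ((r \<otimes> a) \<otimes> y \<oplus> (r \<otimes> q) \<otimes> (a \<otimes> b))"
        using x(2) y(2) c ab(1,2) by (simp add: l_distr r_distr m_ac a_ac)
      also have "\<dots> \<in> M"
        using x(2) y(2) c ab(1,2)
        by (intro M.a_closed M.I_l_closed[OF x(1)] M.I_l_closed[OF y(1)] M.I_l_closed[OF ab(3)]) auto
      finally show False using Tm[OF x(3) y(3)] M(3) by auto
    qed
  qed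
  then show ?thesis using M by auto
qed

text \<open>
  The reason why depth is at most dimension. The chain is built downwards from a prime over the whole
  sequence. If \<open>x\<close> is a nonzerodivisor modulo an ideal \<open>K\<close>, and a prime \<open>P\<close> contains \<open>K\<close> and \<open>x\<close>, then no
  product \<open>s x\<^sup>n\<close> with \<open>s \<notin> P\<close> lies in \<open>K\<close>; a prime over \<open>K\<close> that avoids all these products is contained in \<open>P\<close>
  and omits \<open>x\<close>.
\<close>

lemma (in cring) regular_seq_prime_chain:
  assumes reg: "regular_seq R xs"
  shows "\<exists>P. (\<forall>i\<le>length xs. primeideal (P i) R) \<and> (\<forall>i<length xs. P i \<subset> P (Suc i))"
proof -
  let ?n = "length xs"
  define K where "K i = Idl (set (take i xs))" for i
  have xs: "set xs \<subseteq> carrier R" and proper: "Idl (set xs) \<noteq> carrier R"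
    and nz: "\<And>i a. i < ?n \<Longrightarrow> a \<in> carrier R \<Longrightarrow> xs ! i \<otimes> a \<in> K i \<Longrightarrow> a \<in> K i"
    using reg unfolding regular_seq_def K_def by auto
  have tk: "set (take i xs) \<subseteq> carrier R" for i using xs set_take_subset[of i xs] by auto
  have Ki: "ideal (K i) R" for i unfolding K_def by (rule genideal_ideal[OF tk])
  have "\<exists>P. (\<forall>i\<le>k. primeideal (P i) R) \<and> (\<forall>i<k. P i \<subset> P (Suc i)) \<and> K (?n - k) \<subseteq> P 0" if "k \<le> ?n" for k
    using that
  proof (induction k)
    case 0
    have "\<one> \<notin> K ?n" using proper ideal.one_imp_carrier[OF Ki, of ?n] by (auto simp: K_def)
    then obtain Q where "primeideal Q R" "K ?n \<subseteq> Q"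
      using prime_disjoint_exists[OF Ki, of "{\<one>}" ?n] by auto
    then show ?case by (intro exI[of _ "\<lambda>_. Q"]) auto
  next
    case (Suc k)
    then obtain P where P: "\<forall>i\<le>k. primeideal (P i) R" "\<forall>i<k. P i \<subset> P (Suc i)" "K (?n - k) \<subseteq> P 0" by auto
    define j where "j = ?n - Suc k"
    have j: "j < ?n" "?n - k = Suc j" using Suc.prems by (auto simp: j_def)
    interpret P0: primeideal "P 0" R using P by auto
    interpret Kj: ideal "K j" R by (rule Ki)
    let ?x = "xs ! j"
    have x: "?x \<in> carrier R" using xs j by auto
    have xP: "?x \<in> P 0"
      using P(3) j genideal_self[OF tk, of "Suc j"] by (auto simp: K_def take_Suc_conv_app_nth)
    have KP: "K j \<subseteq> P 0"
    proof -
      have "K j \<subseteq> K (Suc j)" unfolding K_def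
        by (rule subset_Idl_subset[OF tk]) (simp add: set_take_subset_set_take)
      then show ?thesis using P(3) j by auto
    qed
    \<comment> \<open>A prime that avoids \<open>T\<close> lies inside \<open>P 0\<close> (take \<open>n = 0\<close>) and omits \<open>?x\<close> (take \<open>s = \<one>\<close>).\<close>
    define T where "T = {s \<otimes> ?x [^] n | s n. s \<in> carrier R - P 0 \<and> n \<in> (UNIV::nat set)}"
    have pw: "a \<in> K j" if "a \<in> carrier R" "a \<otimes> ?x [^] n \<in> K j" for a and n::nat
      using that
    proof (induction n)
      case 0 then show ?case by simp
    next
      case (Suc n)
      have "?x \<otimes> (a \<otimes> ?x [^] n) = a \<otimes> ?x [^] Suc n" using Suc x by (simp add: m_ac)
      then have "?x \<otimes> (a \<otimes> ?x [^] n) \<in> K j" using Suc by simp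
      then have "a \<otimes> ?x [^] n \<in> K j" by (rule nz[OF j(1), rotated]) (use Suc.prems x in auto)
      then show ?case by (rule Suc.IH[OF Suc.prems(1)])
    qed
    have cpl: "\<one> \<in> carrier R - P 0" using P0.one_imp_carrier P0.I_notcarr by auto
    have "\<exists>Q. primeideal Q R \<and> K j \<subseteq> Q \<and> Q \<inter> T = {}"
    proof (rule prime_disjoint_exists[OF Ki])
      show "T \<subseteq> carrier R" using x by (auto simp: T_def)
      show "\<one> \<in> T" using cpl unfolding T_def by (auto intro!: exI[of _ \<one>] exI[of _ "0::nat"])
      fix s t assume "s \<in> T" "t \<in> T"
      then obtain a b and n m :: nat where s: "a \<in> carrier R - P 0" "b \<in> carrier R - P 0" "s = a \<otimes> ?x [^] n" "t = b \<otimes> ?x [^] m"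
        unfolding T_def by auto
      have "s \<otimes> t = (a \<otimes> b) \<otimes> (?x [^] (n + m))" using s x by (simp add: m_ac nat_pow_mult[symmetric])
      moreover have "a \<otimes> b \<in> carrier R - P 0" using s P0.I_prime by auto
      ultimately show "s \<otimes> t \<in> T" unfolding T_def by auto
    next
      show "K j \<inter> T = {}"
      proof (rule ccontr)
        assume "K j \<inter> T \<noteq> {}"
        then obtain a n where "a \<in> carrier R" "a \<notin> P 0" "a \<otimes> ?x [^] (n::nat) \<in> K j"
          unfolding T_def by auto
        then show False using pw[of a n] KP by blast
      qed
    qed
    then obtain Q where Q: "primeideal Q R" "K j \<subseteq> Q" "Q \<inter> T = {}" by auto
    have QP: "Q \<subseteq> P 0"
    proof
      fix a assume a: "a \<in> Q"
      interpret Q: primeideal Q R by fact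
      have "a \<in> carrier R" using a by auto
      show "a \<in> P 0"
      proof (rule ccontr)
        assume "a \<notin> P 0"
        then have "a \<otimes> ?x [^] (0::nat) \<in> T" using \<open>a \<in> carrier R\<close> unfolding T_def by blast
        then show False using Q(3) a by auto
      qed
    qed
    have "\<one> \<otimes> ?x [^] (1::nat) \<in> T" using cpl unfolding T_def by blast
    then have "?x \<notin> Q" using Q x by auto
    then have QP': "Q \<subset> P 0" using QP xP by auto
    show ?case
    proof (intro exI[of _ "case_nat Q P"] conjI)
      show "\<forall>i\<le>Suc k. primeideal (case_nat Q P i) R" using P Q by (auto split: nat.split)
      show "\<forall>i<Suc k. case_nat Q P i \<subset> case_nat Q P (Suc i)" using P QP' by (auto split: nat.split)
      show "K (?n - Suc k) \<subseteq> case_nat Q P 0" using Q by (simp add: j_def)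
    qed
  qed
  from this[of ?n] show ?thesis by auto
qed

lemma (in cring) depth_le_krull_dim: "depth M R \<le> krull_dim R"
  unfolding depth_def
proof (rule Sup_least)
  fix e assume "e \<in> {enat (length xs) | xs. regular_seq R xs \<and> set xs \<subseteq> M}"
  then obtain xs where "e = enat (length xs)" "regular_seq R xs" by auto
  with regular_seq_prime_chain show "e \<le> krull_dim R"
    unfolding krull_dim_def by (intro Sup_upper) blast
qed

text \<open>
  Multipliers outside \<open>P\<close> become units at \<open>P\<close>, so \<open>xs\<close> bounds the depth of the localization from below. The
  bound on chains of primes below \<open>P\<close> bounds its dimension from above by the same number.
\<close>

lemma (in cring) cohen_macaulay_local_localizationI:
  assumes noeth: "noetherian_ring R" and P: "primeideal P R"
    and xs: "set xs \<subseteq> P"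
    and regular_at: "\<And>i a. i < length xs \<Longrightarrow> a \<in> carrier R \<Longrightarrow> xs ! i \<otimes> a \<in> Idl (set (take i xs)) \<Longrightarrow>
       \<exists>s\<in>carrier R - P. s \<otimes> a \<in> Idl (set (take i xs))"
    and bound: "\<And>r Q. \<forall>i\<le>r. primeideal (Q i) R \<Longrightarrow> \<forall>i<r. Q i \<subset> Q (Suc i) \<Longrightarrow> Q r \<subseteq> P \<Longrightarrow> r \<le> length xs"
  shows "cohen_macaulay_local (localization R (carrier R - P))"
proof -
  interpret P: primeideal P R by fact
  interpret mult_set R "carrier R - P"
    using P.one_imp_carrier P.I_notcarr P.I_prime by unfold_locales auto
  let ?S = "carrier R - P"
  let ?i = "\<lambda>a. fr a \<one>"
  interpret L: cring L by (rule cring_L)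
  have PC: "P \<subseteq> carrier R" by auto
  have xsC: "set xs \<subseteq> carrier R" using xs PC by auto
  define M where "M = Idl\<^bsub>L\<^esub> (?i ` P)"
  have iP: "?i ` P \<subseteq> carrier L" using S_one by auto
  have MI: "ideal M L" unfolding M_def by (rule L.genideal_ideal[OF iP])
  have IP: "Idl P = P" using genideal_self[OF PC] genideal_minimal[OF P.is_ideal] by auto
  have M_iff: "fr a s \<in> M \<longleftrightarrow> a \<in> P" if "a \<in> carrier R" "s \<in> ?S" for a s
  proof -
    have "fr a s \<in> M \<longleftrightarrow> (\<exists>t\<in>?S. t \<otimes> a \<in> P)"
      unfolding M_def using Idl_L_iff[OF PC that] IP by simp
    also have "\<dots> \<longleftrightarrow> a \<in> P"
    proof
      assume "\<exists>t\<in>?S. t \<otimes> a \<in> P" then show "a \<in> P" using P.I_prime that by auto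
    next
      assume "a \<in> P" then show "\<exists>t\<in>?S. t \<otimes> a \<in> P" using S_one that by (intro bexI[of _ \<one>]) auto
    qed
    finally show ?thesis .
  qed
  have proper_sub: "J \<subseteq> M" if J: "ideal J L" "\<one>\<^bsub>L\<^esub> \<notin> J" for J
  proof
    fix x assume x: "x \<in> J"
    interpret J: ideal J L by fact
    have "x \<in> carrier L" using x by auto
    then obtain a s where a: "a \<in> carrier R" "s \<in> ?S" "x = fr a s" by (rule carrier_LE)
    show "x \<in> M"
    proof (rule ccontr)
      assume "x \<notin> M"
      then have aS: "a \<in> ?S" using a M_iff by auto
      have "fr s a \<otimes>\<^bsub>L\<^esub> x \<in> J" using aS a x by (intro J.I_l_closed) auto
      also have "fr s a \<otimes>\<^bsub>L\<^esub> x = \<one>\<^bsub>L\<^esub>"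
      proof -
        have "fr s a \<otimes>\<^bsub>L\<^esub> fr a s = fr (s \<otimes> a) (a \<otimes> s)" using a aS by (intro mult_L) auto
        also have "\<dots> = fr \<one> \<one>" using a aS S_mult[OF aS a(2)] S_one by (intro fr_eqI) (auto simp: m_ac)
        finally show ?thesis by (simp add: a(3) one_L)
      qed
      finally show False using J by simp
    qed
  qed
  have oneM: "\<one>\<^bsub>L\<^esub> \<notin> M" unfolding one_L using M_iff[OF _ S_one] S_one by auto
  have max: "{J. maximalideal J L} = {M}"
  proof -
    have "maximalideal M L"
    proof (rule maximalidealI[OF MI])
      show "carrier L \<noteq> M" using oneM by auto
      fix J assume J: "ideal J L" "M \<subseteq> J" "J \<subseteq> carrier L"
      then show "J = M \<or> J = carrier L" using proper_sub[of J] ideal.one_imp_carrier[of J L] by auto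
    qed
    moreover have "J = M" if "maximalideal J L" for J
    proof -
      interpret J: maximalideal J L by fact
      have "\<one>\<^bsub>L\<^esub> \<notin> J" using J.one_imp_carrier J.I_notcarr by auto
      then have "J \<subseteq> M" using proper_sub J.is_ideal by auto
      then have "M = J \<or> M = carrier L" using J.I_maximal[OF MI] MI by (meson additive_subgroup.a_subset ideal.axioms(1))
      then show "J = M" using oneM by auto
    qed
    ultimately show ?thesis by blast
  qed
  have tk: "set (take i xs) \<subseteq> carrier R" for i using xsC set_take_subset[of i xs] by auto
  have "regular_seq L (map ?i xs)"
    unfolding regular_seq_def
  proof (intro conjI allI impI ballI)
    show "set (map ?i xs) \<subseteq> carrier L" using xsC S_one by auto
    have "Idl\<^bsub>L\<^esub> (set (map ?i xs)) \<subseteq> M"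
      by (rule L.genideal_minimal[OF MI]) (use xs xsC M_iff S_one in auto)
    then show "Idl\<^bsub>L\<^esub> (set (map ?i xs)) \<noteq> carrier L" using oneM by auto
    fix i x assume i: "i < length (map ?i xs)" and x: "x \<in> carrier L"
      and h: "map ?i xs ! i \<otimes>\<^bsub>L\<^esub> x \<in> Idl\<^bsub>L\<^esub> (set (take i (map ?i xs)))"
    obtain a s where a: "a \<in> carrier R" "s \<in> ?S" "x = fr a s" using x by (rule carrier_LE)
    have xi: "xs ! i \<in> carrier R" using i xsC by auto
    have eq: "set (take i (map ?i xs)) = ?i ` set (take i xs)" by (simp add: take_map)
    have "map ?i xs ! i \<otimes>\<^bsub>L\<^esub> x = fr (xs ! i \<otimes> a) s" using i a xi S_one by (simp add: mult_L)
    then obtain t where t: "t \<in> ?S" "t \<otimes> (xs ! i \<otimes> a) \<in> Idl (set (take i xs))"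
      using h Idl_L_iff[OF tk, of "xs ! i \<otimes> a" s i] a xi eq by auto
    then have "xs ! i \<otimes> (t \<otimes> a) \<in> Idl (set (take i xs))" using a xi by (simp add: m_ac)
    then obtain s' where s': "s' \<in> ?S" "s' \<otimes> (t \<otimes> a) \<in> Idl (set (take i xs))"
      using regular_at[of i "t \<otimes> a"] i t a by auto
    have "(s' \<otimes> t) \<otimes> a \<in> Idl (set (take i xs))" using s' t a by (simp add: m_assoc)
    then show "x \<in> Idl\<^bsub>L\<^esub> (set (take i (map ?i xs)))"
      unfolding eq a(3) using Idl_L_iff[OF tk a(1,2)] S_mult[OF s'(1) t(1)] by blast
  qed
  moreover have "set (map ?i xs) \<subseteq> M" using xs xsC M_iff S_one by auto
  ultimately have d: "enat (length xs) \<le> depth M L"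
    unfolding depth_def by (intro Sup_upper) (force intro!: exI[of _ "map ?i xs"])
  have k: "krull_dim L \<le> enat (length xs)"
    unfolding krull_dim_def
  proof (rule Sup_least, clarify)
    fix r Q assume Q: "\<forall>i\<le>r. primeideal (Q i) L" "\<forall>i<r. Q i \<subset> Q (Suc i)"
    have "r \<le> length xs"
    proof (rule bound[of r "\<lambda>i. contraction (Q i)"])
      show "\<forall>i\<le>r. primeideal (contraction (Q i)) R" using Q contraction_prime by auto
      show "\<forall>i<r. contraction (Q i) \<subset> contraction (Q (Suc i))"
        using Q contraction_mono by (simp add: primeideal.axioms(1))
      show "contraction (Q r) \<subseteq> P" using Q contraction_prime(2)[of "Q r"] by (auto simp: contraction_def)
    qed
    then show "enat r \<le> enat (length xs)" by simp
  qed
  have "depth M L = krull_dim L"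
    using d k L.depth_le_krull_dim[of M] by (meson order.antisym order.trans)
  then show ?thesis
    unfolding cohen_macaulay_local_def using max cring_L noetherian_L[OF noeth] by blast
qed

section \<open>Cohen-Macaulay quotient rings\<close>

lemma (in ideal) a_rcos_eq_zero: "x \<in> I \<Longrightarrow> I +> x = \<zero>\<^bsub>R Quot I\<^esub>"
  by (simp add: a_rcos_const FactRing_def)

context cring begin

lemma quot_carrier: "carrier (R Quot I) = (+>) I ` carrier R"
  by (auto simp: FactRing_simps)

lemma quot_Idl_iff:
  assumes I: "ideal I R" and X: "Y \<subseteq> carrier R" and a: "a \<in> carrier R"
  shows "I +> a \<in> Idl\<^bsub>R Quot I\<^esub> ((+>) I ` Y) \<longleftrightarrow> a \<in> Idl (Y \<union> I)"
proof -
  interpret I: ideal I R by fact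
  interpret h: ring_hom_ring R "R Quot I" "(+>) I" by (rule I.rcos_ring_hom_ring)
  have hX: "(+>) I ` Y \<subseteq> carrier (R Quot I)" using X by auto
  have XI: "Y \<union> I \<subseteq> carrier R" using X by auto
  have K: "ideal (Idl (Y \<union> I)) R" by (rule genideal_ideal[OF XI])
  interpret K: ideal "Idl (Y \<union> I)" R by fact
  have sub: "Y \<union> I \<subseteq> Idl (Y \<union> I)" by (rule genideal_self[OF XI])
  show ?thesis
  proof
    assume h: "I +> a \<in> Idl\<^bsub>R Quot I\<^esub> ((+>) I ` Y)"
    have "ideal ((+>) I ` (Idl (Y \<union> I))) (R Quot I)"
      by (rule ring_ideal_imp_quot_ideal[OF I K])
    then have "Idl\<^bsub>R Quot I\<^esub> ((+>) I ` Y) \<subseteq> (+>) I ` (Idl (Y \<union> I))"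
      by (rule h.S.genideal_minimal) (use sub in auto)
    then obtain b where b: "b \<in> Idl (Y \<union> I)" "I +> a = I +> b" using h by auto
    then have bc: "b \<in> carrier R" by simp
    have "a \<ominus> b \<in> I" using quotient_eq_iff_same_a_r_cos[OF I a bc] b by simp
    then have "a \<ominus> b \<oplus> b \<in> Idl (Y \<union> I)" using sub b by (intro K.a_closed) auto
    then show "a \<in> Idl (Y \<union> I)" using a bc by (simp add: a_minus_def a_assoc l_neg)
  next
    assume aK: "a \<in> Idl (Y \<union> I)"
    have G: "ideal (Idl\<^bsub>R Quot I\<^esub> ((+>) I ` Y)) (R Quot I)" by (rule h.S.genideal_ideal[OF hX])
    interpret G: ideal "Idl\<^bsub>R Quot I\<^esub> ((+>) I ` Y)" "R Quot I" by fact
    have "Idl (Y \<union> I) \<subseteq> {r \<in> carrier R. I +> r \<in> Idl\<^bsub>R Quot I\<^esub> ((+>) I ` Y)}"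
    proof (rule genideal_minimal[OF h.ideal_vimage[OF G]], rule subsetI)
      fix x assume x: "x \<in> Y \<union> I"
      show "x \<in> {r \<in> carrier R. I +> r \<in> Idl\<^bsub>R Quot I\<^esub> ((+>) I ` Y)}"
      proof (cases "x \<in> I")
        case True
        have "I +> x \<in> Idl\<^bsub>R Quot I\<^esub> ((+>) I ` Y)"
          unfolding I.a_rcos_eq_zero[OF True] by (rule G.zero_closed)
        moreover have "x \<in> carrier R" by (rule I.Icarr[OF True])
        ultimately show ?thesis by simp
      next
        case False
        then have "x \<in> Y" using x by blast
        then have "I +> x \<in> Idl\<^bsub>R Quot I\<^esub> ((+>) I ` Y)"
          by (intro subsetD[OF h.S.genideal_self[OF hX]] imageI)
        moreover have "x \<in> carrier R" using \<open>x \<in> Y\<close> X by (rule subsetD[rotated])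
        ultimately show ?thesis by simp
      qed
    qed
    from subsetD[OF this aK] show "I +> a \<in> Idl\<^bsub>R Quot I\<^esub> ((+>) I ` Y)" by simp
  qed
qed

lemma quot_vimage_prime:
  assumes I: "ideal I R" and P: "primeideal P (R Quot I)"
  shows "primeideal {r \<in> carrier R. I +> r \<in> P} R" "I \<subseteq> {r \<in> carrier R. I +> r \<in> P}"
proof -
  interpret I: ideal I R by fact
  interpret h: ring_hom_ring R "R Quot I" "(+>) I" by (rule I.rcos_ring_hom_ring)
  interpret P: primeideal P "R Quot I" by fact
  show "primeideal {r \<in> carrier R. I +> r \<in> P} R"
  proof (rule primeidealI[OF h.ideal_vimage[OF P.is_ideal] is_cring])
    show "carrier R \<noteq> {r \<in> carrier R. I +> r \<in> P}"
    proof
      assume "carrier R = {r \<in> carrier R. I +> r \<in> P}"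
      then have "I +> \<one> \<in> P" using one_closed by blast
      then have "\<one>\<^bsub>R Quot I\<^esub> \<in> P" using h.hom_one by metis
      then show False using P.one_imp_carrier P.I_notcarr by blast
    qed
    fix a b assume ab: "a \<in> carrier R" "b \<in> carrier R" "a \<otimes> b \<in> {r \<in> carrier R. I +> r \<in> P}"
    then have "(I +> a) \<otimes>\<^bsub>R Quot I\<^esub> (I +> b) \<in> P" by simp
    then show "a \<in> {r \<in> carrier R. I +> r \<in> P} \<or> b \<in> {r \<in> carrier R. I +> r \<in> P}"
      using P.I_prime[of "I +> a" "I +> b"] ab by auto
  qed
  show "I \<subseteq> {r \<in> carrier R. I +> r \<in> P}"
  proof
    fix x assume x: "x \<in> I"
    have "I +> x \<in> P" unfolding I.a_rcos_eq_zero[OF x] by (rule P.zero_closed)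
    then show "x \<in> {r \<in> carrier R. I +> r \<in> P}" using x I.a_subset by blast
  qed
qed

lemma quot_noetherian:
  assumes noeth: "noetherian_ring R" and I: "ideal I R"
  shows "noetherian_ring (R Quot I)"
proof -
  interpret I: ideal I R by fact
  interpret h: ring_hom_ring R "R Quot I" "(+>) I" by (rule I.rcos_ring_hom_ring)
  interpret N: noetherian_ring R by fact
  show ?thesis
  proof (rule h.S.noetherian_ringI)
    fix J assume J: "ideal J (R Quot I)"
    obtain A where A: "A \<subseteq> carrier R" "finite A" "{r \<in> carrier R. I +> r \<in> J} = Idl A"
      using N.finetely_gen[OF h.ideal_vimage[OF J]] by auto
    have hA: "(+>) I ` A \<subseteq> carrier (R Quot I)" using A by auto
    have AJ: "I +> r \<in> J" if "r \<in> A" for r using genideal_self[OF A(1)] A(3) that by blast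
    have 1: "Idl\<^bsub>R Quot I\<^esub> ((+>) I ` A) \<subseteq> J" by (rule h.S.genideal_minimal[OF J]) (use AJ in blast)
    have 2: "J \<subseteq> Idl\<^bsub>R Quot I\<^esub> ((+>) I ` A)"
    proof
      fix x assume x: "x \<in> J"
      then have "x \<in> carrier (R Quot I)" using J by (meson additive_subgroup.a_Hcarr ideal.axioms(1))
      then obtain a where a: "a \<in> carrier R" "x = I +> a" unfolding quot_carrier by auto
      then have "a \<in> Idl A" using x A(3) by blast
      moreover have "Idl A \<subseteq> Idl (A \<union> I)" using A(1) I.a_subset by (intro subset_Idl_subset) blast+
      ultimately show "x \<in> Idl\<^bsub>R Quot I\<^esub> ((+>) I ` A)"
        using quot_Idl_iff[OF I A(1) a(1)] a(2) by blast
    qed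
    show "\<exists>A\<subseteq>carrier (R Quot I). finite A \<and> J = Idl\<^bsub>R Quot I\<^esub> A"
      using 1 2 A(2) hA by (intro exI[of _ "(+>) I ` A"] conjI subset_antisym finite_imageI)
  qed
qed

text \<open>
  Ideals and primes of the quotient correspond to those of \<open>R\<close> over \<open>I\<close>, so the local criterion can be stated,
  and later be verified, inside \<open>R\<close>.
\<close>

lemma cohen_macaulay_quotientI:
  assumes noeth: "noetherian_ring R" and I: "ideal I R"
    and ex: "\<And>P. primeideal P R \<Longrightarrow> I \<subseteq> P \<Longrightarrow> \<exists>xs. set xs \<subseteq> P \<and>
        (\<forall>i<length xs. \<forall>a\<in>carrier R. xs ! i \<otimes> a \<in> Idl (set (take i xs) \<union> I) \<longrightarrow>
            (\<exists>s\<in>carrier R - P. s \<otimes> a \<in> Idl (set (take i xs) \<union> I))) \<and>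
        (\<forall>r Q. (\<forall>i\<le>r. primeideal (Q i) R \<and> I \<subseteq> Q i) \<and> (\<forall>i<r. Q i \<subset> Q (Suc i)) \<and> Q r \<subseteq> P
            \<longrightarrow> r \<le> length xs)"
  shows "cohen_macaulay (R Quot I)"
proof -
  interpret I: ideal I R by fact
  interpret h: ring_hom_ring R "R Quot I" "(+>) I" by (rule I.rcos_ring_hom_ring)
  interpret A: cring "R Quot I" by (rule I.quotient_is_cring[OF is_cring])
  have NA: "noetherian_ring (R Quot I)" by (rule quot_noetherian[OF noeth I])
  let ?v = "\<lambda>J. {r \<in> carrier R. I +> r \<in> J}"
  have "cohen_macaulay_local (localization (R Quot I) (carrier (R Quot I) - P))"
    if "maximalideal P (R Quot I)" for P
  proof -
    have P: "primeideal P (R Quot I)" by (rule A.maximalideal_prime[OF that])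
    from ex[OF quot_vimage_prime[OF I P]] obtain xs where xs: "set xs \<subseteq> ?v P"
      and wr: "\<forall>i<length xs. \<forall>a\<in>carrier R. xs ! i \<otimes> a \<in> Idl (set (take i xs) \<union> I) \<longrightarrow>
            (\<exists>s\<in>carrier R - ?v P. s \<otimes> a \<in> Idl (set (take i xs) \<union> I))"
      and bd: "\<forall>r Q. (\<forall>i\<le>r. primeideal (Q i) R \<and> I \<subseteq> Q i) \<and> (\<forall>i<r. Q i \<subset> Q (Suc i)) \<and> Q r \<subseteq> ?v P
            \<longrightarrow> r \<le> length xs"
      by (elim exE conjE)
    have tk: "set (take i xs) \<subseteq> carrier R" for i using xs set_take_subset[of i xs] by auto
    show ?thesis
    proof (rule A.cohen_macaulay_local_localizationI[OF NA P, of "map ((+>) I) xs"])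
      show "set (map ((+>) I) xs) \<subseteq> P" using xs by auto
    next
      fix i x
      assume i: "i < length (map ((+>) I) xs)" and x: "x \<in> carrier (R Quot I)"
        and h: "map ((+>) I) xs ! i \<otimes>\<^bsub>R Quot I\<^esub> x \<in> Idl\<^bsub>R Quot I\<^esub> set (take i (map ((+>) I) xs))"
      obtain a where a: "a \<in> carrier R" "x = I +> a" using x unfolding quot_carrier by auto
      have eq: "set (take i (map ((+>) I) xs)) = (+>) I ` set (take i xs)" by (simp add: take_map)
      have xi: "xs ! i \<in> carrier R" using i xs nth_mem by fastforce
      have "I +> (xs ! i \<otimes> a) \<in> Idl\<^bsub>R Quot I\<^esub> ((+>) I ` set (take i xs))"
        using h i a xi unfolding eq by simp
      then have "xs ! i \<otimes> a \<in> Idl (set (take i xs) \<union> I)"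
        using quot_Idl_iff[OF I tk, of "xs ! i \<otimes> a" i] xi a by auto
      moreover have "i < length xs" using i by simp
      ultimately obtain s where s: "s \<in> carrier R - ?v P" "s \<otimes> a \<in> Idl (set (take i xs) \<union> I)"
        using wr a(1) by blast
      have sc: "s \<in> carrier R" "I +> s \<notin> P" using s(1) by simp_all
      have "I +> (s \<otimes> a) \<in> Idl\<^bsub>R Quot I\<^esub> ((+>) I ` set (take i xs))"
        by (rule iffD2[OF quot_Idl_iff[OF I tk] s(2)]) (simp add: sc a)
      then have "(I +> s) \<otimes>\<^bsub>R Quot I\<^esub> x \<in> Idl\<^bsub>R Quot I\<^esub> set (take i (map ((+>) I) xs))"
        unfolding eq using sc(1) a by simp
      moreover have "I +> s \<in> carrier (R Quot I) - P" using sc by simp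
      ultimately show "\<exists>s\<in>carrier (R Quot I) - P. s \<otimes>\<^bsub>R Quot I\<^esub> x \<in> Idl\<^bsub>R Quot I\<^esub> set (take i (map ((+>) I) xs))"
        by blast
    next
      fix r Q
      assume Q: "\<forall>i\<le>r. primeideal (Q i) (R Quot I)" "\<forall>i<r. Q i \<subset> Q (Suc i)" "Q r \<subseteq> P"
      have "r \<le> length xs"
      proof (rule bd[rule_format, of r "\<lambda>i. ?v (Q i)"], intro conjI allI impI)
        fix i assume "i \<le> r"
        then have "primeideal (Q i) (R Quot I)" using Q(1) by blast
        then show "primeideal (?v (Q i)) R" "I \<subseteq> ?v (Q i)" by (rule quot_vimage_prime[OF I])+
      next
        fix i assume i: "i < r"
        then have "Q i \<subset> Q (Suc i)" using Q by auto
        then obtain x where x: "x \<in> Q (Suc i)" "x \<notin> Q i" by auto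
        have "primeideal (Q (Suc i)) (R Quot I)" using Q i by auto
        then have "x \<in> carrier (R Quot I)" using x(1) by (meson additive_subgroup.a_Hcarr ideal.axioms(1) primeideal.axioms(1))
        then obtain a where "a \<in> carrier R" "x = I +> a" unfolding quot_carrier by auto
        then have "a \<in> ?v (Q (Suc i))" "a \<notin> ?v (Q i)" using x by auto
        then show "?v (Q i) \<subset> ?v (Q (Suc i))" using \<open>Q i \<subset> Q (Suc i)\<close> by blast
      qed (use Q in auto)
      then show "r \<le> length (map ((+>) I) xs)" by simp
    qed
  qed
  then show ?thesis unfolding cohen_macaulay_def using A.is_cring NA by blast
qed

end

section \<open>Ideals of a commutative ring type\<close>

text \<open>
  From here on rings are types. For a ring acting on itself, submodules are ideals and the span of a set is
  the ideal it generates, so the calculus of spans is the calculus of ideals.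
\<close>

interpretation ring_mod: Modules.module "(*) :: 'a::comm_ring_1 \<Rightarrow> 'a \<Rightarrow> 'a"
  by unfold_locales (auto simp: algebra_simps)

\<comment> \<open>Used as a rewrite rule, this reverses the associativity law in \<open>algebra_simps\<close>.\<close>
declare ring_mod.scale_scale [simp del]

abbreviation idl :: "'a::comm_ring_1 set \<Rightarrow> 'a set" where "idl \<equiv> ring_mod.span"
abbreviation is_ideal :: "'a::comm_ring_1 set \<Rightarrow> bool" where "is_ideal \<equiv> ring_mod.subspace"

definition is_prime :: "'a::comm_ring_1 set \<Rightarrow> bool" where
  "is_prime P \<longleftrightarrow> is_ideal P \<and> 1 \<notin> P \<and> (\<forall>a b. a * b \<in> P \<longrightarrow> a \<in> P \<or> b \<in> P)"

lemma is_prime_ideal: "is_prime P \<Longrightarrow> is_ideal P" by (simp add: is_prime_def)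
lemma is_prime_one: "is_prime P \<Longrightarrow> 1 \<notin> P" by (simp add: is_prime_def)
lemma is_prime_mult: "is_prime P \<Longrightarrow> a * b \<in> P \<Longrightarrow> a \<in> P \<or> b \<in> P" by (simp add: is_prime_def)

lemma is_prime_power: "is_prime P \<Longrightarrow> a ^ n \<in> P \<Longrightarrow> a \<in> P"
  by (induction n) (auto dest: is_prime_one is_prime_mult)

lemma is_prime_power_iff: "is_prime P \<Longrightarrow> a \<notin> P \<Longrightarrow> a ^ n \<notin> P"
  using is_prime_power by blast

lemma is_ideal_mult_left: "is_ideal J \<Longrightarrow> a \<in> J \<Longrightarrow> r * a \<in> J"
  by (rule ring_mod.subspace_scale)

lemma is_ideal_mult_right: "is_ideal J \<Longrightarrow> a \<in> J \<Longrightarrow> a * r \<in> J"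
  by (metis is_ideal_mult_left mult.commute)

lemma idl_Un_iff: "a \<in> idl (A \<union> B) \<longleftrightarrow> (\<exists>x\<in>idl A. \<exists>y\<in>idl B. a = x + y)"
  by (auto simp: ring_mod.span_Un)

lemma idl_idl [simp]: "idl (idl B) = idl B" by (rule ring_mod.span_span)

lemma idl_eq: "is_ideal J \<Longrightarrow> idl J = J"
  by (simp add: ring_mod.span_eq_iff)

lemma idl_UnI1: "a \<in> idl A \<Longrightarrow> a \<in> idl (A \<union> B)"
  by (meson Un_upper1 ring_mod.span_mono subsetD)

lemma idl_UnI2: "a \<in> B \<Longrightarrow> a \<in> idl (A \<union> B)"
  by (simp add: ring_mod.span_base)

lemma idl_insert_iff: "a \<in> idl (insert u B) \<longleftrightarrow> (\<exists>r. a - r * u \<in> idl B)"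
  by (auto simp: ring_mod.span_insert)

lemma idl_subset_iff: "is_ideal J \<Longrightarrow> idl B \<subseteq> J \<longleftrightarrow> B \<subseteq> J"
  by (meson ring_mod.span_minimal ring_mod.span_superset subset_trans)

abbreviation type_ring :: "'a::comm_ring_1 ring" where "type_ring \<equiv> ring_of_type_algebra"

lemma type_ring_simps [simp]: "carrier type_ring = UNIV" "x \<otimes>\<^bsub>type_ring\<^esub> y = x * y" "x \<oplus>\<^bsub>type_ring\<^esub> y = x + y" "\<one>\<^bsub>type_ring\<^esub> = 1" "\<zero>\<^bsub>type_ring\<^esub> = 0"
  by (simp_all add: ring_of_type_algebra_def)

lemma type_ring_cring: "cring (type_ring :: 'a::comm_ring_1 ring)" by (rule cring_from_type_algebra)

lemma ideal_type_ring_iff: "ideal J (type_ring :: 'a::comm_ring_1 ring) \<longleftrightarrow> is_ideal J"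
proof
  assume "ideal J (type_ring :: 'a ring)"
  then interpret J: ideal J "type_ring :: 'a ring" .
  show "is_ideal J"
  proof (rule ring_mod.subspaceI)
    show "0 \<in> J" using additive_subgroup.zero_closed[OF J.is_additive_subgroup] unfolding type_ring_simps .
    show "x + y \<in> J" if "x \<in> J" "y \<in> J" for x y using additive_subgroup.a_closed[OF J.is_additive_subgroup that] unfolding type_ring_simps .
    show "c * x \<in> J" if "x \<in> J" for c x using J.I_l_closed[OF that, of c] unfolding type_ring_simps by blast
  qed
next
  assume J: "is_ideal J"
  interpret R: cring "type_ring :: 'a ring" by (rule type_ring_cring)
  show "ideal J (type_ring :: 'a ring)"
  proof (rule idealI[OF R.ring_axioms])
    show "subgroup J (add_monoid (type_ring :: 'a ring))"
    proof (rule R.add.subgroupI)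
      show "J \<noteq> {}" using ring_mod.subspace_0[OF J] by blast
      fix a assume a: "a \<in> J"
      have "- a \<oplus>\<^bsub>type_ring\<^esub> a = \<zero>\<^bsub>type_ring\<^esub>" by simp
      then have "\<ominus>\<^bsub>type_ring\<^esub> a = - a" by (intro R.minus_equality) simp_all
      then show "\<ominus>\<^bsub>type_ring\<^esub> a \<in> J" using ring_mod.subspace_neg[OF J a] by simp
    qed (use ring_mod.subspace_add[OF J] in simp_all)
  qed (use is_ideal_mult_left[OF J] is_ideal_mult_right[OF J] in simp_all)
qed

lemma Idl_type_ring: "Idl\<^bsub>type_ring\<^esub> B = idl (B :: 'a::comm_ring_1 set)"
proof -
  interpret R: cring "type_ring :: 'a ring" by (rule type_ring_cring)
  show ?thesis
  proof
    show "Idl\<^bsub>type_ring\<^esub> B \<subseteq> idl B"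
      by (rule R.genideal_minimal) (simp_all add: ideal_type_ring_iff ring_mod.span_superset)
    have "is_ideal (Idl\<^bsub>type_ring\<^esub> B)" using R.genideal_ideal[of B] by (simp add: ideal_type_ring_iff)
    then show "idl B \<subseteq> Idl\<^bsub>type_ring\<^esub> B"
      using R.genideal_self[of B] by (simp add: ring_mod.span_minimal)
  qed
qed

lemma primeideal_type_ring_iff: "primeideal P (type_ring :: 'a::comm_ring_1 ring) \<longleftrightarrow> is_prime P"
proof
  assume "primeideal P (type_ring :: 'a ring)"
  then interpret P: primeideal P "type_ring :: 'a ring" .
  have "is_ideal P" using P.is_ideal by (simp add: ideal_type_ring_iff)
  moreover have "1 \<notin> P" using P.one_imp_carrier P.I_notcarr by force
  ultimately show "is_prime P" using P.I_prime by (simp add: is_prime_def)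
next
  assume P: "is_prime P"
  show "primeideal P (type_ring :: 'a ring)"
  proof (rule primeidealI[OF _ type_ring_cring])
    show "ideal P type_ring" using P by (simp add: ideal_type_ring_iff is_prime_def)
    show "carrier type_ring \<noteq> P" using is_prime_one[OF P] by auto
  qed (use is_prime_mult[OF P] in simp)
qed

section \<open>Sequences that are regular at a prime\<close>

text \<open>
  Regularity of \<open>fs\<close> on the localization of \<open>R/J\<close> at \<open>P\<close>, without passing to fractions: divisions
  have to succeed only up to a factor outside \<open>P\<close>. Here \<open>J\<close> may be any set of generators of the ideal.
\<close>

definition regular_at :: "'a::comm_ring_1 set \<Rightarrow> 'a set \<Rightarrow> 'a list \<Rightarrow> bool" where
  "regular_at P J fs \<longleftrightarrow> (\<forall>i<length fs. \<forall>a. fs ! i * a \<in> idl (set (take i fs) \<union> J) \<longrightarrow>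
     (\<exists>s. s \<notin> P \<and> s * a \<in> idl (set (take i fs) \<union> J)))"

text \<open>
  Multiplication by \<open>u\<close> embeds \<open>R/(J : u)\<close> into \<open>R/J\<close>. It stays injective at \<open>P\<close> modulo an initial part of
  \<open>fs\<close>, because \<open>fs\<close> is regular at \<open>P\<close> on the cokernel \<open>R/(J + u)\<close>: this is the vanishing of the first Koszul
  homology of the cokernel, done by hand.
\<close>

lemma regular_at_colon_aux:
  assumes P: "is_prime P" and J: "is_ideal J" and K: "is_ideal K"
    and colon: "\<And>g. g * u \<in> J \<Longrightarrow> g \<in> K"
    and W: "regular_at P (idl (insert u J)) fs" and i: "i \<le> length fs"
    and g: "g * u \<in> idl (set (take i fs) \<union> J)"
  shows "\<exists>s. s \<notin> P \<and> s * g \<in> idl (set (take i fs) \<union> K)"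
  using i g
proof (induction i arbitrary: g)
  case 0
  then have "g * u \<in> J" by (simp add: idl_eq[OF J])
  then have "1 * g \<in> idl (set (take 0 fs) \<union> K)" using colon[of g] by (simp add: ring_mod.span_base)
  then show ?case using is_prime_one[OF P] by blast
next
  case (Suc i)
  let ?f = "fs ! i" and ?A = "set (take i fs)"
  have tk: "set (take (Suc i) fs) = insert ?f ?A" using Suc.prems(1) by (simp add: take_Suc_conv_app_nth)
  obtain b where b: "g * u - b * ?f \<in> idl (?A \<union> J)"
    using Suc.prems(2) unfolding tk by (auto simp: idl_insert_iff)
  have sub: "idl (?A \<union> J) \<subseteq> idl (?A \<union> idl (insert u J))"
    by (rule ring_mod.span_mono) (use ring_mod.span_superset[of "insert u J"] in blast)
  have "u \<in> idl (?A \<union> idl (insert u J))" by (intro ring_mod.span_base UnI2) (simp add: ring_mod.span_base)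
  then have "g * u - (g * u - b * ?f) \<in> idl (?A \<union> idl (insert u J))"
    by (rule ring_mod.span_diff[OF ring_mod.span_scale subsetD[OF sub b]])
  then have "?f * b \<in> idl (?A \<union> idl (insert u J))" by (simp add: mult.commute)
  then obtain s where s: "s \<notin> P" "s * b \<in> idl (?A \<union> idl (insert u J))"
    using W Suc_le_lessD[OF Suc.prems(1)] unfolding regular_at_def by blast
  obtain x y where x: "x \<in> idl ?A" "y \<in> idl (insert u J)" "s * b = x + y"
    using s(2) by (auto simp: idl_Un_iff)
  obtain r where r: "y - r * u \<in> J" using x(2) by (auto simp: idl_insert_iff idl_eq[OF J])
  have "s * (g * u - b * ?f) + ?f * x + ?f * (y - r * u) \<in> idl (?A \<union> J)"
    by (rule ring_mod.span_add[OF ring_mod.span_add[OF ring_mod.span_scale[OF b] ring_mod.span_scale[OF idl_UnI1[OF x(1)]]] ring_mod.span_scale[OF idl_UnI2[OF r]]])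
  also have "s * (g * u - b * ?f) + ?f * x + ?f * (y - r * u) = s * (g * u) - ?f * (s * b) + ?f * (x + y) - ?f * r * u"
    by (simp add: algebra_simps)
  also have "\<dots> = (s * g - ?f * r) * u"
    unfolding x(3) by (simp add: algebra_simps)
  finally have "(s * g - ?f * r) * u \<in> idl (?A \<union> J)" .
  from Suc.IH[OF Suc_leD[OF Suc.prems(1)] this]
  obtain t where t: "t \<notin> P" "t * (s * g - ?f * r) \<in> idl (?A \<union> K)" by (elim exE conjE)
  have "(t * s) * g - (t * r) * ?f \<in> idl (?A \<union> K)" using t(2) by (simp add: algebra_simps)
  then have "(t * s) * g \<in> idl (insert ?f (?A \<union> K))" unfolding idl_insert_iff by (rule exI)
  then have "(t * s) * g \<in> idl (set (take (Suc i) fs) \<union> K)" unfolding tk by simp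
  moreover have "t * s \<notin> P" using is_prime_mult[OF P] s t by blast
  ultimately show ?case by blast
qed

text \<open>
  Regularity passes from the outer terms of \<open>0 \<rightarrow> R/(J : u) \<rightarrow> R/J \<rightarrow> R/(J + u) \<rightarrow> 0\<close> to the middle term; here
  \<open>K\<close> is the ideal \<open>(J : u)\<close>.
\<close>

lemma regular_at_colon:
  assumes P: "is_prime P" and J: "is_ideal J" and K: "is_ideal K"
    and colon: "\<And>g. g * u \<in> J \<Longrightarrow> g \<in> K" and Ku: "\<And>g. g \<in> K \<Longrightarrow> g * u \<in> J"
    and W: "regular_at P (idl (insert u J)) fs" and WK: "regular_at P K fs"
  shows "regular_at P J fs"
  unfolding regular_at_def
proof (intro allI impI)
  fix i a assume i: "i < length fs" and a: "fs ! i * a \<in> idl (set (take i fs) \<union> J)"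
  let ?f = "fs ! i" and ?A = "set (take i fs)"
  have sub: "idl (?A \<union> J) \<subseteq> idl (?A \<union> idl (insert u J))"
    by (rule ring_mod.span_mono) (use ring_mod.span_superset[of "insert u J"] in blast)
  obtain s where s: "s \<notin> P" "s * a \<in> idl (?A \<union> idl (insert u J))"
    using W i a sub unfolding regular_at_def by blast
  obtain x y where x: "x \<in> idl ?A" "y \<in> idl (insert u J)" "s * a = x + y"
    using s(2) by (auto simp: idl_Un_iff)
  obtain c where c: "y - c * u \<in> J" using x(2) by (auto simp: idl_insert_iff idl_eq[OF J])
  have xy: "x + (y - c * u) \<in> idl (?A \<union> J)"
    by (rule ring_mod.span_add[OF idl_UnI1[OF x(1)] idl_UnI2[OF c]])
  have "s * (?f * a) - ?f * (x + (y - c * u)) \<in> idl (?A \<union> J)"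
    by (rule ring_mod.span_diff[OF ring_mod.span_scale[OF a] ring_mod.span_scale[OF xy]])
  also have "s * (?f * a) - ?f * (x + (y - c * u)) = ?f * (s * a) - ?f * (x + y) + (?f * c) * u"
    by (simp add: algebra_simps)
  also have "\<dots> = (?f * c) * u" unfolding x(3) by simp
  finally have "(?f * c) * u \<in> idl (?A \<union> J)" .
  then have "\<exists>t. t \<notin> P \<and> t * (?f * c) \<in> idl (?A \<union> K)"
    by (rule regular_at_colon_aux[OF P J K _ W less_imp_le[OF i], rotated]) (rule colon)
  then obtain t where t: "t \<notin> P" "t * (?f * c) \<in> idl (?A \<union> K)" by (elim exE conjE)
  then have "?f * (t * c) \<in> idl (?A \<union> K)" by (simp add: algebra_simps)
  then obtain r where r: "r \<notin> P" "r * (t * c) \<in> idl (?A \<union> K)"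
    using WK i unfolding regular_at_def by blast
  obtain p q where pq: "p \<in> idl ?A" "q \<in> K" "r * (t * c) = p + q"
    using r(2) by (auto simp: idl_Un_iff idl_eq[OF K])
  have "u * p + q * u \<in> idl (?A \<union> J)"
    by (rule ring_mod.span_add[OF ring_mod.span_scale[OF idl_UnI1[OF pq(1)]] idl_UnI2[OF Ku[OF pq(2)]]])
  also have "u * p + q * u = r * (t * c) * u" unfolding pq(3) by (simp add: algebra_simps)
  finally have rtu: "r * (t * c) * u \<in> idl (?A \<union> J)" .
  have "r * t * (x + (y - c * u)) + r * (t * c) * u \<in> idl (?A \<union> J)"
    by (rule ring_mod.span_add[OF ring_mod.span_scale[OF xy] rtu])
  also have "r * t * (x + (y - c * u)) + r * (t * c) * u = r * t * (x + y)" by (simp add: algebra_simps)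
  also have "\<dots> = (r * t * s) * a" unfolding x(3)[symmetric] by (simp add: algebra_simps)
  finally have "(r * t * s) * a \<in> idl (?A \<union> J)" .
  moreover have "r * t * s \<notin> P" using is_prime_mult[OF P] s(1) t(1) r(1) by blast
  ultimately show "\<exists>s. s \<notin> P \<and> s * a \<in> idl (?A \<union> J)" by blast
qed

lemma regular_at_idl: "regular_at P (idl J) fs \<longleftrightarrow> regular_at P J fs"
proof -
  have "idl (A \<union> idl J) = idl (A \<union> J)" for A
    by (auto simp: idl_Un_iff)
  then show ?thesis unfolding regular_at_def by simp
qed

theorem cohen_macaulay_type_ring_quotientI:
  fixes I :: "'a::comm_ring_1 set"
  assumes noeth: "noetherian_ring (type_ring :: 'a ring)" and I: "is_ideal I"
    and ex: "\<And>P. is_prime P \<Longrightarrow> I \<subseteq> P \<Longrightarrow> \<exists>fs. set fs \<subseteq> P \<and> regular_at P I fs \<and>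
        (\<forall>r Q. (\<forall>i\<le>r. is_prime (Q i) \<and> I \<subseteq> Q i) \<and> (\<forall>i<r. Q i \<subset> Q (Suc i)) \<and> Q r \<subseteq> P
            \<longrightarrow> r \<le> length fs)"
  shows "cohen_macaulay (type_ring Quot I)"
proof (rule cring.cohen_macaulay_quotientI[OF type_ring_cring noeth], unfold ideal_type_ring_iff primeideal_type_ring_iff)
  show "is_ideal I" by (rule I)
next
  fix P :: "'a set" assume "is_prime P" "I \<subseteq> P"
  from ex[OF this] obtain fs where fs: "set fs \<subseteq> P" "regular_at P I fs" 
    "\<forall>r Q. (\<forall>i\<le>r. is_prime (Q i) \<and> I \<subseteq> Q i) \<and> (\<forall>i<r. Q i \<subset> Q (Suc i)) \<and> Q r \<subseteq> P
            \<longrightarrow> r \<le> length fs" by (elim exE conjE)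
  show "\<exists>xs. set xs \<subseteq> P \<and>
        (\<forall>i<length xs. \<forall>a\<in>carrier type_ring. xs ! i \<otimes>\<^bsub>type_ring\<^esub> a \<in> Idl\<^bsub>type_ring\<^esub> (set (take i xs) \<union> I) \<longrightarrow>
            (\<exists>s\<in>carrier type_ring - P. s \<otimes>\<^bsub>type_ring\<^esub> a \<in> Idl\<^bsub>type_ring\<^esub> (set (take i xs) \<union> I))) \<and>
        (\<forall>r Q. (\<forall>i\<le>r. is_prime (Q i) \<and> I \<subseteq> Q i) \<and> (\<forall>i<r. Q i \<subset> Q (Suc i)) \<and> Q r \<subseteq> P
            \<longrightarrow> r \<le> length xs)"
  proof (intro exI[of _ fs] conjI allI impI ballI)
    fix i a assume "i < length fs" "fs ! i \<otimes>\<^bsub>type_ring\<^esub> a \<in> Idl\<^bsub>type_ring\<^esub> (set (take i fs) \<union> I)"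
    then obtain s where "s \<notin> P" "s * a \<in> idl (set (take i fs) \<union> I)"
      using fs(2) unfolding regular_at_def Idl_type_ring type_ring_simps by blast
    then show "\<exists>s\<in>carrier type_ring - P. s \<otimes>\<^bsub>type_ring\<^esub> a \<in> Idl\<^bsub>type_ring\<^esub> (set (take i fs) \<union> I)"
      unfolding Idl_type_ring type_ring_simps by blast
  next
    fix r Q assume "(\<forall>i\<le>r. is_prime (Q i) \<and> I \<subseteq> Q i) \<and> (\<forall>i<r. Q i \<subset> Q (Suc i)) \<and> Q r \<subseteq> P"
    then show "r \<le> length fs" using fs(3) by blast
  qed (rule fs(1))
qed

section \<open>Hilbert's basis theorem\<close>

abbreviation lookup :: "('a \<Rightarrow>\<^sub>0 'b::zero) \<Rightarrow> 'a \<Rightarrow> 'b" where "lookup \<equiv> Poly_Mapping.lookup"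
abbreviation keys :: "('a \<Rightarrow>\<^sub>0 'b::zero) \<Rightarrow> 'a set" where "keys \<equiv> Poly_Mapping.keys"

lemma poly_mapping_sum_single: "p = (\<Sum>m\<in>keys p. Poly_Mapping.single m (lookup p m))"
proof (rule poly_mapping_eqI)
  fix k
  have "(\<Sum>m\<in>keys p. lookup (Poly_Mapping.single m (lookup p m)) k) = (\<Sum>m\<in>keys p. if m = k then lookup p k else 0)"
    by (intro sum.cong) (auto simp: lookup_single when_def)
  also have "\<dots> = lookup p k" by (simp add: sum.delta not_in_keys_iff_lookup_eq_zero)
  finally show "lookup p k = lookup (\<Sum>m\<in>keys p. Poly_Mapping.single m (lookup p m)) k"
    by (simp add: lookup_sum)
qed

lemma nat_seq_incseq_subseq:
  fixes f :: "nat \<Rightarrow> nat"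
  shows "\<exists>r. strict_mono r \<and> incseq (f \<circ> r)"
proof -
  obtain g :: "nat \<Rightarrow> nat" where g: "strict_mono g" "monoseq (\<lambda>n. f (g n))"
    using seq_monosub[of f] by blast
  show ?thesis
  proof (cases "incseq (\<lambda>n. f (g n))")
    case True then show ?thesis using g by (auto simp: comp_def)
  next
    case False
    then have d: "decseq (\<lambda>n. f (g n))" using g(2) by (simp add: monoseq_iff)
    obtain N where N: "\<And>n. f (g N) \<le> f (g n)"
      using ex_has_least_nat[of "\<lambda>_. True" 0 "\<lambda>n. f (g n)"] by auto
    have "f (g (N + n)) = f (g N)" for n
      using N[of "N + n"] decseqD[OF d, of N "N + n"] by simp
    then have "incseq (f \<circ> (\<lambda>n. g (N + n)))" by (simp add: incseq_def)
    moreover have "strict_mono (\<lambda>n. g (N + n))" using g(1) by (simp add: strict_mono_def)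
    ultimately show ?thesis by blast
  qed
qed

lemma dickson_incseq_subseq:
  fixes m :: "nat \<Rightarrow> 'n \<Rightarrow> nat"
  assumes "finite V"
  shows "\<exists>r. strict_mono r \<and> (\<forall>x\<in>V. incseq (\<lambda>k. m (r k) x))"
  using assms
proof induction
  case empty
  then show ?case by (auto intro: exI[of _ id] simp: strict_mono_def)
next
  case (insert x V)
  then obtain r where r: "strict_mono r" "\<forall>y\<in>V. incseq (\<lambda>k. m (r k) y)" by auto
  obtain q where q: "strict_mono q" "incseq ((\<lambda>k. m (r k) x) \<circ> q)"
    using nat_seq_incseq_subseq[of "\<lambda>k. m (r k) x"] by auto
  have qm: "q a \<le> q b" if "a \<le> b" for a b using q(1) that by (simp add: strict_mono_less_eq)
  have "incseq (\<lambda>k. m ((r \<circ> q) k) y)" if "y \<in> insert x V" for y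
    using that q(2) r(2) qm by (auto simp: incseq_def)
  moreover have "strict_mono (r \<circ> q)" using r(1) q(1) by (simp add: strict_mono_o)
  ultimately show ?case by blast
qed

lemma dickson:
  fixes m :: "nat \<Rightarrow> 'n::finite \<Rightarrow> nat"
  shows "\<exists>i j. i < j \<and> (\<forall>x. m i x \<le> m j x)"
proof -
  obtain r where r: "strict_mono r" "\<forall>x\<in>UNIV. incseq (\<lambda>k. m (r k) x)"
    using dickson_incseq_subseq[of UNIV m] by auto
  have "r 0 < r 1" using r(1) by (simp add: strict_mono_def)
  moreover have "m (r 0) x \<le> m (r 1) x" for x
    using r(2) incseqD[of "\<lambda>k. m (r k) x" 0 1] by simp
  ultimately show ?thesis by blast
qed

definition var_list :: "'n::finite list" where
  "var_list = (SOME xs. set xs = UNIV)"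

lemma set_var_list [simp]: "set (var_list :: 'n::finite list) = UNIV"
  unfolding var_list_def by (rule someI_ex) (simp add: finite_list)

text \<open>
  A monomial order: well-founded, total, and compatible with multiplication. The type of variables carries
  no order, so the exponents are compared along an arbitrary enumeration.
\<close>

definition lex_less :: "('n::finite \<Rightarrow>\<^sub>0 nat) \<Rightarrow> ('n \<Rightarrow>\<^sub>0 nat) \<Rightarrow> bool" where
  "lex_less m m' \<longleftrightarrow> (map (lookup m) var_list, map (lookup m') var_list) \<in> lex less_than"

lemma wf_lex_less: "wf {(m :: 'n::finite \<Rightarrow>\<^sub>0 nat, m'). lex_less m m'}"
proof -
  have "{(m :: 'n \<Rightarrow>\<^sub>0 nat, m'). lex_less m m'} = inv_image (lex less_than) (\<lambda>m. map (lookup m) var_list)"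
    by (auto simp: lex_less_def inv_image_def)
  then show ?thesis by (simp only:) (intro wf_inv_image wf_lex wf_less_than)
qed

lemma lex_less_trans: "lex_less a b \<Longrightarrow> lex_less b c \<Longrightarrow> lex_less a c"
  using lex_transI[of less_than] unfolding lex_less_def trans_def by simp

lemma lex_map_total:
  "map f xs \<noteq> map g xs \<Longrightarrow> (map f xs, map g xs) \<in> lex less_than \<or> (map g xs, map f xs) \<in> lex less_than"
  by (induction xs) auto

lemma lex_less_total: "a \<noteq> b \<Longrightarrow> lex_less a b \<or> lex_less b a"
proof -
  assume "a \<noteq> b"
  then obtain x where "lookup a x \<noteq> lookup b x" by (metis poly_mapping_eqI)
  then have "map (lookup a) var_list \<noteq> map (lookup b) var_list" by auto
  then show ?thesis unfolding lex_less_def by (rule lex_map_total)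
qed

lemma lex_map_add:
  fixes f g h :: "'n \<Rightarrow> nat"
  shows "(map f xs, map g xs) \<in> lex less_than \<Longrightarrow> (map (\<lambda>x. h x + f x) xs, map (\<lambda>x. h x + g x) xs) \<in> lex less_than"
  by (induction xs) auto

lemma lex_less_add: "lex_less a b \<Longrightarrow> lex_less (c + a) (c + b)"
proof -
  have "lookup (c + a) = (\<lambda>x. lookup c x + lookup a x)" for a by (rule ext) (simp add: lookup_add)
  then show "lex_less a b \<Longrightarrow> lex_less (c + a) (c + b)"
    unfolding lex_less_def by (simp add: lex_map_add)
qed

lemma lead_monomial_exists:
  assumes "p \<noteq> (0 :: ('n::finite \<Rightarrow>\<^sub>0 nat) \<Rightarrow>\<^sub>0 'b::zero)"
  shows "\<exists>m\<in>keys p. \<forall>n\<in>keys p. n = m \<or> lex_less n m"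
proof -
  have "\<exists>m\<in>A. \<forall>n\<in>A. n = m \<or> lex_less n m" if "finite A" "A \<noteq> {}" for A :: "('n \<Rightarrow>\<^sub>0 nat) set"
    using that
  proof (induction rule: finite_ne_induct)
    case (insert x A)
    then obtain m where m: "m \<in> A" "\<forall>n\<in>A. n = m \<or> lex_less n m" by auto
    show ?case
    proof (cases "lex_less m x")
      case True
      then have "\<forall>n\<in>insert x A. n = x \<or> lex_less n x" using m lex_less_trans[OF _ True] by auto
      then show ?thesis by blast
    next
      case False
      then have "x = m \<or> lex_less x m" using lex_less_total by blast
      then show ?thesis using m by blast
    qed
  qed simp
  moreover have "keys p \<noteq> {}" using assms by simp
  ultimately show ?thesis by simp
qed

definition lead_monomial :: "(('n::finite \<Rightarrow>\<^sub>0 nat) \<Rightarrow>\<^sub>0 'b::zero) \<Rightarrow> ('n \<Rightarrow>\<^sub>0 nat)" where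
  "lead_monomial p = (SOME m. m \<in> keys p \<and> (\<forall>n\<in>keys p. n = m \<or> lex_less n m))"

lemma lead_monomial:
  assumes "p \<noteq> 0"
  shows "lead_monomial p \<in> keys p" "n \<in> keys p \<Longrightarrow> n = lead_monomial p \<or> lex_less n (lead_monomial p)"
proof -
  have "\<exists>m. m \<in> keys p \<and> (\<forall>n\<in>keys p. n = m \<or> lex_less n m)"
    using lead_monomial_exists[OF assms] by blast
  from someI_ex[OF this] show "lead_monomial p \<in> keys p" "n \<in> keys p \<Longrightarrow> n = lead_monomial p \<or> lex_less n (lead_monomial p)"
    unfolding lead_monomial_def by blast+
qed

lemma single_times:
  fixes p :: "('n \<Rightarrow>\<^sub>0 nat) \<Rightarrow>\<^sub>0 'k::comm_ring_1"
  shows "lookup (Poly_Mapping.single g c * p) (g + m) = c * lookup p m"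
    and "keys (Poly_Mapping.single g c * p) \<subseteq> (+) g ` keys p"
proof -
  have eq: "Poly_Mapping.single g c * p = (\<Sum>n\<in>keys p. Poly_Mapping.single (g + n) (c * lookup p n))"
    by (subst (1) poly_mapping_sum_single[of p]) (simp add: sum_distrib_left mult_single)
  have "lookup (Poly_Mapping.single g c * p) (g + m) = (\<Sum>n\<in>keys p. if n = m then c * lookup p m else 0)"
    unfolding eq lookup_sum by (intro sum.cong) (auto simp: lookup_single when_def)
  also have "\<dots> = c * lookup p m" by (simp add: sum.delta not_in_keys_iff_lookup_eq_zero)
  finally show "lookup (Poly_Mapping.single g c * p) (g + m) = c * lookup p m" .
  show "keys (Poly_Mapping.single g c * p) \<subseteq> (+) g ` keys p"
    using keys_mult[of "Poly_Mapping.single g c" p] by (auto split: if_splits)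
qed

text \<open>
  If \<open>J\<close> were not finitely generated, one could choose \<open>f 0, f 1, \<dots>\<close> in \<open>J\<close>, each outside the ideal of its
  predecessors and with the least possible leading monomial. By Dickson's lemma some leading monomial
  divides a later one. Subtracting a multiple of the earlier element from the later one cancels the leading
  term and contradicts the choice of the later one.
\<close>

theorem mpoly_noetherian: "noetherian_ring (type_ring :: ('n::finite, 'k::field) mpoly ring)"
proof -
  interpret R: cring "type_ring :: ('n, 'k) mpoly ring" by (rule type_ring_cring)
  have "\<exists>B. finite B \<and> J = idl B" if J: "is_ideal J" for J :: "('n, 'k) mpoly set"
  proof (rule ccontr)
    assume "\<not> (\<exists>B. finite B \<and> J = idl B)"
    then have ne: "\<exists>p. p \<in> J \<and> p \<notin> idl B" if "finite B" "B \<subseteq> J" for B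
      using that idl_subset_iff[OF J, of B] by blast
    define good where "good B p \<longleftrightarrow> p \<in> J \<and> p \<notin> idl B \<and>
       (\<forall>q. q \<in> J \<and> q \<notin> idl B \<longrightarrow> \<not> lex_less (lead_monomial q) (lead_monomial p))" for B p
    have ex: "\<exists>p. good B p" if B: "finite B" "B \<subseteq> J" for B
    proof -
      obtain p where "p \<in> {p. p \<in> J \<and> p \<notin> idl B}" using ne[OF B] by blast
      then have "lead_monomial p \<in> lead_monomial ` {p. p \<in> J \<and> p \<notin> idl B}" by (rule imageI)
      from wf_lex_less[unfolded wf_eq_minimal, rule_format, OF this]
      obtain m where m: "m \<in> lead_monomial ` {p. p \<in> J \<and> p \<notin> idl B}"
        "\<forall>y. (y, m) \<in> {(m, m'). lex_less m m'} \<longrightarrow> y \<notin> lead_monomial ` {p. p \<in> J \<and> p \<notin> idl B}"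
        by (elim bexE)
      from m(1) obtain p where p: "p \<in> J" "p \<notin> idl B" "m = lead_monomial p" by blast
      have "\<not> lex_less (lead_monomial q) (lead_monomial p)" if "q \<in> J" "q \<notin> idl B" for q
        using m(2)[rule_format, of "lead_monomial q"] that unfolding p(3) by blast
      then show ?thesis using p unfolding good_def by blast
    qed
    define pick where "pick B = (SOME p. good B p)" for B
    have pick: "good B (pick B)" if "finite B" "B \<subseteq> J" for B
      unfolding pick_def using ex[OF that] by (rule someI_ex)
    define G where "G = rec_nat {} (\<lambda>_ B. insert (pick B) B)"
    have G0: "G 0 = {}" and GS: "G (Suc n) = insert (pick (G n)) (G n)" for n
      by (simp_all add: G_def)
    have G: "finite (G n) \<and> G n \<subseteq> J" for n
      by (induction n) (use pick in \<open>auto simp: G0 GS good_def\<close>)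
    define f where "f n = pick (G n)" for n
    have f: "f n \<in> J" "f n \<notin> idl (G n)"
      "\<And>q. q \<in> J \<Longrightarrow> q \<notin> idl (G n) \<Longrightarrow> \<not> lex_less (lead_monomial q) (lead_monomial (f n))" for n
      using pick[of "G n"] G[of n] unfolding f_def good_def by blast+
    have f0: "f n \<noteq> 0" for n using f(2)[of n] ring_mod.span_zero[of "G n"] by metis
    have fG: "f i \<in> G j" if "i < j" for i j
      using that by (induction j) (auto simp: GS f_def less_Suc_eq)
    obtain i j where ij: "i < j" "\<And>x. lookup (lead_monomial (f i)) x \<le> lookup (lead_monomial (f j)) x"
      using dickson[of "\<lambda>n x. lookup (lead_monomial (f n)) x"] by blast
    let ?a = "lead_monomial (f i)" and ?b = "lead_monomial (f j)"
    define g where "g = ?b - ?a"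
    have gb: "g + ?a = ?b"
      by (rule poly_mapping_eqI) (use ij(2) in \<open>simp add: g_def lookup_add lookup_minus\<close>)
    define c where "c = lookup (f j) ?b / lookup (f i) ?a"
    have ca: "lookup (f i) ?a \<noteq> 0" using lead_monomial(1)[OF f0[of i]] by (simp add: in_keys_iff)
    define h where "h = Poly_Mapping.single g c * f i"
    \<comment> \<open>The leading terms of \<open>f j\<close> and \<open>h\<close> are equal.\<close>
    define q where "q = f j - h"
    have hG: "h \<in> idl (G j)" unfolding h_def by (intro ring_mod.span_scale ring_mod.span_base fG ij)
    have "h \<in> J" unfolding h_def by (rule is_ideal_mult_left[OF J f(1)])
    then have qJ: "q \<in> J" unfolding q_def using f(1) J by (intro ring_mod.subspace_diff)
    have qG: "q \<notin> idl (G j)"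
    proof
      assume "q \<in> idl (G j)"
      then have "q + h \<in> idl (G j)" using hG by (rule ring_mod.span_add)
      then show False using f(2)[of j] by (simp add: q_def)
    qed
    then have q0: "q \<noteq> 0" using ring_mod.span_zero[of "G j"] by metis
    have "lookup h ?b = lookup (f j) ?b"
      using single_times(1)[of g c "f i" ?a] ca unfolding gb h_def by (simp add: c_def)
    then have "lookup q ?b = 0" by (simp add: q_def lookup_minus)
    then have lq: "lead_monomial q \<noteq> ?b" using lead_monomial(1)[OF q0] by (metis in_keys_iff)
    have "lead_monomial q \<in> keys (f j) \<union> keys h"
      using lead_monomial(1)[OF q0] keys_diff[of "f j" h] unfolding q_def by blast
    then have "lex_less (lead_monomial q) ?b"
    proof
      assume "lead_monomial q \<in> keys (f j)"
      then show ?thesis using lead_monomial(2)[OF f0[of j]] lq by blast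
    next
      assume "lead_monomial q \<in> keys h"
      then obtain n where n: "n \<in> keys (f i)" "lead_monomial q = g + n"
        using single_times(2)[of g c "f i"] unfolding h_def by blast
      then have "n \<noteq> ?a" using lq gb by auto
      then have "lex_less n ?a" using lead_monomial(2)[OF f0[of i] n(1)] by blast
      then show ?thesis using lex_less_add[of n ?a g] n(2) gb by simp
    qed
    then show False using f(3)[OF qJ qG] by blast
  qed
  then show ?thesis
    by (intro R.noetherian_ringI) (simp add: ideal_type_ring_iff Idl_type_ring)
qed

section \<open>Polynomials as univariate polynomials\<close>

definition rhom :: "('a::comm_ring_1 \<Rightarrow> 'b::comm_ring_1) \<Rightarrow> bool" where
  "rhom h \<longleftrightarrow> h 1 = 1 \<and> (\<forall>a b. h (a + b) = h a + h b) \<and> (\<forall>a b. h (a * b) = h a * h b)"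

lemma rhom_1: "rhom h \<Longrightarrow> h 1 = 1"
  and rhom_add: "rhom h \<Longrightarrow> h (a + b) = h a + h b"
  and rhom_mult: "rhom h \<Longrightarrow> h (a * b) = h a * h b"
  by (simp_all add: rhom_def)

lemma rhom_0: "rhom h \<Longrightarrow> h 0 = 0"
  using rhom_add[of h 0 0] by simp

lemma rhom_sum: "rhom h \<Longrightarrow> h (sum f A) = (\<Sum>x\<in>A. h (f x))"
  by (induction A rule: infinite_finite_induct) (simp_all add: rhom_0 rhom_add)

lemma rhom_power: "rhom h \<Longrightarrow> h (a ^ n) = h a ^ n"
  by (induction n) (simp_all add: rhom_1 rhom_mult)

lemma rhom_comp: "rhom h \<Longrightarrow> rhom g \<Longrightarrow> rhom (\<lambda>x. h (g x))"
  by (simp add: rhom_def)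

lemma rhom_const_poly: "rhom (\<lambda>a. [:a:])"
  by (simp add: rhom_def one_pCons)

lemma rhom_poly: "rhom (\<lambda>p. poly p a)"
  by (simp add: rhom_def)

lemma coeff_map_poly_rhom: "rhom h \<Longrightarrow> coeff (map_poly h p) k = h (coeff p k)"
  by (simp add: coeff_map_poly rhom_0)

lemma rhom_map_poly: "rhom h \<Longrightarrow> rhom (map_poly h)"
  unfolding rhom_def[of "map_poly h"]
  by (auto simp: poly_eq_iff coeff_map_poly_rhom rhom_add coeff_mult rhom_sum rhom_mult rhom_1 rhom_0)

lemma map_poly_rhom_pCons: "rhom h \<Longrightarrow> map_poly h (pCons a p) = pCons (h a) (map_poly h p)"
  by (simp add: poly_eq_iff coeff_map_poly_rhom coeff_pCons split: nat.split)

definition Const :: "'k::field \<Rightarrow> ('n::finite, 'k) mpoly" where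
  "Const a = Poly_Mapping.single 0 a"

lemma rhom_Const: "rhom Const"
  by (simp add: rhom_def Const_def single_add mult_single)

lemma poly_var_power: "poly_var i ^ k = Poly_Mapping.single (Poly_Mapping.single i k) 1"
proof (induction k)
  case (Suc k)
  then show ?case by (simp add: poly_var_def mult_single single_add[symmetric])
qed simp

lemma prod_single_1:
  "(\<Prod>i\<in>A. Poly_Mapping.single (f i) (1::'k::comm_ring_1)) = Poly_Mapping.single (\<Sum>i\<in>A. f i) 1"
  by (induction A rule: infinite_finite_induct) (simp_all add: mult_single)

lemma single_eq_prod:
  "Poly_Mapping.single m (a::'k::field) = Const a * (\<Prod>i\<in>UNIV. poly_var (i::'n::finite) ^ lookup m i)"
proof -
  have "(\<Sum>i\<in>UNIV. Poly_Mapping.single i (lookup m i)) = m"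
    by (rule poly_mapping_eqI) (simp add: lookup_sum lookup_single when_def)
  then show ?thesis by (simp add: poly_var_power prod_single_1 Const_def mult_single)
qed

lemma mpoly_induct [case_names Const var add mult]:
  fixes p :: "('n::finite, 'k::field) mpoly"
  assumes C: "\<And>a. P (Const a)" and V: "\<And>i. P (poly_var i)"
    and A: "\<And>p q. P p \<Longrightarrow> P q \<Longrightarrow> P (p + q)" and M: "\<And>p q. P p \<Longrightarrow> P q \<Longrightarrow> P (p * q)"
  shows "P p"
proof -
  have one: "P 1" using C[of 1] unfolding rhom_1[OF rhom_Const] .
  have zero: "P 0" using C[of 0] unfolding rhom_0[OF rhom_Const] .
  have pw: "P (poly_var i ^ k)" for i k by (induction k) (use one V M in auto)
  have pr: "P (\<Prod>i\<in>A. poly_var i ^ f i)" for A f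
    by (induction A rule: infinite_finite_induct) (use one pw M in auto)
  have "P (\<Sum>m\<in>A. Poly_Mapping.single m (f m))" for A f
    by (induction A rule: infinite_finite_induct) (use zero A M C pr in \<open>auto simp: single_eq_prod\<close>)
  then show ?thesis by (subst poly_mapping_sum_single)
qed

lemma rhom_eqI:
  fixes h g :: "('n::finite, 'k::field) mpoly \<Rightarrow> 'b::comm_ring_1"
  assumes "rhom h" "rhom g" "\<And>a. h (Const a) = g (Const a)" "\<And>i. h (poly_var i) = g (poly_var i)"
  shows "h p = g p"
  by (induction p rule: mpoly_induct) (simp_all add: assms(3,4) rhom_add[OF assms(1)] rhom_add[OF assms(2)]
       rhom_mult[OF assms(1)] rhom_mult[OF assms(2)])

text \<open>
  Evaluation at \<open>v\<close>, with coefficients mapped by \<open>c\<close>. By its universal property it provides all the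
  homomorphisms used below: substitutions, and the passage to univariate polynomials.
\<close>

definition mpoly_eval :: "('k \<Rightarrow> 'b) \<Rightarrow> ('n \<Rightarrow> 'b) \<Rightarrow> ('n::finite, 'k::field) mpoly \<Rightarrow> 'b::comm_ring_1" where
  "mpoly_eval c v p = (\<Sum>m\<in>keys p. c (lookup p m) * (\<Prod>i\<in>UNIV. v i ^ lookup m i))"

lemma mpoly_eval_superset:
  assumes "rhom c" "finite A" "keys p \<subseteq> A"
  shows "mpoly_eval c v p = (\<Sum>m\<in>A. c (lookup p m) * (\<Prod>i\<in>UNIV. v i ^ lookup m i))"
  unfolding mpoly_eval_def using assms
  by (intro sum.mono_neutral_left) (auto simp: in_keys_iff rhom_0)

lemma mpoly_eval_single: "rhom c \<Longrightarrow> mpoly_eval c v (Poly_Mapping.single m a) = c a * (\<Prod>i\<in>UNIV. v i ^ lookup m i)"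
  by (subst mpoly_eval_superset[of c "{m}"]) auto

lemma mpoly_eval_add:
  assumes "rhom c" shows "mpoly_eval c v (p + q) = mpoly_eval c v p + mpoly_eval c v q"
proof -
  let ?A = "keys p \<union> keys q"
  have "keys (p + q) \<subseteq> ?A" by (rule keys_add)
  then show ?thesis
    using assms by (simp add: mpoly_eval_superset[of c ?A] lookup_add rhom_add sum.distrib distrib_right)
qed

lemma mpoly_eval_zero: "mpoly_eval c v 0 = 0" by (simp add: mpoly_eval_def)

lemma mpoly_eval_sum: "rhom c \<Longrightarrow> mpoly_eval c v (sum f A) = (\<Sum>x\<in>A. mpoly_eval c v (f x))"
  by (induction A rule: infinite_finite_induct) (simp_all add: mpoly_eval_zero mpoly_eval_add)

lemma rhom_mpoly_eval:
  assumes c: "rhom c" shows "rhom (mpoly_eval c v)"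
  unfolding rhom_def
proof (intro conjI allI)
  show "mpoly_eval c v 1 = 1"
    using mpoly_eval_single[OF c, of v 0 1] by (simp add: rhom_1[OF c])
  show "mpoly_eval c v (p + q) = mpoly_eval c v p + mpoly_eval c v q" for p q by (rule mpoly_eval_add[OF c])
  show "mpoly_eval c v (p * q) = mpoly_eval c v p * mpoly_eval c v q" for p q
  proof -
    have "p * q = (\<Sum>m\<in>keys p. \<Sum>n\<in>keys q. Poly_Mapping.single (m + n) (lookup p m * lookup q n))"
      by (subst (1) poly_mapping_sum_single[of p], subst (1) poly_mapping_sum_single[of q])
         (simp add: sum_product mult_single)
    then have "mpoly_eval c v (p * q) = (\<Sum>m\<in>keys p. \<Sum>n\<in>keys q. 
        (c (lookup p m) * (\<Prod>i\<in>UNIV. v i ^ lookup m i)) * (c (lookup q n) * (\<Prod>i\<in>UNIV. v i ^ lookup n i)))"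
      by (simp add: mpoly_eval_sum[OF c] mpoly_eval_single[OF c] lookup_add power_add prod.distrib rhom_mult[OF c] mult_ac)
    also have "\<dots> = mpoly_eval c v p * mpoly_eval c v q" unfolding mpoly_eval_def by (simp add: sum_product)
    finally show ?thesis .
  qed
qed

lemma mpoly_eval_Const: "rhom c \<Longrightarrow> mpoly_eval c v (Const a) = c a"
  by (simp add: Const_def mpoly_eval_single)

lemma mpoly_eval_var: "rhom c \<Longrightarrow> mpoly_eval c v (poly_var j) = v j"
proof -
  assume c: "rhom c"
  have "(\<Prod>i\<in>UNIV. v i ^ lookup (Poly_Mapping.single j (1::nat)) i) = (\<Prod>i\<in>UNIV. if i = j then v j else 1)"
    by (intro prod.cong) (auto simp: lookup_single when_def)
  then show ?thesis unfolding poly_var_def by (simp add: mpoly_eval_single[OF c] rhom_1[OF c])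
qed

abbreviation subst :: "('n \<Rightarrow> ('n, 'k) mpoly) \<Rightarrow> ('n::finite, 'k::field) mpoly \<Rightarrow> ('n, 'k) mpoly" where
  "subst \<equiv> mpoly_eval Const"

abbreviation lift :: "('n \<Rightarrow> ('n, 'k) mpoly poly) \<Rightarrow> ('n::finite, 'k::field) mpoly \<Rightarrow> ('n, 'k) mpoly poly" where
  "lift \<equiv> mpoly_eval (\<lambda>a. [:Const a:])"

lemma rhom_cp: "rhom (\<lambda>a. [:Const a:])"
  by (rule rhom_comp[OF rhom_const_poly rhom_Const])

lemmas rhom_subst = rhom_mpoly_eval[OF rhom_Const] and rhom_lift = rhom_mpoly_eval[OF rhom_cp]
lemmas subst_simps = mpoly_eval_Const[OF rhom_Const] mpoly_eval_var[OF rhom_Const]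
lemmas lift_simps = mpoly_eval_Const[OF rhom_cp] mpoly_eval_var[OF rhom_cp]

definition keep_vars :: "'n set \<Rightarrow> ('n::finite, 'k::field) mpoly \<Rightarrow> ('n, 'k) mpoly" where
  "keep_vars V = subst (\<lambda>i. if i \<in> V then poly_var i else 0)"

lemma rhom_keep_vars: "rhom (keep_vars V)" unfolding keep_vars_def by (rule rhom_subst)
lemma keep_vars_simps: "keep_vars V (Const a) = Const a" "keep_vars V (poly_var i) = (if i \<in> V then poly_var i else 0)"
  by (simp_all add: keep_vars_def subst_simps)

text \<open>
  The polynomials in the variables \<open>V\<close>, described as the fixed points of a retraction. That way closure
  properties follow from homomorphism laws, and no support of a product has to be computed.
\<close>

definition polys_in :: "'n set \<Rightarrow> ('n::finite, 'k::field) mpoly set" where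
  "polys_in V = {p. keep_vars V p = p}"

lemma polys_in_mono:
  assumes VW: "V \<subseteq> W" shows "(polys_in V :: ('n::finite, 'k::field) mpoly set) \<subseteq> polys_in W"
proof
  fix p :: "('n, 'k) mpoly" assume p: "p \<in> polys_in V"
  have "keep_vars W (keep_vars V p) = keep_vars V p"
    by (rule rhom_eqI[OF rhom_comp[OF rhom_keep_vars rhom_keep_vars] rhom_keep_vars])
       (use VW in \<open>auto simp: keep_vars_simps rhom_0[OF rhom_keep_vars]\<close>)
  then show "p \<in> polys_in W" using p by (simp add: polys_in_def)
qed

lemma polys_in_closed:
  "i \<in> V \<Longrightarrow> poly_var i \<in> polys_in V"
  "Const a \<in> polys_in V"
  "p \<in> polys_in V \<Longrightarrow> q \<in> polys_in V \<Longrightarrow> p + q \<in> polys_in V"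
  "p \<in> polys_in V \<Longrightarrow> q \<in> polys_in V \<Longrightarrow> p * q \<in> polys_in V"
  "p \<in> polys_in V \<Longrightarrow> p ^ n \<in> polys_in V"
  "(\<And>x. x \<in> A \<Longrightarrow> f x \<in> polys_in V) \<Longrightarrow> sum f A \<in> polys_in V"
  by (auto simp: polys_in_def keep_vars_simps rhom_add[OF rhom_keep_vars] rhom_mult[OF rhom_keep_vars] rhom_power[OF rhom_keep_vars] rhom_sum[OF rhom_keep_vars])

text \<open>
  The isomorphism of \<open>k[x\<^sub>1, \<dots>, x\<^sub>n]\<close> with a polynomial ring in one variable \<open>x\<close> over the other ones; the
  coefficients stay in the big ring.
\<close>

definition univar :: "'n \<Rightarrow> ('n::finite, 'k::field) mpoly \<Rightarrow> ('n, 'k) mpoly poly" where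
  "univar x = lift (\<lambda>i. if i = x then [:0, 1:] else [:poly_var i:])"

lemma rhom_univar: "rhom (univar x)" unfolding univar_def by (rule rhom_lift)
lemma univar_simps: "univar x (Const a) = [:Const a:]" "univar x (poly_var i) = (if i = x then [:0, 1:] else [:poly_var i:])"
  by (simp_all add: univar_def lift_simps)

lemma univar_free:
  assumes "p \<in> polys_in V" "x \<notin> V" shows "univar x p = [:p:]"
proof -
  have "univar x (keep_vars V p) = [:keep_vars V p:]"
    by (rule rhom_eqI[OF rhom_comp[OF rhom_univar rhom_keep_vars] rhom_comp[OF rhom_const_poly rhom_keep_vars]])
       (use assms(2) in \<open>auto simp: keep_vars_simps univar_simps rhom_0[OF rhom_univar]\<close>)
  then show ?thesis using assms(1) by (simp add: polys_in_def)
qed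

lemma univar_coeff:
  assumes "p \<in> polys_in (insert x V)" "x \<notin> V" shows "coeff (univar x p) k \<in> polys_in V"
proof -
  have "map_poly (keep_vars V) (univar x (keep_vars (insert x V) p)) = univar x (keep_vars (insert x V) p)"
    by (rule rhom_eqI[OF rhom_comp[OF rhom_map_poly[OF rhom_keep_vars] rhom_comp[OF rhom_univar rhom_keep_vars]] rhom_comp[OF rhom_univar rhom_keep_vars]])
       (use assms(2) in \<open>auto simp: keep_vars_simps univar_simps rhom_0[OF rhom_univar] map_poly_rhom_pCons[OF rhom_keep_vars] rhom_0[OF rhom_keep_vars] rhom_1[OF rhom_keep_vars]\<close>)
  then have "map_poly (keep_vars V) (univar x p) = univar x p" using assms(1) by (simp add: polys_in_def)
  then have "coeff (map_poly (keep_vars V) (univar x p)) k = coeff (univar x p) k" by simp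
  then show ?thesis by (simp add: polys_in_def coeff_map_poly_rhom[OF rhom_keep_vars])
qed

lemma univar_eval: "poly (univar x p) (poly_var x) = p"
proof (rule rhom_eqI[where h = "\<lambda>p. poly (univar x p) (poly_var x)" and g = "\<lambda>p. p"])
  show "rhom (\<lambda>p. poly (univar x p) (poly_var x))" by (rule rhom_comp[OF rhom_poly rhom_univar])
qed (auto simp: rhom_def univar_simps)

lemma univar_poly:
  assumes "\<And>k. coeff F k \<in> polys_in V" "x \<notin> V"
  shows "univar x (poly F (poly_var x)) = F"
proof -
  have "univar x (poly F (poly_var x)) = (\<Sum>i\<le>degree F. univar x (coeff F i) * univar x (poly_var x) ^ i)"
    by (simp add: poly_altdef rhom_sum[OF rhom_univar] rhom_mult[OF rhom_univar] rhom_power[OF rhom_univar])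
  also have "\<dots> = (\<Sum>i\<le>degree F. monom (coeff F i) i)"
    using univar_free[OF assms] by (intro sum.cong refl) (simp add: univar_simps monom_altdef)
  also have "\<dots> = F" by (rule poly_as_sum_of_monoms)
  finally show ?thesis .
qed

lemma poly_var_poly_polys_in:
  assumes "\<And>k. coeff F k \<in> polys_in V"
  shows "poly F (poly_var x) \<in> polys_in (insert x V)"
  unfolding poly_altdef
  by (intro polys_in_closed subsetD[OF polys_in_mono assms]) (auto simp: polys_in_closed)

section \<open>Regularity modulo powers of variables\<close>

text \<open>
  Let \<open>u\<close> be the leading coefficient of \<open>F\<close>. Modulo \<open>J\<close>, \<open>u\<close> kills the leading coefficient of \<open>B\<close>, since their
  product is the leading coefficient of \<open>F * B\<close>. So the degree of \<open>u B\<close> can be lowered, and one proceeds by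
  induction.
\<close>

lemma lead_power_mult_coeff:
  fixes F :: "'a::comm_ring_1 poly"
  assumes J: "is_ideal J" and top: "\<And>k. k > D \<Longrightarrow> coeff F k = 0"
    and FB: "\<And>k. coeff (F * B) k \<in> J"
  shows "\<exists>K. \<forall>k. coeff F D ^ K * coeff B k \<in> J"
proof -
  let ?u = "coeff F D"
  have "\<exists>K. \<forall>k. ?u ^ K * coeff B k \<in> J" if "\<forall>k\<ge>n. coeff B k = 0" "\<forall>k. coeff (F * B) k \<in> J" for n B
    using that
  proof (induction n arbitrary: B)
    case 0
    then show ?case using ring_mod.subspace_0[OF J] by auto
  next
    case (Suc n)
    let ?t = "coeff B n"
    have "coeff (F * B) (D + n) = (\<Sum>i\<le>D + n. if i = D then ?u * ?t else 0)"
      unfolding coeff_mult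
    proof (rule sum.cong[OF refl])
      fix i assume "i \<in> {..D + n}"
      show "coeff F i * coeff B (D + n - i) = (if i = D then ?u * ?t else 0)"
        using top[of i] Suc.prems(1)[rule_format, of "D + n - i"] by (cases i D rule: linorder_cases) auto
    qed
    then have ut: "?u * ?t \<in> J" using Suc.prems(2)[rule_format, of "D + n"] by (simp add: sum.delta)
    define B' where "B' = smult ?u B - monom (?u * ?t) n"
    have B'c: "coeff B' k = ?u * coeff B k - (if k = n then ?u * ?t else 0)" for k
      by (simp add: B'_def)
    have "\<forall>k\<ge>n. coeff B' k = 0" using Suc.prems(1) by (auto simp: B'c)
    moreover have "\<forall>k. coeff (F * B') k \<in> J"
    proof
      fix k
      have "coeff (F * B') k = ?u * coeff (F * B) k - coeff (monom (?u * ?t) n * F) k"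
        by (simp add: B'_def right_diff_distrib mult.commute)
      also have "\<dots> \<in> J"
        using Suc.prems(2) is_ideal_mult_left[OF J] is_ideal_mult_right[OF J ut]  ring_mod.subspace_0[OF J]
        by (intro ring_mod.subspace_diff[OF J]) (auto simp: coeff_monom_mult)
      finally show "coeff (F * B') k \<in> J" .
    qed
    ultimately obtain K where K: "\<forall>k. ?u ^ K * coeff B' k \<in> J" using Suc.IH by blast
    have "?u ^ Suc K * coeff B k \<in> J" for k
    proof -
      have "?u ^ Suc K * coeff B k = ?u ^ K * coeff B' k + (if k = n then ?u ^ K * (?u * ?t) else 0)"
        by (auto simp: B'c algebra_simps)
      also have "\<dots> \<in> J"
        using K is_ideal_mult_left[OF J ut] ring_mod.subspace_0[OF J] by (intro ring_mod.subspace_add[OF J]) auto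
      finally show ?thesis .
    qed
    then show ?case by blast
  qed
  from this[of "Suc (degree B)" B] FB show ?thesis by (auto simp: coeff_eq_0)
qed

text \<open>
  If all generators of an ideal are free of a variable, membership can be tested coefficient by coefficient.
\<close>

lemma hom_coeff_idl:
  fixes h :: "'a::comm_ring_1 \<Rightarrow> 'a poly"
  assumes h: "rhom h" and B: "\<And>b. b \<in> B \<Longrightarrow> h b = [:b:]" and p: "p \<in> idl B"
  shows "coeff (h p) k \<in> idl B"
  using p
proof (induction arbitrary: k rule: ring_mod.span_induct_alt)
  case base
  then show ?case by (simp add: rhom_0[OF h] ring_mod.span_zero)
next
  case (step c x y)
  have "coeff (h (c * x + y)) k = coeff (h c) k * x + coeff (h y) k"
    using B[OF step(1)] by (simp add: rhom_add[OF h] rhom_mult[OF h])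
  then show ?case using step by (simp add: ring_mod.span_add ring_mod.span_scale ring_mod.span_base)
qed

text \<open>
  The linear forms \<open>y\<^sub>c\<close>. If every facet has exactly one vertex of each colour, they are a system of parameters
  of all the rings \<open>R/Q'\<close> at once.
\<close>

definition colsum :: "('n \<Rightarrow> 'n) \<Rightarrow> 'n \<Rightarrow> ('n::finite, 'k::field) mpoly" where
  "colsum col c = (\<Sum>i | col i = c. poly_var i)"

text \<open>
  Sequences that look regular at \<open>N\<close> for a formal reason: every member involves a variable \<open>x\<close> that is new
  with respect to its predecessors, and its leading coefficient in \<open>x\<close>, at degree \<open>D\<close>, is invertible at \<open>N\<close>.
\<close>

definition triangular :: "'n set \<Rightarrow> ('n::finite, 'k::field) mpoly set \<Rightarrow> ('n, 'k) mpoly list \<Rightarrow> bool" where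
  "triangular C N gs \<longleftrightarrow> (\<forall>i<length gs. \<exists>x V D. x \<notin> V \<and> insert x V \<subseteq> C \<and> set (take i gs) \<subseteq> polys_in V \<and>
     gs ! i \<in> polys_in (insert x V) \<and> (\<forall>k>D. coeff (univar x (gs ! i)) k = 0) \<and> coeff (univar x (gs ! i)) D \<notin> N)"

text \<open>
  Let \<open>x'\<close> be the vertex of \<open>G\<close> of colour \<open>x\<close>. The homomorphism \<open>h\<close> expresses the variable \<open>x'\<close> through
  \<open>y\<^sub>x\<close>, which becomes the new indeterminate. The powers of variables outside \<open>G\<close> and the other forms \<open>y\<^sub>c\<close> become
  constants, and the current member of the sequence becomes a polynomial whose leading coefficient lies
  outside \<open>P\<close>. Division by it then works up to a power of this coefficient.
\<close>

lemma regular_at_box: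
  fixes P :: "('n::finite, 'k::field) mpoly set"
  assumes P: "is_prime P" and tri: "triangular C {p. subst (colsum col) p \<in> P} gs"
    and G: "\<And>x. x \<in> C \<Longrightarrow> \<exists>!x'. x' \<in> G \<and> col x' = x" and Y: "Y \<inter> G = {}"
  shows "regular_at P {poly_var i ^ e i | i. i \<in> Y} (map (subst (colsum col)) gs)"
  unfolding regular_at_def
proof (intro allI impI)
  let ?s = "subst (colsum col)" let ?Q = "{poly_var i ^ e i | i. i \<in> Y} :: ('n, 'k) mpoly set"
  note hs = rhom_subst[of "colsum col"]
  fix i a assume i: "i < length (map ?s gs)"
    and a: "map ?s gs ! i * a \<in> idl (set (take i (map ?s gs)) \<union> ?Q)"
  then have i': "i < length gs" by simp
  from tri[unfolded triangular_def, rule_format, OF this]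
  obtain x V D where x: "x \<notin> V" "insert x V \<subseteq> C" and gV: "set (take i gs) \<subseteq> polys_in V"
    and g: "gs ! i \<in> polys_in (insert x V)" and D: "\<forall>k>D. coeff (univar x (gs ! i)) k = 0"
      "coeff (univar x (gs ! i)) D \<notin> {p. ?s p \<in> P}" by (elim exE conjE)
  let ?g = "gs ! i"
  from x(2) have "x \<in> C" by simp
  from G[OF this] obtain x' where x': "x' \<in> G" "col x' = x" "\<And>z. z \<in> G \<Longrightarrow> col z = x \<Longrightarrow> z = x'" by blast
  let ?y = "colsum col x :: ('n, 'k) mpoly"
  define h where "h = lift (\<lambda>j. if j = x' then [:poly_var x' - ?y, 1:] else [:poly_var j:])"
  have hh: "rhom h" unfolding h_def by (rule rhom_lift)
  have h_simps: "h (Const c) = [:Const c:]" "h (poly_var j) = (if j = x' then [:poly_var x' - ?y, 1:] else [:poly_var j:])" for c j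
    by (simp_all add: h_def lift_simps)
  have hy: "h (colsum col c) = [:colsum col c:]" if "c \<noteq> x" for c
  proof -
    have "h (colsum col c) = (\<Sum>i | col i = c. [:poly_var i:])"
      unfolding colsum_def rhom_sum[OF hh] using that x'(2) by (intro sum.cong) (auto simp: h_simps)
    then show ?thesis by (simp add: colsum_def rhom_sum[OF rhom_const_poly])
  qed
  have hyx: "h ?y = [:0, 1:]"
  proof -
    define S where "S = (\<Sum>i\<in>{i. col i = x} - {x'}. poly_var i :: ('n, 'k) mpoly)"
    have e: "?y = poly_var x' + S"
      unfolding colsum_def S_def by (subst sum.remove[of _ x']) (use x'(2) in auto)
    have "h S = (\<Sum>i\<in>{i. col i = x} - {x'}. [:poly_var i:])"
      unfolding S_def rhom_sum[OF hh] by (intro sum.cong) (auto simp: h_simps)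
    then have hS: "h S = [:S:]" unfolding S_def rhom_sum[OF rhom_const_poly] .
    have "h ?y = h (poly_var x') + h S" unfolding e by (rule rhom_add[OF hh])
    also have "\<dots> = [:poly_var x' - ?y, 1:] + [:S:]" unfolding hS h_simps by simp
    also have "\<dots> = [:poly_var x' - ?y + S, 1:]" by simp
    also have "poly_var x' - ?y + S = 0" unfolding e by (simp add: algebra_simps)
    finally show ?thesis .
  qed
  have hs_eq: "h (?s p) = map_poly ?s (univar x p)" if "p \<in> polys_in (insert x V)" for p
  proof -
    have "h (?s (keep_vars (insert x V) p)) = map_poly ?s (univar x (keep_vars (insert x V) p))"
      by (rule rhom_eqI[OF rhom_comp[OF hh rhom_comp[OF hs rhom_keep_vars]] rhom_comp[OF rhom_map_poly[OF hs] rhom_comp[OF rhom_univar rhom_keep_vars]]])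
         (use x(1) in \<open>auto simp: keep_vars_simps subst_simps h_simps univar_simps hy hyx map_poly_rhom_pCons[OF hs]
              rhom_0[OF hs] rhom_1[OF hs] rhom_0[OF hh] rhom_0[OF rhom_univar]\<close>)
    then show ?thesis using that by (simp add: polys_in_def)
  qed
  have heval: "poly (h p) ?y = p" for p
  proof (rule rhom_eqI[where h = "\<lambda>p. poly (h p) ?y" and g = "\<lambda>p. p"])
    show "rhom (\<lambda>p. poly (h p) ?y)" by (rule rhom_comp[OF rhom_poly hh])
  qed (auto simp: rhom_def h_simps)
  define B where "B = set (take i (map ?s gs)) \<union> ?Q"
  have hB: "h b = [:b:]" if "b \<in> B" for b
  proof -
    from that consider g where "g \<in> set (take i gs)" "b = ?s g" | j where "j \<in> Y" "b = poly_var j ^ e j"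
      unfolding B_def by (auto simp: take_map)
    then show ?thesis
    proof cases
      case 1
      then have gv: "g \<in> polys_in V" using gV by blast
      then have "g \<in> polys_in (insert x V)" using polys_in_mono[of V "insert x V"] by blast
      then have "h b = map_poly ?s (univar x g)" using hs_eq 1 by simp
      also have "\<dots> = [:b:]" using univar_free[OF gv x(1)] 1 by (simp add: map_poly_rhom_pCons[OF hs])
      finally show ?thesis .
    next
      case 2
      then have "j \<noteq> x'" using Y x'(1) by blast
      then show ?thesis using 2 rhom_power[OF rhom_const_poly, of "poly_var j :: ('n, 'k) mpoly" "e j"]
        by (simp add: rhom_power[OF hh] h_simps)
    qed
  qed
  let ?F = "map_poly ?s (univar x ?g)" let ?u = "coeff ?F D"
  have F: "h (?s ?g) = ?F" by (rule hs_eq[OF g])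
  have u: "?u \<notin> P" using D(2) by (simp add: coeff_map_poly_rhom[OF hs])
  have "\<exists>K. \<forall>k. ?u ^ K * coeff (h a) k \<in> idl B"
  proof (rule lead_power_mult_coeff[OF ring_mod.subspace_span])
    fix k assume "D < k"
    then show "coeff ?F k = 0" using D(1) by (simp add: coeff_map_poly_rhom[OF hs] rhom_0[OF hs])
  next
    fix k
    have "?s ?g * a \<in> idl B" using a i' by (simp add: B_def)
    from hom_coeff_idl[OF hh hB this] have "coeff (h (?s ?g * a)) k \<in> idl B" by blast
    then show "coeff (?F * h a) k \<in> idl B" by (simp add: rhom_mult[OF hh] F)
  qed
  then obtain K where K: "\<And>k. ?u ^ K * coeff (h a) k \<in> idl B" by blast
  have "?u ^ K * a = ?u ^ K * poly (h a) ?y" by (simp add: heval)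
  also have "\<dots> = (\<Sum>k\<le>degree (h a). ?y ^ k * (?u ^ K * coeff (h a) k))"
    by (simp add: poly_altdef sum_distrib_left mult_ac)
  also have "\<dots> \<in> idl B" by (intro ring_mod.span_sum ring_mod.span_scale K)
  finally have "?u ^ K * a \<in> idl B" .
  moreover have "?u ^ K \<notin> P" by (rule is_prime_power_iff[OF P u])
  ultimately show "\<exists>s. s \<notin> P \<and> s * a \<in> idl (set (take i (map ?s gs)) \<union> ?Q)"
    unfolding B_def by blast
qed

section \<open>Algebraic independence modulo a prime\<close>

text \<open>
  Exponents are lists, since the number of elements to be tested for independence varies within the proofs.
  The exponents below \<open>K\<close> are enough to describe any one polynomial relation.
\<close>

definition box :: "nat \<Rightarrow> nat \<Rightarrow> nat list set" where
  "box K n = {es. set es \<subseteq> {..<K} \<and> length es = n}"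

lemma finite_box [simp]: "finite (box K n)"
  unfolding box_def by (rule finite_lists_length_eq) simp

lemma card_box: "card (box K n) = K ^ n"
  unfolding box_def by (subst card_lists_length_eq) simp_all

lemma box_0: "box K 0 = {[]}" by (auto simp: box_def)

lemma sum_box_Suc: "(\<Sum>es\<in>box K (Suc n). f es) = (\<Sum>e<K. \<Sum>es\<in>box K n. f (e # es))"
proof -
  have "box K (Suc n) = (\<lambda>(e, es). e # es) ` ({..<K} \<times> box K n)"
    by (auto simp: box_def length_Suc_conv)
  moreover have "inj_on (\<lambda>(e, es). e # es) ({..<K} \<times> box K n)" by (auto simp: inj_on_def)
  ultimately show ?thesis
    by (simp add: sum.reindex sum.cartesian_product case_prod_unfold)
qed

definition mono_val :: "'a::comm_ring_1 list \<Rightarrow> nat list \<Rightarrow> 'a" where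
  "mono_val zs es = prod_list (map2 (^) zs es)"

text \<open>
  The value at \<open>zs\<close> of the polynomial with coefficients \<open>c\<close>.
\<close>

definition rel_val :: "(nat list \<Rightarrow> 'k) \<Rightarrow> nat \<Rightarrow> ('n::finite, 'k::field) mpoly list \<Rightarrow> ('n, 'k) mpoly" where
  "rel_val c K zs = (\<Sum>es\<in>box K (length zs). Const (c es) * mono_val zs es)"

definition alg_indep :: "('n::finite, 'k::field) mpoly set \<Rightarrow> ('n, 'k) mpoly list \<Rightarrow> bool" where
  "alg_indep P zs \<longleftrightarrow> (\<forall>K c. (\<exists>es\<in>box K (length zs). c es \<noteq> 0) \<longrightarrow> rel_val c K zs \<notin> P)"

lemma rel_val_Cons: "rel_val c K (z # zs) = (\<Sum>e<K. z ^ e * rel_val (\<lambda>es. c (e # es)) K zs)"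
  by (simp add: rel_val_def sum_box_Suc mono_val_def sum_distrib_left mult_ac)

lemma alg_indep_subset: "alg_indep P zs \<Longrightarrow> Q \<subseteq> P \<Longrightarrow> alg_indep Q zs"
  unfolding alg_indep_def by blast

lemma Const_notin_prime:
  assumes "is_prime P" "a \<noteq> 0" shows "Const a \<notin> P"
proof
  assume "Const a \<in> P"
  then have "Const (inverse a) * Const a \<in> P" by (rule is_ideal_mult_left[OF is_prime_ideal[OF assms(1)]])
  then show False using assms by (simp add: rhom_mult[OF rhom_Const, symmetric] rhom_1[OF rhom_Const] is_prime_one)
qed

lemma alg_indep_Nil: "is_prime P \<Longrightarrow> alg_indep P []"
  by (auto simp: alg_indep_def rel_val_def box_0 mono_val_def Const_notin_prime)

lemma rel_val_zero: "(\<forall>es\<in>box K (length zs). c es = 0) \<Longrightarrow> rel_val c K zs = 0"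
  by (simp add: rel_val_def rhom_0[OF rhom_Const])

text \<open>
  In a relation modulo \<open>P\<close> collect powers of \<open>z\<close>, and cancel the lowest power, which is allowed as \<open>z \<notin> P\<close>.
  What remains is a relation \<open>q + z r \<in> P\<close> in which \<open>q\<close> does not involve \<open>z\<close>. Modulo \<open>P'\<close>, where \<open>z\<close> vanishes,
  \<open>q\<close> is a relation among \<open>zs\<close>.
\<close>

lemma alg_indep_Cons:
  assumes P: "is_prime P" and P': "is_ideal P'" and PP': "P \<subseteq> P'"
    and z: "z \<in> P'" "z \<notin> P" and zs: "alg_indep P' zs"
  shows "alg_indep P (z # zs)"
  unfolding alg_indep_def
proof (intro allI impI notI)
  fix K c assume "\<exists>es\<in>box K (length (z # zs)). c es \<noteq> 0" and r: "rel_val c K (z # zs) \<in> P"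
  let ?q = "\<lambda>e. rel_val (\<lambda>es. c (e # es)) K zs"
  let ?A = "\<lambda>e. e < K \<and> (\<exists>es\<in>box K (length zs). c (e # es) \<noteq> 0)"
  from \<open>\<exists>es\<in>_. _\<close> obtain l where "l \<in> box K (Suc (length zs))" "c l \<noteq> 0" by auto
  then have "\<exists>e. ?A e" by (cases l) (auto simp: box_def)
  then obtain e0 where e0: "?A e0" "\<And>e. e < e0 \<Longrightarrow> \<not> ?A e" using exists_least_iff[of ?A] by blast
  have q0: "?q e = 0" if "e < e0" for e
    using e0(2)[OF that] that e0(1) by (intro rel_val_zero) auto
  have "rel_val c K (z # zs) = (\<Sum>e<e0. z ^ e * ?q e) + z ^ e0 * ?q e0 + (\<Sum>e\<in>{e0<..<K}. z ^ e * ?q e)"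
  proof -
    have "(\<Sum>e<K. z ^ e * ?q e) = (\<Sum>e<e0. z ^ e * ?q e) + (\<Sum>e=e0..<K. z ^ e * ?q e)"
      unfolding lessThan_atLeast0 using e0(1) by (intro sum.atLeastLessThan_concat[symmetric]) auto
    also have "(\<Sum>e=e0..<K. z ^ e * ?q e) = z ^ e0 * ?q e0 + (\<Sum>e\<in>{Suc e0..<K}. z ^ e * ?q e)"
      using e0(1) by (intro sum.atLeast_Suc_lessThan) auto
    finally show ?thesis unfolding rel_val_Cons atLeastSucLessThan_greaterThanLessThan by (simp only: add.assoc)
  qed
  also have "(\<Sum>e<e0. z ^ e * ?q e) = 0" by (rule sum.neutral) (simp add: q0)
  also have "(\<Sum>e\<in>{e0<..<K}. z ^ e * ?q e) = z ^ e0 * (z * (\<Sum>e\<in>{e0<..<K}. z ^ (e - e0 - 1) * ?q e))"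
    unfolding sum_distrib_left
  proof (rule sum.cong[OF refl])
    fix e assume "e \<in> {e0<..<K}"
    then have "e = e0 + Suc (e - e0 - 1)" by simp
    then have "z ^ e = z ^ (e0 + Suc (e - e0 - 1))" by (rule arg_cong)
    then show "z ^ e * ?q e = z ^ e0 * (z * (z ^ (e - e0 - 1) * ?q e))" by (simp only: power_add power_Suc mult.assoc)
  qed
  finally have "rel_val c K (z # zs) = z ^ e0 * (?q e0 + z * (\<Sum>e\<in>{e0<..<K}. z ^ (e - e0 - 1) * ?q e))" (is "_ = _ * (_ + z * ?r)")
    by (simp add: distrib_left)
  then have "?q e0 + z * ?r \<in> P"
    using r is_prime_mult[OF P, of "z ^ e0"] is_prime_power_iff[OF P z(2), of e0] by simp
  then have "?q e0 + z * ?r - z * ?r \<in> P'"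
    by (intro ring_mod.subspace_diff[OF P'] subsetD[OF PP'] is_ideal_mult_right[OF P' z(1)])
  then have "?q e0 \<in> P'" by simp
  moreover have "?q e0 \<notin> P'" by (rule zs[unfolded alg_indep_def, rule_format, OF conjunct2[OF e0(1)]])
  ultimately show False by (rule notE[rotated])
qed

lemma alg_indep_prime_chain:
  assumes "\<forall>i\<le>r. is_prime (Q i)" "\<forall>i<r. Q i \<subset> Q (Suc i)" "alg_indep (Q r) ys"
  shows "\<exists>zs. length zs = r \<and> alg_indep (Q 0) (zs @ ys)"
  using assms
proof (induction r arbitrary: Q)
  case 0
  then show ?case by simp
next
  case (Suc r)
  have "\<exists>zs. length zs = r \<and> alg_indep (Q (Suc 0)) (zs @ ys)"
    using Suc.prems by (intro Suc.IH[of "\<lambda>i. Q (Suc i)"]) auto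
  then obtain zs where zs: "length zs = r" "alg_indep (Q (Suc 0)) (zs @ ys)" by blast
  have Q01: "Q 0 \<subset> Q (Suc 0)" and pr: "is_prime (Q 0)" "is_prime (Q (Suc 0))" using Suc.prems by auto
  then obtain z where z: "z \<in> Q (Suc 0)" "z \<notin> Q 0" by blast
  have "alg_indep (Q 0) (z # zs @ ys)"
    using Q01 by (intro alg_indep_Cons[OF pr(1) is_prime_ideal[OF pr(2)] _ z zs(2)]) blast
  then show ?case using zs(1) by (intro exI[of _ "z # zs"]) simp
qed

lemma rel_val_map:
  assumes h: "rhom h" "\<And>a. h (Const a) = Const a"
  shows "rel_val c K (map h zs) = h (rel_val c K zs)"
proof -
  have "mono_val (map h zs) es = h (mono_val zs es)" for es
    unfolding mono_val_def
    by (induction zs es rule: list_induct2') (simp_all add: rhom_1[OF h(1)] rhom_mult[OF h(1)] rhom_power[OF h(1)])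
  then show ?thesis by (simp add: rel_val_def rhom_sum[OF h(1)] rhom_mult[OF h(1)] h(2))
qed

lemma alg_indep_map:
  assumes h: "rhom h" "\<And>a. h (Const a) = Const a" and "alg_indep {p. h p \<in> P} zs"
  shows "alg_indep P (map h zs)"
  using assms(3) by (simp add: alg_indep_def rel_val_map[OF h])

lemma rel_val_polys:
  assumes "set zs \<subseteq> polys_in V" shows "rel_val c K zs \<in> polys_in V"
proof -
  have one: "1 \<in> polys_in V" by (simp add: polys_in_def rhom_1[OF rhom_keep_vars])
  have "mono_val zs es \<in> polys_in V" for es
    using assms unfolding mono_val_def
    by (induction zs es rule: list_induct2') (auto simp: one intro!: polys_in_closed(4,5))
  then show ?thesis unfolding rel_val_def by (intro polys_in_closed(2,4,6))
qed

text \<open>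
  A relation between \<open>x\<close> and polynomials free of \<open>x\<close> is a polynomial in \<open>x\<close>; its coefficients are relations
  among the latter.
\<close>

lemma alg_indep_var_Cons:
  assumes zs: "alg_indep N zs" "set zs \<subseteq> polys_in V" and x: "x \<notin> V"
    and ext: "\<And>g k. g \<in> N \<Longrightarrow> g \<in> polys_in (insert x V) \<Longrightarrow> coeff (univar x g) k \<in> N"
  shows "alg_indep N (poly_var x # zs)"
  unfolding alg_indep_def
proof (intro allI impI notI)
  fix K c assume "\<exists>es\<in>box K (length (poly_var x # zs)). c es \<noteq> 0" and r: "rel_val c K (poly_var x # zs) \<in> N"
  let ?q = "\<lambda>e. rel_val (\<lambda>es. c (e # es)) K zs"
  from \<open>\<exists>es\<in>_. _\<close> obtain l where "l \<in> box K (Suc (length zs))" "c l \<noteq> 0" by auto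
  then obtain e es where e: "e < K" "es \<in> box K (length zs)" "c (e # es) \<noteq> 0" by (cases l) (auto simp: box_def)
  define F where "F = (\<Sum>e<K. monom (?q e) e)"
  have F: "coeff F k = (if k < K then ?q k else 0)" for k by (simp add: F_def coeff_sum)
  have Fp: "coeff F k \<in> polys_in V" for k
    using rel_val_polys[OF zs(2)] by (simp add: F polys_in_def rhom_0[OF rhom_keep_vars])
  have ev: "poly F (poly_var x) = rel_val c K (poly_var x # zs)"
    by (simp add: F_def poly_sum poly_monom rel_val_Cons mult.commute)
  have "coeff (univar x (poly F (poly_var x))) e \<in> N"
    by (rule ext[OF r[folded ev] poly_var_poly_polys_in[OF Fp]])
  then have "?q e \<in> N" using e(1) unfolding univar_poly[OF Fp x] by (simp add: F)
  moreover have "?q e \<notin> N" by (rule zs(1)[unfolded alg_indep_def, rule_format], rule bexI[OF _ e(2)], rule e(3))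
  ultimately show False by (rule notE[rotated])
qed

interpretation mvs: vector_space "\<lambda>a (p :: ('n::finite, 'k::field) mpoly). Const a * p"
  by unfold_locales
    (simp_all add: distrib_left distrib_right rhom_add[OF rhom_Const] rhom_mult[OF rhom_Const] rhom_1[OF rhom_Const] mult_ac)

text \<open>
  Stated for families, because different monomials in the given elements may have equal values.
\<close>

lemma (in vector_space) family_dependent:
  assumes A: "finite A" and T: "finite T" "card T < card A" and f: "f ` A \<subseteq> span T"
  shows "\<exists>c. (\<exists>a\<in>A. c a \<noteq> 0) \<and> (\<Sum>a\<in>A. scale (c a) (f a)) = 0"
proof (cases "inj_on f A")
  case True
  have "dependent (f ` A)"
  proof (rule ccontr)
    assume "independent (f ` A)"
    from independent_span_bound[OF T(1) this f] have "card (f ` A) \<le> card T" by simp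
    then show False using T(2) card_image[OF True] by simp
  qed
  then obtain u where u: "\<exists>v\<in>f ` A. u v \<noteq> 0" "(\<Sum>v\<in>f ` A. scale (u v) v) = 0"
    using dependent_finite[of "f ` A"] A by auto
  then show ?thesis using sum.reindex[OF True, of "\<lambda>v. scale (u v) v"] by (intro exI[of _ "u \<circ> f"]) auto
next
  case False
  then obtain a b where ab: "a \<in> A" "b \<in> A" "a \<noteq> b" "f a = f b" by (auto simp: inj_on_def)
  let ?c = "\<lambda>x. if x = a then 1 else if x = b then - 1 else 0"
  have "(\<Sum>x\<in>A. scale (?c x) (f x)) = (\<Sum>x\<in>{a, b}. scale (?c x) (f x))"
    using A ab by (intro sum.mono_neutral_right) auto
  also have "\<dots> = 0" using ab by simp
  finally show ?thesis using ab by (intro exI[of _ ?c]) auto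
qed

section \<open>The number of independent elements\<close>

definition bounded_polys :: "'n set \<Rightarrow> nat \<Rightarrow> ('n::finite, 'k::field) mpoly set" where
  "bounded_polys F B = {p. \<forall>m\<in>keys p. keys m \<subseteq> F \<and> (\<forall>i. lookup m i \<le> B)}"

lemma bounded_polys_mono: "p \<in> bounded_polys F A \<Longrightarrow> A \<le> B \<Longrightarrow> p \<in> bounded_polys F B"
  by (auto simp: bounded_polys_def intro: order_trans)

lemma bounded_polys_1: "1 \<in> bounded_polys F B"
  by (simp add: bounded_polys_def)

lemma bounded_polys_add: "p \<in> bounded_polys F A \<Longrightarrow> q \<in> bounded_polys F A \<Longrightarrow> p + q \<in> bounded_polys F A"
  using keys_add[of p q] unfolding bounded_polys_def by blast

lemma bounded_polys_mult:
  assumes p: "p \<in> bounded_polys F A" and q: "q \<in> bounded_polys F B"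
  shows "p * q \<in> bounded_polys F (A + B)"
  unfolding bounded_polys_def
proof (intro CollectI ballI)
  fix m assume "m \<in> keys (p * q)"
  then obtain a b where ab: "m = a + b" "a \<in> keys p" "b \<in> keys q" using keys_mult[of p q] by blast
  then have "keys a \<subseteq> F" "keys b \<subseteq> F" "\<And>i. lookup a i \<le> A" "\<And>i. lookup b i \<le> B"
    using p q unfolding bounded_polys_def by blast+
  then show "keys m \<subseteq> F \<and> (\<forall>i. lookup m i \<le> A + B)"
    using keys_add[of a b] ab(1) by (auto simp: lookup_add add_mono)
qed

lemma bounded_polys_power: "p \<in> bounded_polys F A \<Longrightarrow> p ^ n \<in> bounded_polys F (n * A)"
  by (induction n) (auto simp: bounded_polys_1 bounded_polys_mult)

lemma keep_vars_bounded: "\<exists>D. keep_vars F p \<in> bounded_polys F D"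
proof (induction p rule: mpoly_induct)
  case (Const a)
  show ?case unfolding keep_vars_simps by (intro exI[of _ 0]) (simp add: bounded_polys_def Const_def)
next
  case (var i)
  show ?case
    unfolding keep_vars_simps
    by (intro exI[of _ 1]) (auto simp: bounded_polys_def poly_var_def lookup_single when_def)
next
  case (add p q)
  then obtain A B where "keep_vars F p \<in> bounded_polys F A" "keep_vars F q \<in> bounded_polys F B" by blast
  then have "keep_vars F p + keep_vars F q \<in> bounded_polys F (max A B)"
    by (intro bounded_polys_add) (auto intro: bounded_polys_mono)
  then show ?case by (auto simp: rhom_add[OF rhom_keep_vars])
next
  case (mult p q)
  then show ?case unfolding rhom_mult[OF rhom_keep_vars] using bounded_polys_mult by blast
qed

lemma mono_val_bounded:
  assumes "set zs \<subseteq> bounded_polys F D" "es \<in> box K (length zs)"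
  shows "mono_val zs es \<in> bounded_polys F (length zs * D * K)"
  using assms
proof (induction zs arbitrary: es)
  case Nil
  then show ?case by (simp add: box_0 mono_val_def bounded_polys_1)
next
  case (Cons z zs)
  then obtain e es' where es: "es = e # es'" "e < K" "es' \<in> box K (length zs)"
    by (cases es) (auto simp: box_def)
  have "z ^ e \<in> bounded_polys F (D * K)"
    by (rule bounded_polys_mono[OF bounded_polys_power[of _ _ D]]) (use Cons.prems es in auto)
  moreover have "mono_val zs es' \<in> bounded_polys F (length zs * D * K)"
    using Cons es by auto
  ultimately have "z ^ e * mono_val zs es' \<in> bounded_polys F (D * K + length zs * D * K)"
    by (rule bounded_polys_mult)
  then show ?case by (simp add: es(1) mono_val_def algebra_simps)
qed

lemma bounded_polys_span:
  "\<exists>T :: ('n::finite, 'k::field) mpoly set. finite T \<and> card T \<le> (B + 1) ^ card F \<and> bounded_polys F B \<subseteq> mvs.span T"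
proof -
  define E where "E = PiE F (\<lambda>_. {..B})"
  define t where "t f = Poly_Mapping.single (\<Sum>i\<in>F. Poly_Mapping.single i (f i)) (1 :: 'k)" for f :: "'n \<Rightarrow> nat"
  have fE: "finite E" unfolding E_def by (rule finite_PiE) auto
  have "card E = (B + 1) ^ card F" unfolding E_def by (subst card_PiE) auto
  then have c: "card (t ` E) \<le> (B + 1) ^ card F" using card_image_le[OF fE, of t] by simp
  have "p \<in> mvs.span (t ` E)" if p: "p \<in> bounded_polys F B" for p :: "('n, 'k) mpoly"
  proof -
    have "Const (lookup p m) * Poly_Mapping.single m 1 \<in> mvs.span (t ` E)" if m: "m \<in> keys p" for m
    proof (rule mvs.span_scale, rule mvs.span_base)
      have mF: "keys m \<subseteq> F" "\<And>i. lookup m i \<le> B" using p m unfolding bounded_polys_def by auto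
      let ?f = "restrict (lookup m) F"
      have "(\<Sum>i\<in>F. Poly_Mapping.single i (?f i)) = m"
      proof (rule poly_mapping_eqI)
        fix j
        have "lookup (\<Sum>i\<in>F. Poly_Mapping.single i (?f i)) j = (\<Sum>i\<in>F. if i = j then lookup m j else 0)"
          unfolding lookup_sum by (intro sum.cong) (auto simp: lookup_single when_def)
        also have "\<dots> = lookup m j" using mF(1) by (auto simp: sum.delta in_keys_iff)
        finally show "lookup (\<Sum>i\<in>F. Poly_Mapping.single i (?f i)) j = lookup m j" .
      qed
      then have "Poly_Mapping.single m 1 = t ?f" by (simp add: t_def)
      moreover have "?f \<in> E" using mF(2) by (auto simp: E_def)
      ultimately show "Poly_Mapping.single m 1 \<in> t ` E" by blast
    qed
    then have "(\<Sum>m\<in>keys p. Const (lookup p m) * Poly_Mapping.single m 1) \<in> mvs.span (t ` E)"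
      by (intro mvs.span_sum)
    also have "(\<Sum>m\<in>keys p. Const (lookup p m) * Poly_Mapping.single m 1) = p"
      using poly_mapping_sum_single[of p] by (simp add: Const_def mult_single)
    finally show ?thesis .
  qed
  then show ?thesis using c fE by (intro exI[of _ "t ` E"]) auto
qed

lemma minus_keep_vars_in_ideal:
  assumes P: "is_ideal P" and v: "\<And>i. i \<notin> F \<Longrightarrow> poly_var i \<in> P"
  shows "p - keep_vars F p \<in> P"
proof (induction p rule: mpoly_induct)
  case (Const a)
  show ?case by (simp add: keep_vars_simps ring_mod.subspace_0[OF P])
next
  case (var i)
  show ?case using v by (auto simp: keep_vars_simps ring_mod.subspace_0[OF P])
next
  case (add p q)
  then have "(p - keep_vars F p) + (q - keep_vars F q) \<in> P" by (rule ring_mod.subspace_add[OF P])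
  then show ?case by (simp add: rhom_add[OF rhom_keep_vars] algebra_simps)
next
  case (mult p q)
  have "q * (p - keep_vars F p) + keep_vars F p * (q - keep_vars F q) \<in> P"
    using mult by (intro ring_mod.subspace_add[OF P] is_ideal_mult_left[OF P])
  then show ?case by (simp add: rhom_mult[OF rhom_keep_vars] algebra_simps)
qed

text \<open>
  Modulo \<open>P\<close> only the variables in \<open>F\<close> survive. Monomials in \<open>zs\<close> with exponents below \<open>K\<close> number
  \<open>K ^ length zs\<close>, while their values lie in a space whose dimension is at most a constant multiple of
  \<open>K ^ card F\<close>. For large \<open>K\<close> this forces a relation if \<open>length zs > card F\<close>.
\<close>

lemma alg_indep_length_le:
  fixes P :: "('n::finite, 'k::field) mpoly set"
  assumes P: "is_ideal P" and v: "\<And>i. i \<notin> F \<Longrightarrow> poly_var i \<in> P" and zs: "alg_indep P zs"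
  shows "length zs \<le> card F"
proof (rule ccontr)
  assume "\<not> length zs \<le> card F"
  then have len: "Suc (card F) \<le> length zs" by simp
  let ?zs = "map (keep_vars F) zs"
  obtain d where d: "\<And>z :: ('n, 'k) mpoly. keep_vars F z \<in> bounded_polys F (d z)" using keep_vars_bounded by metis
  define D where "D = sum_list (map d zs)"
  have "keep_vars F z \<in> bounded_polys F D" if "z \<in> set zs" for z
    using bounded_polys_mono[OF d] member_le_sum_list[of "d z" "map d zs"] that by (simp add: D_def)
  then have zD: "set ?zs \<subseteq> bounded_polys F D" by auto
  define L where "L = length ?zs * D"
  \<comment> \<open>Values of monomials have exponents at most \<open>L * K\<close>, and \<open>(L * K + 1) ^ card F < K ^ (card F + 1)\<close>.\<close>
  define K where "K = (L + 1) ^ card F + 1"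
  obtain T :: "('n, 'k) mpoly set" where T: "finite T" "card T \<le> (L * K + 1) ^ card F" "bounded_polys F (L * K) \<subseteq> mvs.span T"
    using bounded_polys_span[of "L * K" F] by blast
  have "L * K + 1 \<le> (L + 1) * K" by (simp add: K_def)
  then have "(L * K + 1) ^ card F \<le> ((L + 1) * K) ^ card F" by (rule power_mono) simp
  also have "\<dots> = (L + 1) ^ card F * K ^ card F" by (rule power_mult_distrib)
  also have "\<dots> < K * K ^ card F" by (simp add: K_def)
  also have "\<dots> \<le> K ^ length zs" using power_increasing[OF len, of K] by (simp add: K_def)
  finally have cT: "card T < card (box K (length zs))" using T(2) by (simp add: card_box)
  have "mono_val ?zs ` box K (length zs) \<subseteq> mvs.span T"
    using mono_val_bounded[OF zD] T(3) by (auto simp: L_def)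
  from mvs.family_dependent[OF finite_box T(1) cT this]
  obtain c where c: "\<exists>es\<in>box K (length zs). c es \<noteq> 0" "rel_val c K ?zs = 0"
    by (auto simp: rel_val_def)
  have "rel_val c K ?zs = keep_vars F (rel_val c K zs)"
    by (rule rel_val_map[OF rhom_keep_vars]) (simp add: keep_vars_simps)
  then have "rel_val c K zs \<in> P" using minus_keep_vars_in_ideal[OF P v, where F=F and p = "rel_val c K zs"] c(2) by simp
  then show False using zs c(1) unfolding alg_indep_def by blast
qed

section \<open>Elements of a prime of a polynomial ring\<close>

lemma triangular_mono: "triangular C N gs \<Longrightarrow> C \<subseteq> C' \<Longrightarrow> triangular C' N gs"
  unfolding triangular_def by (meson subset_trans)

text \<open>
  Terms of \<open>g\<close> above the last coefficient outside \<open>N\<close> belong to \<open>N\<close> and may be dropped.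
\<close>

lemma nonextended_element:
  assumes N: "is_ideal N" and x: "x \<notin> V" and g: "g \<in> N" "g \<in> polys_in (insert x V)" "coeff (univar x g) k \<notin> N"
  shows "\<exists>g' D. g' \<in> N \<and> g' \<in> polys_in (insert x V) \<and> (\<forall>k>D. coeff (univar x g') k = 0) \<and> coeff (univar x g') D \<notin> N"
proof -
  let ?F = "univar x g"
  define D where "D = Max {k. coeff ?F k \<notin> N}"
  have z: "0 \<in> N" by (rule ring_mod.subspace_0[OF N])
  have "{k. coeff ?F k \<notin> N} \<subseteq> {..Polynomial.degree ?F}"
    using z by (auto simp: le_degree) (metis coeff_eq_0 not_le)
  then have fin: "finite {k. coeff ?F k \<notin> N}" by (rule finite_subset) simp
  have D: "coeff ?F D \<notin> N" using Max_in[OF fin] g(3) unfolding D_def by blast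
  have D': "coeff ?F k \<in> N" if "k > D" for k
    using Max_ge[OF fin, of k] that unfolding D_def by fastforce
  let ?H = "poly_cutoff (Suc D) ?F"
  define g' where "g' = poly ?H (poly_var x)"
  have Hc: "coeff ?H k \<in> polys_in V" for k
    using univar_coeff[OF g(2) x] by (simp add: coeff_poly_cutoff polys_in_def rhom_0[OF rhom_keep_vars])
  have ug: "univar x g' = ?H" unfolding g'_def by (rule univar_poly[OF Hc x])
  have "g - g' = poly (?F - ?H) (poly_var x)" by (simp add: g'_def univar_eval)
  also have "\<dots> \<in> N"
    unfolding poly_altdef
  proof (rule ring_mod.subspace_sum[OF N], rule is_ideal_mult_right[OF N])
    show "coeff (?F - ?H) k \<in> N" for k using D' z by (simp add: coeff_poly_cutoff)
  qed
  finally have "g - (g - g') \<in> N" by (rule ring_mod.subspace_diff[OF N g(1)])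
  then have "g' \<in> N" by simp
  moreover have "g' \<in> polys_in (insert x V)" unfolding g'_def by (rule poly_var_poly_polys_in[OF Hc])
  moreover have "\<forall>k>D. coeff (univar x g') k = 0" "coeff (univar x g') D \<notin> N"
    using D by (simp_all add: ug coeff_poly_cutoff)
  ultimately show ?thesis by blast
qed

text \<open>
  Adding one variable \<open>x\<close> to those in \<open>cs\<close>: if the part of \<open>N\<close> in the larger ring is merely extended from
  the smaller ring, that is, if all coefficients of its members belong to \<open>N\<close>, then \<open>x\<close> is independent of
  what was found before. Otherwise some member has a leading coefficient outside \<open>N\<close>. So each variable
  contributes to one of the two lists. If \<open>cs\<close> lists all variables, the lengths of the two lists are the height
  of \<open>N\<close> and the transcendence degree of its residue field.
\<close>

lemma triangular_indep_split:
  assumes N: "is_prime N" and cs: "distinct cs"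
  shows "\<exists>gs zs. length gs + length zs = length cs \<and> set gs \<subseteq> N \<inter> polys_in (set cs) \<and>
     set zs \<subseteq> polys_in (set cs) \<and> alg_indep N zs \<and> triangular (set cs) N gs"
  using cs
proof (induction cs rule: rev_induct)
  case Nil
  show ?case by (intro exI[of _ "[]"]) (simp add: alg_indep_Nil[OF N] triangular_def)
next
  case (snoc x cs)
  let ?V = "set cs"
  from snoc obtain gs zs where 1: "length gs + length zs = length cs" "set gs \<subseteq> N \<inter> polys_in ?V"
     "set zs \<subseteq> polys_in ?V" "alg_indep N zs" "triangular ?V N gs" by auto
  have x: "x \<notin> ?V" using snoc.prems by simp
  have V': "set (cs @ [x]) = insert x ?V" by simp
  have sub: "polys_in ?V \<subseteq> polys_in (insert x ?V)" by (rule polys_in_mono) blast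
  show ?case
  proof (cases "\<forall>g k. g \<in> N \<longrightarrow> g \<in> polys_in (insert x ?V) \<longrightarrow> coeff (univar x g) k \<in> N")
    case True
    then have "alg_indep N (poly_var x # zs)" by (intro alg_indep_var_Cons[OF 1(4,3) x]) blast
    moreover have "poly_var x \<in> polys_in (insert x ?V)" by (rule polys_in_closed) simp
    moreover have "triangular (insert x ?V) N gs" by (rule triangular_mono[OF 1(5)]) blast
    ultimately show ?thesis unfolding V'
      using 1 sub by (intro exI[of _ gs] exI[of _ "poly_var x # zs"]) auto
  next
    case False
    then obtain g k where "g \<in> N" "g \<in> polys_in (insert x ?V)" "coeff (univar x g) k \<notin> N" by blast
    from nonextended_element[OF is_prime_ideal[OF N] x this]
    obtain g' D where g': "g' \<in> N" "g' \<in> polys_in (insert x ?V)" "\<forall>k>D. coeff (univar x g') k = 0" "coeff (univar x g') D \<notin> N"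
      by (elim exE conjE)
    have "triangular (insert x ?V) N (gs @ [g'])"
      unfolding triangular_def
    proof (intro allI impI)
      fix i assume "i < length (gs @ [g'])"
      then consider "i < length gs" | "i = length gs" by fastforce
      then show "\<exists>x' W D. x' \<notin> W \<and> insert x' W \<subseteq> insert x ?V \<and> set (take i (gs @ [g'])) \<subseteq> polys_in W \<and>
        (gs @ [g']) ! i \<in> polys_in (insert x' W) \<and> (\<forall>k>D. coeff (univar x' ((gs @ [g']) ! i)) k = 0) \<and>
        coeff (univar x' ((gs @ [g']) ! i)) D \<notin> N"
      proof cases
        case 1
        then show ?thesis
          using triangular_mono[OF \<open>triangular ?V N gs\<close>, of "insert x ?V"] unfolding triangular_def
          by (auto simp: nth_append)
      next
        case 2
        then show ?thesis using g' x \<open>set gs \<subseteq> N \<inter> polys_in ?V\<close>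
          by (intro exI[of _ x] exI[of _ ?V] exI[of _ D]) auto
      qed
    qed
    then show ?thesis unfolding V'
      using 1 sub g' by (intro exI[of _ "gs @ [g']"] exI[of _ zs]) auto
  qed
qed

lemma is_prime_vimage:
  assumes P: "is_prime P" and h: "rhom h" shows "is_prime {p. h p \<in> P}"
  unfolding is_prime_def
proof (intro conjI allI impI)
  show "is_ideal {p. h p \<in> P}"
    using is_prime_ideal[OF P]
    by (intro ring_mod.subspaceI) (simp_all add: rhom_0[OF h] rhom_add[OF h] rhom_mult[OF h]
        ring_mod.subspace_0 ring_mod.subspace_add is_ideal_mult_left)
  show "1 \<notin> {p. h p \<in> P}" using is_prime_one[OF P] by (simp add: rhom_1[OF h])
  show "a \<in> {p. h p \<in> P} \<or> b \<in> {p. h p \<in> P}" if "a * b \<in> {p. h p \<in> P}" for a b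
    using that is_prime_mult[OF P] by (simp add: rhom_mult[OF h])
qed

section \<open>Gluing along an order of the facets\<close>

definition pow_gens :: "'n set \<Rightarrow> ('n \<Rightarrow> nat) \<Rightarrow> ('n::finite, 'k::field) mpoly set" where
  "pow_gens Y e = {poly_var i ^ e i | i. i \<in> Y}"

lemma pow_gens_I: "i \<in> Y \<Longrightarrow> poly_var i ^ e i \<in> pow_gens Y e"
  by (auto simp: pow_gens_def)

lemma pow_gens_insert: "pow_gens (insert i Y) e = insert (poly_var i ^ e i) (pow_gens Y e)"
  by (auto simp: pow_gens_def)

lemma pow_gens_cong: "(\<And>i. i \<in> Y \<Longrightarrow> e i = e' i) \<Longrightarrow> pow_gens Y e = pow_gens Y e'"
  by (auto simp: pow_gens_def) metis+

lemma power_in_ideal_mono: "is_ideal J \<Longrightarrow> x ^ m \<in> J \<Longrightarrow> m \<le> n \<Longrightarrow> x ^ n \<in> J"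
  by (metis is_ideal_mult_left le_add_diff_inverse2 power_add)

text \<open>
  The generators are free of \<open>w\<close>, so multiplying by a power of \<open>w\<close> only shifts coefficients.
\<close>

lemma pow_gens_colon_free:
  assumes w: "w \<notin> Y" and g: "g * poly_var w ^ k \<in> idl (pow_gens Y e)"
  shows "g \<in> idl (pow_gens Y e)"
proof -
  have free: "univar w b = [:b:]" if "b \<in> pow_gens Y e" for b
  proof -
    from that obtain i where i: "i \<in> Y" "b = poly_var i ^ e i" by (auto simp: pow_gens_def)
    have "b \<in> polys_in Y" unfolding i(2) by (intro polys_in_closed i(1))
    then show ?thesis by (rule univar_free) (rule w)
  qed
  have c: "coeff (univar w g) n \<in> idl (pow_gens Y e)" for n
  proof -
    have "univar w (g * poly_var w ^ k) = monom 1 k * univar w g"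
      by (simp add: rhom_mult[OF rhom_univar] rhom_power[OF rhom_univar] univar_simps monom_altdef)
    then have "coeff (univar w (g * poly_var w ^ k)) (n + k) = coeff (univar w g) n"
      by (simp add: coeff_monom_mult)
    then show ?thesis using hom_coeff_idl[OF rhom_univar free g, of "n + k"] by simp
  qed
  have "poly (univar w g) (poly_var w) \<in> idl (pow_gens Y e)"
    unfolding poly_altdef
    by (intro ring_mod.span_sum is_ideal_mult_right[OF ring_mod.subspace_span] c)
  then show ?thesis by (simp add: univar_eval)
qed

lemma pow_gens_colon:
  fixes g :: "('n::finite, 'k::field) mpoly"
  assumes i: "i \<in> Y" and k: "k \<le> e i" and g: "g * poly_var i ^ k \<in> idl (pow_gens Y e)"
  shows "g \<in> idl (pow_gens Y (e(i := e i - k)))"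
proof -
  have Y: "insert i (Y - {i}) = Y" using i by blast
  let ?pg = "pow_gens :: _ \<Rightarrow> _ \<Rightarrow> ('n, 'k) mpoly set"
  have eq: "?pg Y e = insert (poly_var i ^ e i) (?pg (Y - {i}) e)"
    using pow_gens_insert[of i "Y - {i}" e] unfolding Y .
  have "?pg Y (e(i := e i - k)) = insert (poly_var i ^ (e i - k)) (?pg (Y - {i}) (e(i := e i - k)))"
    using pow_gens_insert[of i "Y - {i}" "e(i := e i - k)"] unfolding Y by simp
  also have "?pg (Y - {i}) (e(i := e i - k)) = ?pg (Y - {i}) e" by (rule pow_gens_cong) simp
  finally have eq': "?pg Y (e(i := e i - k)) = insert (poly_var i ^ (e i - k)) (?pg (Y - {i}) e)" .
  obtain r where "g * poly_var i ^ k - r * poly_var i ^ e i \<in> idl (pow_gens (Y - {i}) e)"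
    using g unfolding eq idl_insert_iff by blast
  also have "g * poly_var i ^ k - r * poly_var i ^ e i = (g - r * poly_var i ^ (e i - k)) * poly_var i ^ k"
    using k by (simp add: left_diff_distrib mult.assoc power_add[symmetric])
  finally have "g - r * poly_var i ^ (e i - k) \<in> idl (pow_gens (Y - {i}) e)"
    by (rule pow_gens_colon_free[rotated]) simp
  then show ?thesis unfolding eq' idl_insert_iff by blast
qed

lemma pow_gens_colon_conv:
  assumes i: "i \<in> Y" and k: "k \<le> e i" and g: "g \<in> idl (pow_gens Y (e(i := e i - k)))"
  shows "g * poly_var i ^ k \<in> idl (pow_gens Y e)"
proof -
  have "is_ideal {g. g * poly_var i ^ k \<in> idl (pow_gens Y e)}"
    by (rule ring_mod.subspaceI) (simp_all add: ring_mod.span_zero distrib_right ring_mod.span_add mult.assoc ring_mod.span_scale)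
  moreover have "pow_gens Y (e(i := e i - k)) \<subseteq> {g. g * poly_var i ^ k \<in> idl (pow_gens Y e)}"
  proof
    fix b assume "b \<in> pow_gens Y (e(i := e i - k))"
    then obtain j where j: "j \<in> Y" "b = poly_var j ^ (e(i := e i - k)) j" by (auto simp: pow_gens_def)
    have "poly_var j ^ e j \<in> idl (pow_gens Y e)" by (rule ring_mod.span_base[OF pow_gens_I[OF j(1)]])
    then show "b \<in> {g. g * poly_var i ^ k \<in> idl (pow_gens Y e)}"
      using j(2) k is_ideal_mult_right[OF ring_mod.subspace_span, of "poly_var j ^ e j" _ "poly_var i ^ k"]
      by (cases "j = i") (simp_all add: power_add[symmetric])
  qed
  ultimately show ?thesis using g ring_mod.span_minimal by blast
qed

lemma idl_modular:
  assumes I': "is_ideal I'" and Q: "is_ideal Q" and A: "A \<subseteq> I'"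
  shows "idl (I' \<inter> Q \<union> A) = I' \<inter> idl (Q \<union> A)"
proof
  show "idl (I' \<inter> Q \<union> A) \<subseteq> I' \<inter> idl (Q \<union> A)"
    using A ring_mod.span_superset[of "Q \<union> A"]
    by (intro ring_mod.span_minimal ring_mod.subspace_inter I' ring_mod.subspace_span) blast
  show "I' \<inter> idl (Q \<union> A) \<subseteq> idl (I' \<inter> Q \<union> A)"
  proof
    fix x assume "x \<in> I' \<inter> idl (Q \<union> A)"
    then obtain q s where x: "x \<in> I'" "q \<in> Q" "s \<in> idl A" "x = q + s"
      by (auto simp: idl_Un_iff idl_eq[OF Q])
    have "s \<in> I'" using x(3) A I' idl_subset_iff by blast
    then have "x - s \<in> I'" using x(1) by (intro ring_mod.subspace_diff[OF I'])
    then have "q \<in> I' \<inter> Q" using x by simp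
    then have "q \<in> idl (I' \<inter> Q)" by (rule ring_mod.span_base)
    then show "x \<in> idl (I' \<inter> Q \<union> A)" using x(3,4) unfolding idl_Un_iff by blast
  qed
qed

text \<open>
  One step of the filtration. Write \<open>Q\<close> for the ideal of the powers outside \<open>G\<close>. By the modular law, the ideals
  \<open>J Z0\<close> generated by \<open>I' \<inter> Q\<close> and the powers \<open>x\<^sub>i ^ \<beta> i\<close> with \<open>i \<in> Z0\<close> climb from \<open>I' \<inter> Q\<close> to \<open>I'\<close>. Going down from
  \<open>I'\<close>, the power of \<open>w\<close> is removed first: as \<open>w \<in> G\<close>, it is a nonzerodivisor modulo powers of variables
  outside \<open>G\<close>. In every step the colon ideal is again generated by powers of all the variables outside \<open>G\<close>.
\<close>

lemma regular_at_intersection: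
  fixes P :: "('n::finite, 'k::field) mpoly set"
  assumes P: "is_prime P"
    and Wbox: "\<And>e. regular_at P (pow_gens (- G) e) fs"
    and I': "is_ideal I'" "regular_at P I' fs"
    and Z: "Z \<subseteq> - G" "\<And>i. i \<in> Z \<Longrightarrow> \<beta> i \<le> e i" and w: "w \<in> G"
    and ZI: "\<And>i. i \<in> insert w Z \<Longrightarrow> poly_var i ^ \<beta> i \<in> I'"
    and cover: "I' \<subseteq> idl (pow_gens (- G) e \<union> pow_gens (insert w Z) \<beta>)"
  shows "regular_at P (I' \<inter> idl (pow_gens (- G) e)) fs"
proof -
  define Q where "Q = idl (pow_gens (- G) e :: ('n, 'k) mpoly set)"
  have Q: "is_ideal Q" unfolding Q_def by (rule ring_mod.subspace_span)
  define J where "J Z0 = idl (I' \<inter> Q \<union> pow_gens Z0 \<beta>)" for Z0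
  have genI: "pow_gens Z0 \<beta> \<subseteq> I'" if "Z0 \<subseteq> insert w Z" for Z0
    using that ZI by (auto simp: pow_gens_def)
  have J: "J Z0 = I' \<inter> idl (Q \<union> pow_gens Z0 \<beta>)" if "Z0 \<subseteq> insert w Z" for Z0
    unfolding J_def by (rule idl_modular[OF I'(1) Q genI[OF that]])
  have QZ: "idl (Q \<union> B) = idl (pow_gens (- G) e \<union> B)" for B
    by (auto simp: Q_def idl_Un_iff)
  have J_insert: "idl (insert (poly_var i ^ \<beta> i) (J Z0)) = J (insert i Z0)" for i Z0
  proof -
    have "idl (insert u (idl A)) = idl (insert u A)" for u and A :: "('n, 'k) mpoly set"
      by (auto simp: idl_insert_iff)
    then show ?thesis unfolding J_def by (simp add: pow_gens_insert)
  qed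
  have JI: "is_ideal (J Z0)" for Z0 unfolding J_def by (rule ring_mod.subspace_span)
  \<comment> \<open>The exponents of \<open>Q + (x\<^sub>i ^ \<beta> i : i \<in> Z0)\<close>.\<close>
  define eZ where "eZ Z0 i = (if i \<in> Z0 then \<beta> i else e i)" for Z0 i
  let ?pg = "pow_gens :: _ \<Rightarrow> _ \<Rightarrow> ('n, 'k) mpoly set"
  have box: "idl (Q \<union> ?pg Z0 \<beta>) = idl (?pg (- G) (eZ Z0))" if Z0: "Z0 \<subseteq> Z" for Z0
    unfolding QZ
  proof
    show "idl (?pg (- G) e \<union> ?pg Z0 \<beta>) \<subseteq> idl (?pg (- G) (eZ Z0))"
    proof (rule ring_mod.span_minimal[OF _ ring_mod.subspace_span], rule Un_least)
      show "?pg (- G) e \<subseteq> idl (?pg (- G) (eZ Z0))"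
      proof
        fix b :: "('n, 'k) mpoly" assume "b \<in> ?pg (- G) e"
        then obtain i where i: "i \<in> - G" "b = poly_var i ^ e i" by (auto simp: pow_gens_def)
        have "(poly_var i :: ('n, 'k) mpoly) ^ eZ Z0 i \<in> idl (?pg (- G) (eZ Z0))"
          by (rule ring_mod.span_base[OF pow_gens_I[OF i(1)]])
        moreover have "eZ Z0 i \<le> e i" using Z(2) Z0 by (auto simp: eZ_def)
        ultimately show "b \<in> idl (?pg (- G) (eZ Z0))"
          unfolding i(2) by (rule power_in_ideal_mono[OF ring_mod.subspace_span])
      qed
      show "?pg Z0 \<beta> \<subseteq> idl (?pg (- G) (eZ Z0))"
      proof
        fix b :: "('n, 'k) mpoly" assume "b \<in> ?pg Z0 \<beta>"
        then obtain i where i: "i \<in> Z0" "b = poly_var i ^ \<beta> i" by (auto simp: pow_gens_def)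
        then have "b = poly_var i ^ eZ Z0 i" "i \<in> - G" using Z0 Z(1) by (auto simp: eZ_def)
        then show "b \<in> idl (?pg (- G) (eZ Z0))" using ring_mod.span_base[OF pow_gens_I] by blast
      qed
    qed
    show "idl (?pg (- G) (eZ Z0)) \<subseteq> idl (?pg (- G) e \<union> ?pg Z0 \<beta>)"
      by (rule ring_mod.span_mono) (auto simp: pow_gens_def eZ_def)
  qed
  have top: "J (insert w Z) = I'"
    using cover unfolding J[OF subset_refl] QZ by blast
  have WZ: "regular_at P (J Z) fs"
  proof (rule regular_at_colon[OF P JI, where u = "poly_var w ^ \<beta> w"])
    show "is_ideal (idl (pow_gens (- G) (eZ Z)) :: ('n, 'k) mpoly set)" by (rule ring_mod.subspace_span)
    show "g \<in> idl (pow_gens (- G) (eZ Z))" if "g * poly_var w ^ \<beta> w \<in> J Z" for g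
    proof (rule pow_gens_colon_free)
      show "w \<notin> - G" using w by simp
      show "g * poly_var w ^ \<beta> w \<in> idl (pow_gens (- G) (eZ Z))"
        using that unfolding J[OF subset_insertI] box[OF subset_refl] by (rule IntD2)
    qed
    show "g * poly_var w ^ \<beta> w \<in> J Z" if "g \<in> idl (pow_gens (- G) (eZ Z))" for g
      unfolding J[OF subset_insertI] box[OF subset_refl]
      by (intro IntI is_ideal_mult_left[OF I'(1)] ZI is_ideal_mult_right[OF ring_mod.subspace_span that]) simp
    show "regular_at P (idl (insert (poly_var w ^ \<beta> w) (J Z))) fs" unfolding J_insert top by (rule I'(2))
    show "regular_at P (idl (pow_gens (- G) (eZ Z))) fs" unfolding regular_at_idl by (rule Wbox)
  qed
  have step: "regular_at P (J Z0) fs" if W: "regular_at P (J (insert i Z0)) fs" and iZ: "i \<in> Z" "i \<notin> Z0" "Z0 \<subseteq> Z" for i Z0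
  proof (rule regular_at_colon[OF P JI, where u = "poly_var i ^ \<beta> i"])
    let ?e = "(eZ Z0)(i := eZ Z0 i - \<beta> i)"
    have Z0w: "Z0 \<subseteq> insert w Z" using iZ(3) by blast
    have iG: "i \<in> - G" using iZ(1) Z(1) by blast
    have ei: "\<beta> i \<le> eZ Z0 i" using Z(2)[OF iZ(1)] iZ(2) by (simp add: eZ_def)
    show "is_ideal (idl (pow_gens (- G) ?e) :: ('n, 'k) mpoly set)" by (rule ring_mod.subspace_span)
    show "g \<in> idl (pow_gens (- G) ?e)" if "g * poly_var i ^ \<beta> i \<in> J Z0" for g
      using that unfolding J[OF Z0w] box[OF iZ(3)] by (intro pow_gens_colon[where e = "eZ Z0" and i = i and k = "\<beta> i", OF iG ei]) (rule IntD2)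
    show "g * poly_var i ^ \<beta> i \<in> J Z0" if "g \<in> idl (pow_gens (- G) ?e)" for g
      unfolding J[OF Z0w] box[OF iZ(3)]
      by (intro IntI is_ideal_mult_left[OF I'(1)] ZI pow_gens_colon_conv[where e = "eZ Z0" and i = i and k = "\<beta> i", OF iG ei that]) (simp add: iZ(1))
    show "regular_at P (idl (insert (poly_var i ^ \<beta> i) (J Z0))) fs" unfolding J_insert by (rule W)
    show "regular_at P (idl (pow_gens (- G) ?e)) fs" unfolding regular_at_idl by (rule Wbox)
  qed
  have "regular_at P (J (Z - Z1)) fs" if "finite Z1" "Z1 \<subseteq> Z" for Z1
    using that
  proof (induction Z1)
    case empty
    then show ?case using WZ by simp
  next
    case (insert i Z1)
    have eq: "insert i (Z - insert i Z1) = Z - Z1" using insert.hyps insert.prems by blast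
    have W: "regular_at P (J (insert i (Z - insert i Z1))) fs" unfolding eq using insert by blast
    show ?case by (rule step[OF W]) (use insert.prems in auto)
  qed
  from this[of Z] have "regular_at P (J {}) fs" by simp
  moreover have "J {} = I' \<inter> Q"
    unfolding J_def by (simp add: pow_gens_def idl_eq[OF ring_mod.subspace_inter[OF I'(1) Q]])
  ultimately show ?thesis by (simp add: Q_def)
qed

text \<open>
  What the combinatorics delivers to the algebra: \<open>b t\<close> is the index of the branch of the facet at index \<open>t\<close>,
  \<open>w t\<close> its new vertex and \<open>a i t\<close> the exponent of \<open>x\<^sub>i\<close> there. In \<open>a_step\<close> the second alternative covers
  vertices that appear only later, beyond the facet at \<open>t\<close>; their exponents may increase from \<open>b t\<close> to \<open>t\<close>.
\<close>

locale facet_order =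
  fixes Gs :: "'n::finite set list" and b :: "nat \<Rightarrow> nat" and w :: "nat \<Rightarrow> 'n" and a :: "'n \<Rightarrow> nat \<Rightarrow> nat"
  assumes Gs_ne: "Gs \<noteq> []"
    and card_eq: "\<And>t. t < length Gs \<Longrightarrow> card (Gs ! t) = card (Gs ! 0)"
    and b_less: "\<And>t. 1 \<le> t \<Longrightarrow> t < length Gs \<Longrightarrow> b t < t"
    and w_in: "\<And>t. 1 \<le> t \<Longrightarrow> t < length Gs \<Longrightarrow> w t \<in> Gs ! t"
    and G_sub: "\<And>t. 1 \<le> t \<Longrightarrow> t < length Gs \<Longrightarrow> Gs ! t - {w t} \<subseteq> Gs ! b t"
    and w_new: "\<And>t j. 1 \<le> t \<Longrightarrow> t < length Gs \<Longrightarrow> j < t \<Longrightarrow> w t \<notin> Gs ! j"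
    and a_w: "\<And>t j. 1 \<le> t \<Longrightarrow> t < length Gs \<Longrightarrow> j < t \<Longrightarrow> a (w t) j \<le> a (w t) (b t)"
    and a_step: "\<And>t i. 1 \<le> t \<Longrightarrow> t < length Gs \<Longrightarrow> i \<notin> Gs ! t \<Longrightarrow> i \<notin> Gs ! b t \<Longrightarrow>
        a i t \<le> a i (b t) \<or> (\<forall>j<t. i \<notin> Gs ! j \<and> a i j \<le> a i (b t))"
begin

text \<open>
  The new vertex of a facet takes the colour of the vertex of the branch that it replaces.
\<close>

lemma colouring_exists:
  "\<exists>col. \<forall>t<length Gs. \<forall>c\<in>Gs ! 0. \<exists>!x. x \<in> Gs ! t \<and> col x = c"
proof -
  have "\<exists>col. \<forall>t<n. \<forall>c\<in>Gs ! 0. \<exists>!x. x \<in> Gs ! t \<and> col x = c" if "n \<le> length Gs" for n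
    using that
  proof (induction n)
    case 0 then show ?case by simp
  next
    case (Suc n)
    then obtain col where col: "\<forall>t<n. \<forall>c\<in>Gs ! 0. \<exists>!x. x \<in> Gs ! t \<and> col x = c" by auto
    show ?case
    proof (cases "n = 0")
      case True
      then show ?thesis by (intro exI[of _ id]) auto
    next
      case False
      then have n: "1 \<le> n" "n < length Gs" using Suc.prems by auto
      let ?G = "Gs ! n" and ?H = "Gs ! b n" and ?w = "w n"
      have bn: "b n < n" by (rule b_less[OF n])
      have wG: "?w \<in> ?G" by (rule w_in[OF n])
      have wH: "?w \<notin> ?H" by (rule w_new[OF n bn])
      have GH: "?G - {?w} \<subseteq> ?H" by (rule G_sub[OF n])
      have "card ?H = card ?G" using card_eq[of n] card_eq[of "b n"] n bn by simp
      moreover have "card (?G - {?w}) = card ?G - 1" using wG by simp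
      moreover have "card ?G > 0" using wG by (auto simp: card_gt_0_iff)
      ultimately have "card (?H - (?G - {?w})) = 1" using GH by (subst card_Diff_subset) auto
      then obtain p where p: "?H - (?G - {?w}) = {p}" by (auto simp: card_1_singleton_iff)
      then have pH: "p \<in> ?H" "p \<notin> ?G" using wH by auto
      have H: "?H = insert p (?G - {?w})" using p GH by blast
      \<comment> \<open>Earlier facets do not contain \<open>?w\<close>, so their colouring is unaffected.\<close>
      define col' where "col' = col(?w := col p)"
      have "\<exists>!x. x \<in> Gs ! t \<and> col' x = c" if t: "t < Suc n" and c: "c \<in> Gs ! 0" for t c
      proof (cases "t = n")
        case False
        then have tn: "t < n" using t by simp
        then have "?w \<notin> Gs ! t" by (rule w_new[OF n])
        then have "x \<in> Gs ! t \<and> col' x = c \<longleftrightarrow> x \<in> Gs ! t \<and> col x = c" for x by (auto simp: col'_def)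
        then show ?thesis using col tn c by simp
      next
        case True
        have "\<exists>!x. x \<in> ?H \<and> col x = c" using col bn c by blast
        then obtain x where xc: "x \<in> ?H \<and> col x = c" and xu: "\<forall>y. y \<in> ?H \<and> col y = c \<longrightarrow> y = x"
          by (elim ex1E)
        have x: "x \<in> ?H" "col x = c" using xc by simp_all
        have x_unique: "y = x" if "y \<in> ?H" "col y = c" for y using xu that by simp
        show ?thesis
        proof (cases "x = p")
          case xp: True
          have "y = ?w" if "y \<in> ?G" "col' y = c" for y
          proof (rule ccontr)
            assume "y \<noteq> ?w"
            then have "y \<in> ?H" "col y = c" using that GH by (auto simp: col'_def)
            from x_unique[OF this] show False using xp pH that(1) by blast
          qed
          moreover have "col' ?w = c" using x(2) xp by (simp add: col'_def)
          ultimately show ?thesis unfolding True using wG by (intro ex1I[of _ ?w] conjI) blast+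
        next
          case xp: False
          have xG: "x \<in> ?G" "x \<noteq> ?w" using x(1) xp H wH by auto
          have "y = x" if "y \<in> ?G" "col' y = c" for y
          proof (cases "y = ?w")
            case yw: True
            then have "col p = c" using that(2) by (simp add: col'_def)
            from x_unique[OF pH(1) this] show ?thesis using xp by simp
          next
            case yw: False
            then have "y \<in> ?H" "col y = c" using that GH by (auto simp: col'_def)
            then show ?thesis by (rule x_unique)
          qed
          moreover have "col' x = c" using x(2) xG by (simp add: col'_def)
          ultimately show ?thesis unfolding True using xG by (intro ex1I[of _ x] conjI) blast+
        qed
      qed
      then show ?thesis by (intro exI[of _ col']) blast
    qed
  qed
  then show ?thesis by blast
qed

lemma regular_at_prefix:
  fixes P :: "('n::finite, 'k::field) mpoly set"
  assumes P: "is_prime P" and Wbox: "\<And>t e. t < length Gs \<Longrightarrow> regular_at P (pow_gens (- (Gs ! t)) e) fs"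
    and n: "n < length Gs"
  shows "regular_at P (\<Inter>t\<le>n. idl (pow_gens (- (Gs ! t)) (\<lambda>i. a i t))) fs"
  using n
proof (induction n)
  case 0
  then show ?case by (simp add: regular_at_idl Wbox)
next
  case (Suc n)
  let ?t = "Suc n"
  let ?Q = "\<lambda>t. idl (pow_gens (- (Gs ! t)) (\<lambda>i. a i t)) :: ('n, 'k) mpoly set"
  let ?I = "\<Inter>t\<le>n. ?Q t"
  have t: "1 \<le> ?t" "?t < length Gs" using Suc.prems by auto
  let ?\<beta> = "\<lambda>i. a i (b ?t)"
  \<comment> \<open>The vertices outside both facets at which the branch contributes a smaller power.\<close>
  define Z where "Z = {i. i \<notin> Gs ! ?t \<and> i \<notin> Gs ! b ?t \<and> ?\<beta> i < a i ?t}"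
  have bt: "b ?t < ?t" by (rule b_less[OF t])
  have I: "is_ideal ?I" by (intro ring_mod.subspace_Int ring_mod.subspace_span)
  have new: "i \<notin> Gs ! j \<and> a i j \<le> ?\<beta> i" if "i \<in> insert (w ?t) Z" "j < ?t" for i j
  proof (cases "i = w ?t")
    case True
    then show ?thesis using w_new[OF t that(2)] a_w[OF t that(2)] by simp
  next
    case False
    then have "i \<in> Z" using that(1) by simp
    then show ?thesis using a_step[OF t, of i] that(2) unfolding Z_def by auto
  qed
  have ZI: "poly_var i ^ ?\<beta> i \<in> ?I" if "i \<in> insert (w ?t) Z" for i
  proof (rule INT_I)
    fix j assume "j \<in> {..n}"
    then have j: "i \<notin> Gs ! j" "a i j \<le> ?\<beta> i" using new[OF that, of j] by auto
    have "poly_var i ^ a i j \<in> ?Q j" by (rule ring_mod.span_base[OF pow_gens_I]) (simp add: j(1))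
    then show "poly_var i ^ ?\<beta> i \<in> ?Q j" by (rule power_in_ideal_mono[OF ring_mod.subspace_span _ j(2)])
  qed
  have cover: "?I \<subseteq> idl (pow_gens (- (Gs ! ?t)) (\<lambda>i. a i ?t) \<union> pow_gens (insert (w ?t) Z) ?\<beta>)" (is "_ \<subseteq> idl (?A \<union> ?B)")
  proof -
    have "pow_gens (- (Gs ! b ?t)) ?\<beta> \<subseteq> idl (?A \<union> ?B)"
    proof
      fix x :: "('n, 'k) mpoly" assume "x \<in> pow_gens (- (Gs ! b ?t)) ?\<beta>"
      then obtain i where i: "i \<notin> Gs ! b ?t" "x = poly_var i ^ ?\<beta> i" by (auto simp: pow_gens_def)
      show "x \<in> idl (?A \<union> ?B)"
      proof (cases "i \<in> insert (w ?t) Z")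
        case True
        then show ?thesis unfolding i(2) by (intro ring_mod.span_base UnI2 pow_gens_I)
      next
        case False
        then have iG: "i \<notin> Gs ! ?t" using G_sub[OF t] i(1) by blast
        then have le: "a i ?t \<le> ?\<beta> i" using False i(1) unfolding Z_def by auto
        have "poly_var i ^ a i ?t \<in> idl (?A \<union> ?B)"
          by (intro ring_mod.span_base UnI1 pow_gens_I) (simp add: iG)
        then show ?thesis unfolding i(2) by (rule power_in_ideal_mono[OF ring_mod.subspace_span _ le])
      qed
    qed
    then have "?Q (b ?t) \<subseteq> idl (?A \<union> ?B)" by (rule ring_mod.span_minimal[OF _ ring_mod.subspace_span])
    moreover have "?I \<subseteq> ?Q (b ?t)" using bt by (intro INT_lower) simp
    ultimately show ?thesis by blast
  qed
  have "regular_at P (?I \<inter> ?Q ?t) fs"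
  proof (rule regular_at_intersection[OF P Wbox[OF t(2)] I _ _ _ w_in[OF t] ZI cover])
    show "regular_at P ?I fs" using Suc by simp
    show "Z \<subseteq> - (Gs ! ?t)" by (auto simp: Z_def)
    show "?\<beta> i \<le> a i ?t" if "i \<in> Z" for i using that by (simp add: Z_def)
  qed
  then show ?case by (simp add: atMost_Suc Int_commute)
qed

lemma prime_contains_one:
  fixes P :: "'b::comm_ring_1 set"
  assumes P: "is_prime P" and "finite A" "(\<Inter>t\<in>A. J t) \<subseteq> P" "\<And>t. is_ideal (J t)"
  shows "\<exists>t\<in>A. J t \<subseteq> P"
proof (rule ccontr)
  assume "\<not> ?thesis"
  then have "\<forall>t\<in>A. \<exists>x. x \<in> J t \<and> x \<notin> P" by blast
  from bchoice[OF this] obtain x where x: "\<And>t. t \<in> A \<Longrightarrow> x t \<in> J t \<and> x t \<notin> P" by blast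
  have "prod x A \<notin> P" using \<open>finite A\<close> x
    by (induction A) (use is_prime_one[OF P] is_prime_mult[OF P] in auto)
  moreover have "prod x A \<in> J t" if "t \<in> A" for t
    using \<open>finite A\<close> that x is_ideal_mult_right[OF assms(4)] by (simp add: prod.remove[of A t])
  ultimately show False using assms(3) by blast
qed

text \<open>
  For a prime over the ideal, the two lists of \<open>triangular_indep_split\<close>, read in the forms \<open>y\<^sub>c\<close>, yield the
  regular sequence and the bound on chains of primes; their lengths add up to the size of a facet.
\<close>

theorem cohen_macaulay_quotient:
  "cohen_macaulay (mpoly_ring Quot (\<Inter>t<length Gs. idl (pow_gens (- (Gs ! t)) (\<lambda>i. a i t)) :: ('n, 'k::field) mpoly set))"
  unfolding mpoly_ring_def
proof (rule cohen_macaulay_type_ring_quotientI[OF mpoly_noetherian])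
  let ?Q = "\<lambda>t. idl (pow_gens (- (Gs ! t)) (\<lambda>i. a i t)) :: ('n, 'k) mpoly set"
  let ?I = "\<Inter>t<length Gs. ?Q t"
  show "is_ideal ?I" by (intro ring_mod.subspace_Int ring_mod.subspace_span)
  fix P assume P: "is_prime P" and IP: "?I \<subseteq> P"
  from colouring_exists obtain col where
    col: "\<forall>t<length Gs. \<forall>c\<in>Gs ! 0. \<exists>!x. x \<in> Gs ! t \<and> col x = c" by (elim exE)
  let ?s = "subst (colsum col) :: ('n, 'k) mpoly \<Rightarrow> _"
  let ?N = "{p. ?s p \<in> P}"
  have N: "is_prime ?N" by (rule is_prime_vimage[OF P rhom_subst])
  obtain cs where cs: "set cs = Gs ! 0" "distinct cs" using finite_distinct_list[of "Gs ! 0"] by auto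
  from triangular_indep_split[OF N cs(2)] obtain gs zs where gs: "length gs + length zs = length cs"
    "set gs \<subseteq> ?N \<inter> polys_in (set cs)" "alg_indep ?N zs" "triangular (Gs ! 0) ?N gs" unfolding cs(1) by (elim exE conjE)
  let ?fs = "map ?s gs"
  have Wbox: "regular_at P (pow_gens (- (Gs ! t)) e) ?fs" if "t < length Gs" for t e
    unfolding pow_gens_def
  proof (rule regular_at_box[OF P gs(4)])
    show "\<exists>!x'. x' \<in> Gs ! t \<and> col x' = x" if "x \<in> Gs ! 0" for x using col \<open>t < length Gs\<close> that by blast
    show "- (Gs ! t) \<inter> Gs ! t = {}" by simp
  qed
  have "regular_at P (\<Inter>t\<le>length Gs - 1. ?Q t) ?fs"
    by (rule regular_at_prefix[OF P Wbox]) (use Gs_ne in auto)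
  moreover have "{..length Gs - 1} = {..<length Gs}" using Gs_ne by (cases Gs) auto
  ultimately have W: "regular_at P ?I ?fs" by (simp only:)
  have bound: "r \<le> length ?fs" if Q: "\<forall>i\<le>r. is_prime (Q i) \<and> ?I \<subseteq> Q i" "\<forall>i<r. Q i \<subset> Q (Suc i)" "Q r \<subseteq> P" for r Q
  proof -
    have "alg_indep P (map ?s zs)" by (rule alg_indep_map[OF rhom_subst _ gs(3)]) (simp add: subst_simps)
    then have "alg_indep (Q r) (map ?s zs)" using Q(3) by (rule alg_indep_subset)
    moreover have "\<forall>i\<le>r. is_prime (Q i)" using Q(1) by blast
    ultimately obtain ys where ys: "length ys = r" "alg_indep (Q 0) (ys @ map ?s zs)"
      using alg_indep_prime_chain[OF _ Q(2)] by blast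
    have Q0: "is_prime (Q 0)" "?I \<subseteq> Q 0" using Q(1) by auto
    obtain t where t: "t < length Gs" "?Q t \<subseteq> Q 0"
      using prime_contains_one[OF Q0(1) _ Q0(2)] ring_mod.subspace_span by blast
    have "poly_var i \<in> Q 0" if "i \<notin> Gs ! t" for i
    proof -
      have "poly_var i ^ a i t \<in> ?Q t" by (rule ring_mod.span_base[OF pow_gens_I]) (simp add: that)
      then show ?thesis using t(2) is_prime_power[OF Q0(1)] by blast
    qed
    from alg_indep_length_le[OF is_prime_ideal[OF Q0(1)] this ys(2)]
    have "r + length zs \<le> card (Gs ! t)" using ys(1) by simp
    also have "\<dots> = length cs" using card_eq[OF t(1)] cs distinct_card by metis
    finally show ?thesis using gs(1) by simp
  qed
  show "\<exists>fs. set fs \<subseteq> P \<and> regular_at P ?I fs \<and>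
        (\<forall>r Q. (\<forall>i\<le>r. is_prime (Q i) \<and> ?I \<subseteq> Q i) \<and> (\<forall>i<r. Q i \<subset> Q (Suc i)) \<and> Q r \<subseteq> P
            \<longrightarrow> r \<le> length fs)"
  proof (intro exI[of _ ?fs] conjI allI impI)
    show "set ?fs \<subseteq> P" using gs(2) by auto
    show "regular_at P ?I ?fs" by (rule W)
    fix r Q assume "(\<forall>i\<le>r. is_prime (Q i) \<and> ?I \<subseteq> Q i) \<and> (\<forall>i<r. Q i \<subset> Q (Suc i)) \<and> Q r \<subseteq> P"
    then show "r \<le> length ?fs" by (elim conjE) (rule bound)
  qed
qed

end

section \<open>Leaf orders and relation trees\<close>

text \<open>
  A leaf order with chosen branches, freed from complexes: facets form an antichain, so the complex generated
  by a prefix of the list has just the members of the prefix as facets.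
\<close>

locale branch_order =
  fixes Gs :: "'n::finite set list" and br :: "nat \<Rightarrow> 'n set"
  assumes dist: "distinct Gs"
    and br_in: "\<And>t. 1 \<le> t \<Longrightarrow> t < length Gs \<Longrightarrow> br t \<in> set (take t Gs)"
    and br_cover: "\<And>t H. 1 \<le> t \<Longrightarrow> t < length Gs \<Longrightarrow> H \<in> set (take t Gs) \<Longrightarrow> H \<inter> Gs ! t \<subseteq> br t"
begin

lemma in_take_iff: "k \<le> length Gs \<Longrightarrow> x \<in> set (take k Gs) \<longleftrightarrow> (\<exists>j<k. x = Gs ! j)"
  by (auto simp: in_set_conv_nth)

lemma nth_in_take_iff: "k \<le> length Gs \<Longrightarrow> j < length Gs \<Longrightarrow> Gs ! j \<in> set (take k Gs) \<longleftrightarrow> j < k"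
  using dist by (auto simp: in_take_iff nth_eq_iff_index_eq)

definition branch_index :: "nat \<Rightarrow> nat" where
  "branch_index t = (SOME j. j < t \<and> Gs ! j = br t)"

lemma branch_index: "1 \<le> t \<Longrightarrow> t < length Gs \<Longrightarrow> branch_index t < t \<and> Gs ! branch_index t = br t"
  unfolding branch_index_def using br_in[of t] in_take_iff[of t "br t"]
  by (intro someI_ex[of "\<lambda>j. j < t \<and> Gs ! j = br t"]) auto

definition edges :: "'n set set set" where
  "edges = {{Gs ! t, br t} | t. 1 \<le> t \<and> t < length Gs}"

lemma edge: "1 \<le> t \<Longrightarrow> t < length Gs \<Longrightarrow> {Gs ! t, br t} \<in> edges"
  "1 \<le> t \<Longrightarrow> t < length Gs \<Longrightarrow> {br t, Gs ! t} \<in> edges"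
  by (auto simp: edges_def insert_commute)

definition tree_path :: "'n set list \<Rightarrow> bool" where
  "tree_path p \<longleftrightarrow> p \<noteq> [] \<and> distinct p \<and> set p \<subseteq> set Gs \<and> successively (\<lambda>x y. {x, y} \<in> edges) p"

lemma tree_path_Cons:
  "tree_path p \<Longrightarrow> x \<in> set Gs \<Longrightarrow> x \<notin> set p \<Longrightarrow> {x, hd p} \<in> edges \<Longrightarrow> tree_path (x # p)"
  unfolding tree_path_def by (auto simp: successively_Cons)

lemma tree_path_snoc:
  "tree_path p \<Longrightarrow> x \<in> set Gs \<Longrightarrow> x \<notin> set p \<Longrightarrow> {last p, x} \<in> edges \<Longrightarrow> tree_path (p @ [x])"
  unfolding tree_path_def by (auto simp: successively_append_iff)

lemma tree_path_suffix:
  "tree_path (xs @ ys) \<Longrightarrow> ys \<noteq> [] \<Longrightarrow> tree_path ys"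
  unfolding tree_path_def by (auto simp: successively_append_iff)

lemma tree_path_single: "x \<in> set Gs \<Longrightarrow> tree_path [x]"
  by (simp add: tree_path_def)

lemma prefix_path:
  assumes "k \<le> length Gs" "A \<in> set (take k Gs)" "B \<in> set (take k Gs)"
  shows "\<exists>p. tree_path p \<and> hd p = A \<and> last p = B \<and> set p \<subseteq> set (take k Gs)"
  using assms
proof (induction k arbitrary: A B)
  case 0
  then show ?case by simp
next
  case (Suc k)
  let ?g = "Gs ! k"
  have k: "k < length Gs" "k \<le> length Gs" using Suc.prems by auto
  have tk: "set (take (Suc k) Gs) = insert ?g (set (take k Gs))"
    using k by (simp add: take_Suc_conv_app_nth)
  have g: "?g \<in> set Gs" "?g \<notin> set (take k Gs)" using k nth_in_take_iff[of k k] by simp_all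
  have k1: "1 \<le> k" if "C \<in> set (take k Gs)" for C using that by (cases k) auto
  consider "A = ?g" "B = ?g" | "A = ?g" "B \<in> set (take k Gs)" | "A \<in> set (take k Gs)" "B = ?g"
    | "A \<in> set (take k Gs)" "B \<in> set (take k Gs)" using Suc.prems(2,3) unfolding tk by blast
  then show ?case
  proof cases
    case 1
    then show ?thesis using g tk by (intro exI[of _ "[?g]"]) (simp add: tree_path_single)
  next
    case 2
    have brk: "br k \<in> set (take k Gs)" by (rule br_in[OF k1[OF 2(2)] k(1)])
    from Suc.IH[OF k(2) brk 2(2)] obtain p where p: "tree_path p" "hd p = br k" "last p = B" "set p \<subseteq> set (take k Gs)" by blast
    have "tree_path (?g # p)"
      using p g edge(1)[OF k1[OF 2(2)] k(1)] by (intro tree_path_Cons) auto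
    then show ?thesis using 2 p tk by (intro exI[of _ "?g # p"]) (auto simp: tree_path_def)
  next
    case 3
    have brk: "br k \<in> set (take k Gs)" by (rule br_in[OF k1[OF 3(1)] k(1)])
    from Suc.IH[OF k(2) 3(1) brk] obtain p where p: "tree_path p" "hd p = A" "last p = br k" "set p \<subseteq> set (take k Gs)" by blast
    have "tree_path (p @ [?g])"
      using p g edge(2)[OF k1[OF 3(1)] k(1)] by (intro tree_path_snoc) auto
    then show ?thesis using 3 p tk by (intro exI[of _ "p @ [?g]"]) (auto simp: tree_path_def)
  next
    case 4
    then show ?thesis using Suc.IH[OF k(2) 4] tk by blast
  qed
qed

text \<open>
  Passing from a facet to its branch lowers the index. So from index \<open>s\<close> one arrives at some index \<open>k \<le> t\<close>
  through facets of index above \<open>t\<close>, and any path among the first \<open>t + 1\<close> facets can follow. The point of this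
  formulation is that the facet at \<open>t\<close> itself may be the place of arrival, which decides the direction in which
  its edge to the branch is traversed.
\<close>

lemma descending_path:
  assumes "s < length Gs" "t < length Gs"
  shows "\<exists>k\<le>t. \<forall>q. tree_path q \<and> hd q = Gs ! k \<and> set q \<subseteq> set (take (Suc t) Gs) \<longrightarrow>
    (\<exists>r. tree_path (r @ q) \<and> hd (r @ q) = Gs ! s \<and> set (r @ q) \<subseteq> set (take (Suc (max s t)) Gs))"
  using assms(1)
proof (induction s rule: less_induct)
  case (less s)
  show ?case
  proof (cases "s \<le> t")
    case True
    then show ?thesis by (intro exI[of _ s]) (auto intro!: exI[of _ "[]"] simp: max_def)
  next
    case False
    then have s: "1 \<le> s" "s < length Gs" "t < s" using less.prems by auto
    let ?b = "branch_index s"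
    have b: "?b < s" "Gs ! ?b = br s" using branch_index[OF s(1,2)] by auto
    from less.IH[OF b(1)] s b obtain k where k: "k \<le> t" and
      kq: "\<And>q. tree_path q \<Longrightarrow> hd q = Gs ! k \<Longrightarrow> set q \<subseteq> set (take (Suc t) Gs) \<Longrightarrow>
        (\<exists>r. tree_path (r @ q) \<and> hd (r @ q) = Gs ! ?b \<and> set (r @ q) \<subseteq> set (take (Suc (max ?b t)) Gs))" by auto
    have "\<exists>r. tree_path (r @ q) \<and> hd (r @ q) = Gs ! s \<and> set (r @ q) \<subseteq> set (take (Suc (max s t)) Gs)"
      if q: "tree_path q" "hd q = Gs ! k" "set q \<subseteq> set (take (Suc t) Gs)" for q
    proof -
      obtain r where r: "tree_path (r @ q)" "hd (r @ q) = br s" "set (r @ q) \<subseteq> set (take (Suc (max ?b t)) Gs)"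
        using kq[OF q] unfolding b(2) by (elim exE conjE)
      have le: "Suc (max ?b t) \<le> s" using b s by simp
      have sub: "set (take (Suc (max ?b t)) Gs) \<subseteq> set (take s Gs)" by (rule set_take_subset_set_take[OF le])
      have "Gs ! s \<notin> set (take s Gs)" using nth_in_take_iff[of s s] s by simp
      then have "tree_path (Gs ! s # (r @ q))"
        using r sub s edge(1)[OF s(1,2)] by (intro tree_path_Cons) auto
      moreover have "set (take (Suc (max s t)) Gs) = insert (Gs ! s) (set (take s Gs))"
        using s by (simp add: max_def take_Suc_conv_app_nth)
      ultimately show ?thesis using r(3) sub by (intro exI[of _ "Gs ! s # r"]) auto
    qed
    then show ?thesis using k by blast
  qed
qed

definition adj :: "nat \<Rightarrow> 'n set set \<Rightarrow> 'n set \<Rightarrow> 'n set \<Rightarrow> bool" where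
  "adj d U A B \<longleftrightarrow> A \<in> U \<and> B \<in> U \<and> card (A \<inter> B) = d - 1"

text \<open>
  All neighbours of \<open>g\<close> meet \<open>g\<close> in the same set \<open>c \<inter> g\<close>, hence are equal or adjacent to each other. A path that
  runs through \<open>g\<close> can therefore skip it.
\<close>

lemma adj_bypass:
  assumes cardU: "\<And>A. A \<in> insert g U \<Longrightarrow> card A = d" and d: "d \<ge> 1" and gU: "g \<notin> U"
    and c: "c \<in> U" "\<And>H. H \<in> U \<Longrightarrow> H \<inter> g \<subseteq> c"
    and path: "(adj d (insert g U))\<^sup>*\<^sup>* A B" and A: "A \<in> U"
  shows "(B \<in> U \<longrightarrow> (adj d U)\<^sup>*\<^sup>* A B) \<and> (B = g \<longrightarrow> (\<forall>K\<in>U. card (K \<inter> g) = d - 1 \<longrightarrow> (adj d U)\<^sup>*\<^sup>* A K))"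
  using path
proof induction
  case base
  then show ?case using A gU by auto
next
  case (step B C)
  have lt: "card (K \<inter> L) < d" if "K \<in> insert g U" "L \<in> insert g U" "K \<noteq> L" for K L
  proof -
    have "K \<inter> L \<subset> K"
    proof (rule psubsetI)
      show "K \<inter> L \<noteq> K"
      proof
        assume "K \<inter> L = K"
        then have "K \<subseteq> L" by blast
        then have "K = L" using cardU[OF that(1)] cardU[OF that(2)] by (intro card_seteq) auto
        then show False using that(3) by blast
      qed
    qed blast
    then have "card (K \<inter> L) < card K" by (intro psubset_card_mono) auto
    then show ?thesis using cardU[OF that(1)] by simp
  qed
  have meet: "K \<inter> g = c \<inter> g" if "K \<in> U" "card (K \<inter> g) = d - 1" for K
  proof (rule card_seteq)
    show "K \<inter> g \<subseteq> c \<inter> g" using c(2)[OF that(1)] by blast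
    have "card (c \<inter> g) < d" using lt[of c g] c(1) gU by blast
    then show "card (c \<inter> g) \<le> card (K \<inter> g)" using that(2) by simp
  qed simp
  have nb: "(adj d U)\<^sup>*\<^sup>* H K" if HK: "H \<in> U" "card (H \<inter> g) = d - 1" "K \<in> U" "card (K \<inter> g) = d - 1" for H K
  proof (cases "H = K")
    case False
    have "H \<inter> g \<subseteq> H \<inter> K" using meet[OF HK(1,2)] meet[OF HK(3,4)] by blast
    then have "d - 1 \<le> card (H \<inter> K)" using HK(2) card_mono[of "H \<inter> K" "H \<inter> g"] by simp
    moreover have "card (H \<inter> K) < d" using lt[of H K] HK False by blast
    ultimately have "adj d U H K" using HK d by (simp add: adj_def)
    then show ?thesis by blast
  qed simp
  have adjBC: "B \<in> insert g U" "C \<in> insert g U" "card (B \<inter> C) = d - 1" using step.hyps(2) by (auto simp: adj_def)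
  show ?case
  proof (intro conjI impI ballI)
    assume C: "C \<in> U"
    show "(adj d U)\<^sup>*\<^sup>* A C"
    proof (cases "B = g")
      case True
      then show ?thesis using step.IH C adjBC(3) by (simp add: Int_commute)
    next
      case False
      then have BU: "B \<in> U" using adjBC(1) by simp
      have "adj d U B C" unfolding adj_def using BU C adjBC(3) by simp
      moreover have "(adj d U)\<^sup>*\<^sup>* A B" using step.IH BU by blast
      ultimately show ?thesis by (meson rtranclp.rtrancl_into_rtrancl)
    qed
  next
    fix K assume C: "C = g" and K: "K \<in> U" "card (K \<inter> g) = d - 1"
    show "(adj d U)\<^sup>*\<^sup>* A K"
    proof (cases "B = g")
      case True
      then show ?thesis using step.IH K by blast
    next
      case False
      then have B: "B \<in> U" "(adj d U)\<^sup>*\<^sup>* A B" using adjBC step.IH by auto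
      have "(adj d U)\<^sup>*\<^sup>* B K" using nb[OF B(1) _ K] adjBC(3) C by simp
      then show ?thesis using B(2) by (rule rtranclp_trans[rotated])
    qed
  qed
qed

lemma prefix_strongly_connected:
  assumes card: "\<And>A. A \<in> set Gs \<Longrightarrow> card A = d" and d: "d \<ge> 1"
    and conn: "\<And>A B. A \<in> set Gs \<Longrightarrow> B \<in> set Gs \<Longrightarrow> (adj d (set Gs))\<^sup>*\<^sup>* A B"
    and k: "k \<le> length Gs" and AB: "A \<in> set (take k Gs)" "B \<in> set (take k Gs)"
  shows "(adj d (set (take k Gs)))\<^sup>*\<^sup>* A B"
  using k AB
proof (induction k arbitrary: A B rule: inc_induct)
  case base
  then show ?case using conn by simp
next
  case (step k)
  have tk: "set (take (Suc k) Gs) = insert (Gs ! k) (set (take k Gs))"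
    using step.hyps by (simp add: take_Suc_conv_app_nth)
  have k1: "1 \<le> k" using step.prems by (cases k) auto
  have "(adj d (insert (Gs ! k) (set (take k Gs))))\<^sup>*\<^sup>* A B"
    using step.IH[of A B] step.prems unfolding tk by blast
  note path = this
  have sub: "insert (Gs ! k) (set (take k Gs)) \<subseteq> set Gs"
    using step.hyps set_take_subset[of k Gs] by auto
  have new: "Gs ! k \<notin> set (take k Gs)" using nth_in_take_iff[of k k] step.hyps by simp
  have kl: "k < length Gs" using step.hyps by simp
  show ?case
  proof (rule adj_bypass[THEN conjunct1, rule_format])
    show "card C = d" if "C \<in> insert (Gs ! k) (set (take k Gs))" for C using card sub that by blast
    show "H \<inter> Gs ! k \<subseteq> br k" if "H \<in> set (take k Gs)" for H by (rule br_cover[OF k1 kl that])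
  qed (use d new br_in[OF k1 kl] path step.prems in blast)+
qed

text \<open>
  The prefix up to \<open>t\<close> is strongly connected, so the facet at \<open>t\<close> has a neighbour in it; the intersection with
  this neighbour is contained in the branch.
\<close>

lemma card_branch_meet:
  assumes card: "\<And>A. A \<in> set Gs \<Longrightarrow> card A = d" and d: "d \<ge> 1"
    and conn: "\<And>A B. A \<in> set Gs \<Longrightarrow> B \<in> set Gs \<Longrightarrow> (adj d (set Gs))\<^sup>*\<^sup>* A B"
    and t: "1 \<le> t" "t < length Gs"
  shows "card (Gs ! t - br t) = 1"
proof -
  let ?g = "Gs ! t" and ?U = "set (take (Suc t) Gs)"
  have tk: "?U = insert ?g (set (take t Gs))" using t by (simp add: take_Suc_conv_app_nth)
  have gn: "?g \<notin> set (take t Gs)" using nth_in_take_iff[of t t] t by simp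
  have g: "?g \<in> set Gs" using t by simp
  have b: "br t \<in> set (take t Gs)" by (rule br_in[OF t])
  have bG: "br t \<in> set Gs" using b by (rule in_set_takeD)
  have "(adj d ?U)\<^sup>*\<^sup>* (br t) ?g"
    by (rule prefix_strongly_connected[OF card d conn]) (use t tk b in auto)
  moreover have "br t \<noteq> ?g" using b gn by metis
  ultimately obtain A where A: "adj d ?U A ?g" by (metis rtranclp.cases)
  then have cA: "card (A \<inter> ?g) = d - 1" "A \<in> ?U" by (simp_all add: adj_def)
  have "A \<noteq> ?g" using cA(1) card[OF g] d by auto
  then have "A \<in> set (take t Gs)" using cA(2) tk by blast
  then have "A \<inter> ?g \<subseteq> br t \<inter> ?g" using br_cover[OF t] by blast
  then have ge: "d - 1 \<le> card (br t \<inter> ?g)" using card_mono[of "br t \<inter> ?g" "A \<inter> ?g"] cA(1) by simp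
  have "\<not> ?g \<subseteq> br t"
  proof
    assume "?g \<subseteq> br t"
    then have "?g = br t" using card[OF g] card[OF bG] by (intro card_seteq) auto
    then show False using b gn by simp
  qed
  then have "?g - br t \<noteq> {}" by blast
  then have "card (?g - br t) \<ge> 1" using card_gt_0_iff[of "?g - br t"] by simp
  moreover have "card (?g - br t) + card (br t \<inter> ?g) = card ?g"
    using card_Diff_subset_Int[of ?g "br t"] card_mono[of ?g "?g \<inter> br t"] by (simp add: Int_commute)
  ultimately show ?thesis using ge card[OF g] d by simp
qed

text \<open>
  A path that avoids \<open>i\<close> and starts next to a facet containing \<open>i\<close> is a path of the contracted tree that starts
  at the contracted vertex. The exponents of \<open>x\<^sub>i\<close> may not increase along it.
\<close>

definition outward_antimono :: "('n set \<Rightarrow> nat) \<Rightarrow> 'n \<Rightarrow> bool" where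
  "outward_antimono f i \<longleftrightarrow> (\<forall>p G k l. tree_path p \<longrightarrow> (\<forall>x\<in>set p. i \<notin> x) \<longrightarrow> G \<in> set Gs \<longrightarrow> i \<in> G \<longrightarrow>
     {hd p, G} \<in> edges \<longrightarrow> k \<le> l \<longrightarrow> l < length p \<longrightarrow> f (p ! l) \<le> f (p ! k))"

lemma outward_antimonoD:
  assumes "outward_antimono f i" "tree_path p" "\<And>x. x \<in> set p \<Longrightarrow> i \<notin> x" "G \<in> set Gs" "i \<in> G" "{hd p, G} \<in> edges"
    "k \<le> l" "l < length p"
  shows "f (p ! l) \<le> f (p ! k)"
  using assms unfolding outward_antimono_def by blast

text \<open>
  No facet before \<open>t\<close> contains the new vertex, so the path from the branch to an earlier facet inside the prefix
  leads away from the facet at \<open>t\<close>, which contains it.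
\<close>

lemma exponent_new_vertex:
  assumes f: "outward_antimono f i" and t: "1 \<le> t" "t < length Gs" and i: "i \<in> Gs ! t" "i \<notin> br t" and j: "j < t"
  shows "i \<notin> Gs ! j" "f (Gs ! j) \<le> f (br t)"
proof -
  have new: "i \<notin> H" if "H \<in> set (take t Gs)" for H using br_cover[OF t that] i by blast
  have jt: "Gs ! j \<in> set (take t Gs)" using nth_in_take_iff[of t j] t j by simp
  then show "i \<notin> Gs ! j" by (rule new)
  obtain p where p: "tree_path p" "hd p = br t" "last p = Gs ! j" "set p \<subseteq> set (take t Gs)"
    using prefix_path[OF less_imp_le[OF t(2)] br_in[OF t] jt] by blast
  have ne: "p \<noteq> []" using p(1) by (simp add: tree_path_def)
  have "f (p ! (length p - 1)) \<le> f (p ! 0)"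
    by (rule outward_antimonoD[OF f p(1) _ _ i(1)]) (use new p t ne edge(2)[OF t] in auto)
  then show "f (Gs ! j) \<le> f (br t)" using p(2,3) ne by (simp add: hd_conv_nth last_conv_nth)
qed

text \<open>
  Suppose first that \<open>i\<close> occurs before \<open>t\<close>. Then a path inside the prefix leads from its occurrences to the
  branch and on to the facet at \<open>t\<close>. Otherwise take the first facet that contains \<open>i\<close>; it comes after \<open>t\<close>, and a
  path descends from its branch. If the path reaches the prefix at \<open>t\<close> itself, it goes on to the branch of \<open>t\<close>
  and to all earlier facets; if it arrives before \<open>t\<close>, it goes on to the branch of \<open>t\<close> and then to \<open>t\<close>.
\<close>

lemma exponent_old_vertex:
  assumes f: "outward_antimono f i" and t: "1 \<le> t" "t < length Gs" and i: "i \<notin> Gs ! t" "i \<notin> br t"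
    and ex: "\<exists>G\<in>set Gs. i \<in> G"
  shows "f (Gs ! t) \<le> f (br t) \<or> (\<forall>j<t. i \<notin> Gs ! j \<and> f (Gs ! j) \<le> f (br t))"
proof -
  have tl: "t \<le> length Gs" using t by simp
  have brt: "br t \<in> set (take t Gs)" by (rule br_in[OF t])
  have gt: "Gs ! t \<in> set Gs" "Gs ! t \<notin> set (take t Gs)" using t nth_in_take_iff[of t t] by simp_all
  have St: "set (take (Suc t) Gs) = insert (Gs ! t) (set (take t Gs))" using t by (simp add: take_Suc_conv_app_nth)
  show ?thesis
  proof (cases "\<exists>H\<in>set (take t Gs). i \<in> H")
    case True
    then obtain H where H: "H \<in> set (take t Gs)" "i \<in> H" by blast
    obtain p where p: "tree_path p" "hd p = H" "last p = br t" "set p \<subseteq> set (take t Gs)"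
      using prefix_path[OF tl H(1) brt] by blast
    have "\<exists>x\<in>set p. i \<in> x" using p(1,2) H(2) by (auto simp: tree_path_def)
    then obtain xs x ys where s: "p = xs @ x # ys" "i \<in> x" "\<forall>y\<in>set ys. i \<notin> y"
      using split_list_last_prop[of p "\<lambda>x. i \<in> x"] by blast
    have ys: "ys \<noteq> []" using s p(3) i(2) by auto
    then have e: "{x, hd ys} \<in> edges" using p(1) unfolding s(1) tree_path_def by (auto simp: successively_append_iff successively_Cons)
    have "tree_path ys" using tree_path_suffix[of "xs @ [x]" ys] p(1) s(1) ys by simp
    moreover have "last ys = br t" using p(3) s(1) ys by simp
    moreover have "Gs ! t \<notin> set ys" using p(4) s(1) gt by auto
    ultimately have q: "tree_path (ys @ [Gs ! t])" using gt edge(2)[OF t] by (intro tree_path_snoc) auto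
    have "f ((ys @ [Gs ! t]) ! length ys) \<le> f ((ys @ [Gs ! t]) ! (length ys - 1))"
    proof (rule outward_antimonoD[OF f q _ _ s(2)])
      show "x \<in> set Gs" using p(1) s(1) by (auto simp: tree_path_def)
      show "{hd (ys @ [Gs ! t]), x} \<in> edges" using e ys by (simp add: insert_commute)
    qed (use s(3) i(1) in auto)
    moreover have "(ys @ [Gs ! t]) ! (length ys - 1) = br t"
      using ys \<open>last ys = br t\<close> by (simp add: nth_append last_conv_nth)
    ultimately show ?thesis by simp
  next
    case False
    define s where "s = (LEAST s. s < length Gs \<and> i \<in> Gs ! s)"
    have "\<exists>s. s < length Gs \<and> i \<in> Gs ! s" using ex by (auto simp: in_set_conv_nth)
    from LeastI_ex[OF this] have s: "s < length Gs" "i \<in> Gs ! s" unfolding s_def by auto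
    have least: "i \<notin> Gs ! j" if "j < s" for j using not_less_Least[of j "\<lambda>s. s < length Gs \<and> i \<in> Gs ! s"] that s(1) unfolding s_def by auto
    have noti: "i \<notin> H" if "H \<in> set (take s Gs)" for H using that least in_take_iff[of s H] s(1) by auto
    have ts: "t < s"
    proof (rule ccontr)
      assume "\<not> t < s"
      then consider "s = t" | "s < t" by linarith
      then show False
      proof cases
        case 1 then show ?thesis using s i by simp
      next
        case 2
        then have "Gs ! s \<in> set (take t Gs)" using nth_in_take_iff[of t s] t s by simp
        then show ?thesis using False s by blast
      qed
    qed
    have s1: "1 \<le> s" using ts by simp
    let ?b = "branch_index s"
    have b: "?b < s" "Gs ! ?b = br s" using branch_index[OF s1 s(1)] by auto
    have bl: "?b < length Gs" using b s by simp
    obtain k where k: "k \<le> t" and kq: "\<And>q. tree_path q \<Longrightarrow> hd q = Gs ! k \<Longrightarrow> set q \<subseteq> set (take (Suc t) Gs) \<Longrightarrow>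
       \<exists>r. tree_path (r @ q) \<and> hd (r @ q) = br s \<and> set (r @ q) \<subseteq> set (take (Suc (max ?b t)) Gs)"
      using descending_path[OF bl t(2)] unfolding b(2) by blast
    have anti: "f (q ! y) \<le> f (q ! x)"
      if q: "tree_path q" "hd q = Gs ! k" "set q \<subseteq> set (take (Suc t) Gs)" and xy: "x \<le> y" "y < length q" for q x y
    proof -
      obtain r where r: "tree_path (r @ q)" "hd (r @ q) = br s" "set (r @ q) \<subseteq> set (take (Suc (max ?b t)) Gs)"
        using kq[OF q] by blast
      have "Suc (max ?b t) \<le> s" using b ts by simp
      then have sub: "set (take (Suc (max ?b t)) Gs) \<subseteq> set (take s Gs)" by (rule set_take_subset_set_take)
      have "f ((r @ q) ! (length r + y)) \<le> f ((r @ q) ! (length r + x))"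
      proof (rule outward_antimonoD[OF f r(1) _ _ s(2)])
        show "{hd (r @ q), Gs ! s} \<in> edges" unfolding r(2) by (rule edge(2)[OF s1 s(1)])
      qed (use noti r(3) sub s xy in auto)
      then show ?thesis by simp
    qed
    show ?thesis
    proof (cases "k = t")
      case True
      have "f (Gs ! j) \<le> f (br t)" if j: "j < t" for j
      proof -
        have jt: "Gs ! j \<in> set (take t Gs)" using nth_in_take_iff[of t j] t j by simp
        obtain p where p: "tree_path p" "hd p = br t" "last p = Gs ! j" "set p \<subseteq> set (take t Gs)"
          using prefix_path[OF tl brt jt] by blast
        have ne: "p \<noteq> []" using p(1) by (simp add: tree_path_def)
        have "tree_path (Gs ! t # p)" using p gt edge(1)[OF t] by (intro tree_path_Cons) auto
        then have "f ((Gs ! t # p) ! length p) \<le> f ((Gs ! t # p) ! 1)"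
          by (rule anti) (use True p(4) St ne in \<open>auto simp: Suc_le_eq\<close>)
        then show ?thesis using p(2,3) ne by (simp add: hd_conv_nth last_conv_nth nth_Cons')
      qed
      moreover have "i \<notin> Gs ! j" if "j < t" for j using least that ts by simp
      ultimately show ?thesis by blast
    next
      case False
      then have kt: "Gs ! k \<in> set (take t Gs)" using nth_in_take_iff[of t k] t k by simp
      obtain p where p: "tree_path p" "hd p = Gs ! k" "last p = br t" "set p \<subseteq> set (take t Gs)"
        using prefix_path[OF tl kt brt] by blast
      have ne: "p \<noteq> []" using p(1) by (simp add: tree_path_def)
      have "tree_path (p @ [Gs ! t])" using p gt edge(2)[OF t] by (intro tree_path_snoc) auto
      then have "f ((p @ [Gs ! t]) ! length p) \<le> f ((p @ [Gs ! t]) ! (length p - 1))"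
        by (rule anti) (use p St ne in auto)
      then show ?thesis using p(3) ne by (simp add: nth_append last_conv_nth)
    qed
  qed
qed

end

section \<open>Facets and the final argument\<close>

lemma facet_subset_eq: "A \<in> facets \<Delta> \<Longrightarrow> B \<in> facets \<Delta> \<Longrightarrow> A \<subseteq> B \<Longrightarrow> A = B"
  unfolding facets_def by blast

text \<open>
  Facets form an antichain, so none of them is lost when a subset of them generates a complex.
\<close>

lemma facets_generated_complex:
  assumes "S \<subseteq> facets \<Delta>" shows "facets (generated_complex S) = S"
proof
  show "facets (generated_complex S) \<subseteq> S"
    unfolding facets_def generated_complex_def by blast
  show "S \<subseteq> facets (generated_complex S)"
  proof
    fix A assume A: "A \<in> S"
    have "C = A" if "C \<in> generated_complex S" "A \<subseteq> C" for C
    proof -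
      obtain B where B: "B \<in> S" "C \<subseteq> B" using \<open>C \<in> generated_complex S\<close> unfolding generated_complex_def by blast
      have "A = B" by (rule facet_subset_eq[of _ \<Delta>]) (use A B that assms in auto)
      then show ?thesis using that(2) B(2) by blast
    qed
    moreover have "A \<in> generated_complex S" using A unfolding generated_complex_def by blast
    ultimately show "A \<in> facets (generated_complex S)" unfolding facets_def by simp
  qed
qed

lemma facet_above:
  fixes \<Delta> :: "'n::finite set set"
  assumes "A \<in> \<Delta>" shows "\<exists>G\<in>facets \<Delta>. A \<subseteq> G"
proof -
  have "finite {B \<in> \<Delta>. A \<subseteq> B}" by simp
  from finite_has_maximal2[OF this, of A] assms
  obtain G where G: "G \<in> {B \<in> \<Delta>. A \<subseteq> B}" "\<forall>B\<in>{B \<in> \<Delta>. A \<subseteq> B}. G \<subseteq> B \<longrightarrow> G = B" by auto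
  then have "G \<in> facets \<Delta>" unfolding facets_def by blast
  then show ?thesis using G(1) by blast
qed

text \<open>
  Start at a facet of largest size \<open>d\<close>. If a facet meets a facet of size \<open>d\<close> in \<open>d - 1\<close> elements and had fewer
  than \<open>d\<close> elements itself, it would be contained in the other one.
\<close>

lemma strongly_connected_pure:
  fixes \<Delta> :: "'n::finite set set"
  assumes "simplicial_complex \<Delta>" "strongly_connected \<Delta>"
  shows "Max (card ` \<Delta>) \<ge> 1" "A \<in> facets \<Delta> \<Longrightarrow> card A = Max (card ` \<Delta>)"
proof -
  let ?d = "Max (card ` \<Delta>)"
  have fin: "finite (card ` \<Delta>)" by simp
  obtain v :: 'n where True by simp
  have v: "{v} \<in> \<Delta>" using assms(1) unfolding simplicial_complex_def by blast
  then have "card {v} \<in> card ` \<Delta>" by (rule imageI)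
  from Max_ge[OF fin this] show "?d \<ge> 1" by simp
  have le: "card B \<le> ?d" if "B \<in> \<Delta>" for B using Max_ge[OF fin] that by blast
  have "?d \<in> card ` \<Delta>" using v by (intro Max_in[OF fin]) blast
  then obtain D where D: "D \<in> \<Delta>" "card D = ?d" by auto
  obtain G where G: "G \<in> facets \<Delta>" "D \<subseteq> G" using facet_above[OF D(1)] by blast
  have G\<Delta>: "G \<in> \<Delta>" using G(1) unfolding facets_def by blast
  have cG: "card G = ?d" using le[OF G\<Delta>] card_mono[OF _ G(2)] D(2) by simp
  assume A: "A \<in> facets \<Delta>"
  have "(\<lambda>A B. A \<in> facets \<Delta> \<and> B \<in> facets \<Delta> \<and> card (A \<inter> B) = ?d - 1)\<^sup>*\<^sup>* G A"
    using assms(2) G(1) A unfolding strongly_connected_def by blast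
  then show "card A = ?d"
  proof induction
    case base
    show ?case by (rule cG)
  next
    case (step B C)
    then have BC: "B \<in> facets \<Delta>" "C \<in> facets \<Delta>" "card (B \<inter> C) = ?d - 1" "card B = ?d" by blast+
    have "C \<in> \<Delta>" using BC(2) unfolding facets_def by blast
    then have "card C \<le> ?d" by (rule le)
    show ?case
    proof (rule ccontr)
      assume "card C \<noteq> ?d"
      then have "card C \<le> card (B \<inter> C)" using \<open>card C \<le> ?d\<close> BC(3) by simp
      then have "B \<inter> C = C" by (intro card_seteq) auto
      then have "C = B" using facet_subset_eq[OF BC(2,1)] by blast
      then show False using BC(4) \<open>card C \<noteq> ?d\<close> by simp
    qed
  qed
qed

lemma (in branch_order) outward_antimono_if_directed:
  assumes dir: "\<And>A B. A \<in> set Gs \<Longrightarrow> B \<in> set Gs \<Longrightarrow>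
      (Some A, Some B) \<in> directed_away (contracted_tree (set Gs, edges) i) None \<Longrightarrow> f B \<le> f A"
  shows "outward_antimono f i"
  unfolding outward_antimono_def
proof (intro allI impI)
  fix p G k l
  assume p: "tree_path p" and ip: "\<forall>x\<in>set p. i \<notin> x" and G: "G \<in> set Gs" "i \<in> G" "{hd p, G} \<in> edges"
    and kl: "k \<le> l" "l < length p"
  have pG: "p \<noteq> []" "distinct p" "set p \<subseteq> set Gs" "successively (\<lambda>x y. {x, y} \<in> edges) p"
    using p by (simp_all add: tree_path_def)
  let ?T = "contracted_tree (set Gs, edges) i"
  have step: "f (p ! Suc k) \<le> f (p ! k)" if k: "Suc k < length p" for k
  proof (rule dir)
    have pk: "p ! j \<in> set p" if "j < length p" for j using that by simp
    show "p ! k \<in> set Gs" "p ! Suc k \<in> set Gs" using pk pG(3) k Suc_lessD[OF k] by blast+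
    let ?q = "None # map Some (take k p)"
    have q: "?q @ [Some (p ! k), Some (p ! Suc k)] = None # map Some (take (Suc (Suc k)) p)"
      using k by (simp add: take_Suc_conv_app_nth)
    have "graph_path ?T (None # map Some (take (Suc (Suc k)) p))"
      unfolding graph_path_def
    proof (intro conjI allI impI)
      show "None # map Some (take (Suc (Suc k)) p) \<noteq> []" by simp
      show "distinct (None # map Some (take (Suc (Suc k)) p))"
        using pG(2) by (auto simp: distinct_map)
      show "set (None # map Some (take (Suc (Suc k)) p)) \<subseteq> fst ?T"
        using pG(3) ip set_take_subset[of "Suc (Suc k)" p] by (auto simp: contracted_tree_def)
      fix t assume t: "Suc t < length (None # map Some (take (Suc (Suc k)) p))"
      show "{(None # map Some (take (Suc (Suc k)) p)) ! t, (None # map Some (take (Suc (Suc k)) p)) ! Suc t} \<in> snd ?T"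
      proof (cases t)
        case 0
        have "hd p \<in> set Gs" "i \<notin> hd p" using pG(1,3) ip by auto
        then have "{None, Some (hd p)} \<in> snd ?T" using G unfolding contracted_tree_def by auto
        then show ?thesis using 0 pG(1) k by (simp add: hd_conv_nth)
      next
        case (Suc u)
        then have u: "Suc u < length p" "Suc u < Suc (Suc k)" using t by auto
        have "{p ! u, p ! Suc u} \<in> edges" using successively_nth[OF pG(4) u(1)] .
        moreover have "i \<notin> p ! u" "i \<notin> p ! Suc u" using ip u(1) by simp_all
        ultimately have "{Some (p ! u), Some (p ! Suc u)} \<in> snd ?T" unfolding contracted_tree_def by auto
        then show ?thesis using Suc u by simp
      qed
    qed
    then show "(Some (p ! k), Some (p ! Suc k)) \<in> directed_away ?T None"
      unfolding directed_away_def q[symmetric]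
      by (intro CollectI case_prodI exI[of _ ?q] conjI) simp_all
  qed
  show "f (p ! l) \<le> f (p ! k)"
    using kl
  proof (induction l rule: dec_induct)
    case base show ?case by simp
  next
    case (step m)
    then have "f (p ! Suc m) \<le> f (p ! m)" by (intro \<open>\<And>k. Suc k < length p \<Longrightarrow> f (p ! Suc k) \<le> f (p ! k)\<close>)
    then show ?case using step by simp
  qed
qed

theorem theorem4p8:
  fixes \<Delta> :: "'n::finite set set"
    and F :: "nat \<Rightarrow> 'n set"
    and m :: nat
    and \<alpha> :: "'n \<Rightarrow> nat \<Rightarrow> nat"
  assumes "quasi_tree \<Delta>"
    and "strongly_connected \<Delta>"
    and "bij_betw F {1..m} (facets \<Delta>)"
    and "\<And>i j. j \<in> {1..m} \<Longrightarrow> i \<notin> F j \<Longrightarrow> \<alpha> i j > 0"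
    and "satisfying \<Delta> F m \<alpha>"
  shows "cohen_macaulay
           (mpoly_ring Quot (complex_ideal F m \<alpha> :: ('n, 'k::field) mpoly set))"
proof -
  have sc: "simplicial_complex \<Delta>" using assms(1) unfolding quasi_tree_def quasi_forest_def by blast
  let ?d = "Max (card ` \<Delta>)"
  note d1 = strongly_connected_pure(1)[OF sc assms(2)] and pure = strongly_connected_pure(2)[OF sc assms(2)]
  from assms(5) obtain T where "relation_tree \<Delta> T" and T_sat: "\<forall>i. \<forall>h\<in>{1..m}. \<forall>l\<in>{1..m}.
           (Some (F h), Some (F l)) \<in> directed_away (contracted_tree T i) None \<longrightarrow> \<alpha> i h \<ge> \<alpha> i l"
    unfolding satisfying_def by blast
  then obtain Gs br where lo: "leaf_order \<Delta> Gs"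
    and br: "\<And>t. 1 \<le> t \<Longrightarrow> t < length Gs \<Longrightarrow>
           is_branch (generated_complex (set (take (Suc t) Gs))) (Gs ! t) (br t)"
    and T: "T = (facets \<Delta>, {{Gs ! t, br t} | t. 1 \<le> t \<and> t < length Gs})"
    unfolding relation_tree_def by blast
  have dist: "distinct Gs" and setG: "set Gs = facets \<Delta>" using lo unfolding leaf_order_def by blast+
  have br': "br t \<in> set (take t Gs) \<and> (\<forall>H\<in>set (take t Gs). H \<inter> Gs ! t \<subseteq> br t)" if t: "1 \<le> t" "t < length Gs" for t
  proof -
    have tk: "set (take (Suc t) Gs) = insert (Gs ! t) (set (take t Gs))" using t by (simp add: take_Suc_conv_app_nth)
    have fg: "facets (generated_complex (set (take (Suc t) Gs))) = set (take (Suc t) Gs)"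
      by (rule facets_generated_complex[of _ \<Delta>]) (use setG set_take_subset[of "Suc t" Gs] in blast)
    have "distinct (take (Suc t) Gs)" using dist by simp
    then have new: "Gs ! t \<notin> set (take t Gs)" using t by (simp add: take_Suc_conv_app_nth)
    have 1: "br t \<in> set (take (Suc t) Gs)" "br t \<noteq> Gs ! t"
      "\<And>H. H \<in> set (take (Suc t) Gs) \<Longrightarrow> H \<noteq> Gs ! t \<Longrightarrow> H \<inter> Gs ! t \<subseteq> br t \<inter> Gs ! t"
      using br[OF t] unfolding is_branch_def fg by blast+
    have "H \<inter> Gs ! t \<subseteq> br t" if H: "H \<in> set (take t Gs)" for H
    proof -
      have "H \<noteq> Gs ! t" using H new by metis
      then show ?thesis using 1(3)[of H] H tk by blast
    qed
    then show ?thesis using 1(1,2) tk by blast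
  qed
  interpret B: branch_order Gs br
    by unfold_locales (use dist br' in blast)+
  have T': "T = (set Gs, B.edges)" unfolding T setG B.edges_def ..
  \<comment> \<open>The given numbering of the facets need not follow the leaf order; \<open>ix\<close> translates.\<close>
  define ix where "ix = the_inv_into {1..m} F"
  have inj: "inj_on F {1..m}" and img: "F ` {1..m} = set Gs" using assms(3) setG unfolding bij_betw_def by auto
  have ix: "ix G \<in> {1..m}" "F (ix G) = G" if "G \<in> set Gs" for G
  proof -
    have "G \<in> F ` {1..m}" using that img by simp
    then show "ix G \<in> {1..m}" "F (ix G) = G"
      unfolding ix_def by (rule the_inv_into_into[OF inj _ subset_refl], rule f_the_inv_into_f[OF inj])
  qed
  have anti: "B.outward_antimono (\<lambda>G. \<alpha> i (ix G)) i" for i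
  proof (rule B.outward_antimono_if_directed)
    fix A C assume AC: "A \<in> set Gs" "C \<in> set Gs"
      "(Some A, Some C) \<in> directed_away (contracted_tree (set Gs, B.edges) i) None"
    then have "(Some (F (ix A)), Some (F (ix C))) \<in> directed_away (contracted_tree T i) None"
      using ix(2) unfolding T' by simp
    then show "\<alpha> i (ix C) \<le> \<alpha> i (ix A)" using T_sat ix(1) AC(1,2) by blast
  qed
  have conn: "(B.adj ?d (set Gs))\<^sup>*\<^sup>* A C" if "A \<in> set Gs" "C \<in> set Gs" for A C
  proof -
    have "B.adj ?d (set Gs) = (\<lambda>A B. A \<in> facets \<Delta> \<and> B \<in> facets \<Delta> \<and> card (A \<inter> B) = ?d - 1)"
      by (intro ext) (simp add: B.adj_def setG)
    then show ?thesis using assms(2) that unfolding strongly_connected_def setG by simp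
  qed
  have cards: "card A = ?d" if "A \<in> set Gs" for A using pure that setG by blast
  define w where "w t = (SOME x. x \<in> Gs ! t - br t)" for t
  have w: "Gs ! t - br t = {w t}" if t: "1 \<le> t" "t < length Gs" for t
  proof -
    obtain x where "Gs ! t - br t = {x}"
      using B.card_branch_meet[OF cards d1 conn t] by (auto simp: card_1_singleton_iff)
    then show ?thesis unfolding w_def by simp
  qed
  have ne: "Gs \<noteq> []"
  proof
    assume "Gs = []"
    obtain v :: 'n where True by simp
    have "{v} \<in> \<Delta>" using sc unfolding simplicial_complex_def by blast
    from facet_above[OF this] show False using setG \<open>Gs = []\<close> by simp
  qed
  have bi: "B.branch_index t < t" "Gs ! B.branch_index t = br t" if "1 \<le> t" "t < length Gs" for t
    using B.branch_index[OF that] by simp_all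
  interpret O: facet_order Gs B.branch_index w "\<lambda>i t. \<alpha> i (ix (Gs ! t))"
  proof
    show "Gs \<noteq> []" by (rule ne)
    show "card (Gs ! t) = card (Gs ! 0)" if "t < length Gs" for t
      using cards[of "Gs ! t"] cards[of "Gs ! 0"] that ne by simp
    fix t assume t: "1 \<le> t" "t < length Gs"
    have wt: "w t \<in> Gs ! t" "w t \<notin> br t" using w[OF t] by blast+
    show "B.branch_index t < t" by (rule bi(1)[OF t])
    show "w t \<in> Gs ! t" by (rule wt(1))
    show "Gs ! t - {w t} \<subseteq> Gs ! B.branch_index t" unfolding bi(2)[OF t] using w[OF t] by blast
    show "w t \<notin> Gs ! j" if "j < t" for j
      by (rule B.exponent_new_vertex(1)[OF anti t wt that])
    show "\<alpha> (w t) (ix (Gs ! j)) \<le> \<alpha> (w t) (ix (Gs ! B.branch_index t))" if "j < t" for j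
      unfolding bi(2)[OF t] by (rule B.exponent_new_vertex(2)[OF anti t wt that])
    show "\<alpha> i (ix (Gs ! t)) \<le> \<alpha> i (ix (Gs ! B.branch_index t)) \<or>
        (\<forall>j<t. i \<notin> Gs ! j \<and> \<alpha> i (ix (Gs ! j)) \<le> \<alpha> i (ix (Gs ! B.branch_index t)))"
      if i: "i \<notin> Gs ! t" "i \<notin> Gs ! B.branch_index t" for i
    proof -
      have "{i} \<in> \<Delta>" using sc unfolding simplicial_complex_def by blast
      then have "\<exists>G\<in>set Gs. i \<in> G" using facet_above[of "{i}" \<Delta>] setG by auto
      then show ?thesis using B.exponent_old_vertex[OF anti t i[unfolded bi(2)[OF t]]] unfolding bi(2)[OF t] by blast
    qed
  qed
  have "complex_ideal F m \<alpha> = (\<Inter>t<length Gs. idl (pow_gens (- (Gs ! t)) (\<lambda>i. \<alpha> i (ix (Gs ! t)))) :: ('n, 'k) mpoly set)"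
  proof -
    have gens: "pow_gens (- F j) (\<lambda>i. \<alpha> i j) = ({poly_var i ^ \<alpha> i j | i. i \<notin> F j} :: ('n, 'k) mpoly set)" for j
      by (auto simp: pow_gens_def)
    have "ix ` set Gs = {1..m}"
    proof
      show "ix ` set Gs \<subseteq> {1..m}" using ix(1) by blast
      show "{1..m} \<subseteq> ix ` set Gs"
      proof
        fix j assume j: "j \<in> {1..m}"
        then have "ix (F j) = j" unfolding ix_def by (rule the_inv_into_f_f[OF inj])
        moreover have "F j \<in> set Gs" using j img by blast
        ultimately show "j \<in> ix ` set Gs" by (metis imageI)
      qed
    qed
    note ix_img = this
    have "complex_ideal F m \<alpha> = (\<Inter>j\<in>{1..m}. idl (pow_gens (- F j) (\<lambda>i. \<alpha> i j)) :: ('n, 'k) mpoly set)"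
      unfolding complex_ideal_def mpoly_ring_def Idl_type_ring gens ..
    also have "\<dots> = (\<Inter>G\<in>set Gs. idl (pow_gens (- F (ix G)) (\<lambda>i. \<alpha> i (ix G))))"
      unfolding ix_img[symmetric] image_image ..
    also have "\<dots> = (\<Inter>G\<in>set Gs. idl (pow_gens (- G) (\<lambda>i. \<alpha> i (ix G))))"
      using ix(2) by (intro INF_cong) simp_all
    also have "\<dots> = (\<Inter>t<length Gs. idl (pow_gens (- (Gs ! t)) (\<lambda>i. \<alpha> i (ix (Gs ! t)))))"
      unfolding set_conv_nth by auto
    finally show ?thesis .
  qed
  then show ?thesis by (simp only: O.cohen_macaulay_quotient)
qed

end
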